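(* Let $G$ be a finite group. Then $C^*(G)$, with the $G$-grading given by $C^*(G)_g = \mathbb{C} u_g$ for $g \in G$, where $u_g \in C^*(G)$ is the unitary corresponding to $g$, is graded semiprojective.
   Context: Let $G$ be a finite group. A $G$-grading on a C*-algebra $A$ is a direct sum decomposition as Banach spaces $A = \bigoplus_{g \in G} A_g$ such that if $g, h \in G$, $a \in A_g$, and $b \in A_h$, then $ab \in A_{gh}$ and $a^* \in A_{g^{-1}}$ (the direct sum norm is only required to be equivalent to the norm of $A$). A subspace $E \subset A$ is graded if $E = \sum_{g \in G} (E \cap A_g)$. A homomorphism $\varphi \colon A \to B$ ($*$-homomorphism) of $G$-graded C*-algebras is graded if $\varphi(A_g) \subset B_g$ for all $g \in G$. If $I \subset A$ is a graded (closed two-sided) ideal, then $A/I$ is $G$-graded by $(A/I)_g = (A_g + I)/I$. A $G$-graded C*-algebra $A$ is graded semiprojective if whenever $C$ is a C*-algebra with $G$-grading $C = \bigoplus_{g \in G} C_g$, $J_0 \subset J_1 \subset \cdots$ are graded ideals in $C$, $J = \overline{\bigcup_{n=0}^{\infty} J_n}$, and $\varphi \colon A \to C/J$ is a graded homomorphism, then there exist $n$ and a graded homomorphism $\psi \colon A \to C/J_n$ such that the composition $A \xrightarrow{\psi} C/J_n \to C/J$ (the second map being the quotient map) equals $\varphi$. *)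

theory Defs
  imports "HOL-Analysis.Analysis" "HOL-Algebra.Module" "HOL-Algebra.QuotRing"
begin

section \<open>C*-algebras\<close>

definition complex_ring :: "complex ring" where
  "complex_ring = \<lparr>carrier = UNIV, mult = (*), one = 1, zero = 0, add = (+)\<rparr>"

text \<open>
  C*-algebras are not assumed to be unital. Extending the records of HOL-Algebra gives access to
  \<^const>\<open>finsum\<close>, cosets and submodules, but the record field \<^const>\<open>one\<close> inherited from there carries
  no meaning and is never used below. Addition, zero and scalar multiplication of a complex vector
  space \<open>A\<close> are governed by the locale \<open>Module.module complex_ring A\<close>, which does not mention the
  fields \<^const>\<open>one\<close> and \<^const>\<open>mult\<close> of \<open>A\<close>.
\<close>

record 'a star_algebra = "(complex, 'a) module" +
  adj :: "'a \<Rightarrow> 'a"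

record 'a cstar_algebra = "'a star_algebra" +
  nrm :: "'a \<Rightarrow> real"

locale star_algebra = Module.module complex_ring A
  for A :: "('a, 'm) star_algebra_scheme" (structure) +
  assumes mult_closed:
      "\<lbrakk>x \<in> carrier A; y \<in> carrier A\<rbrakk> \<Longrightarrow> x \<otimes> y \<in> carrier A"
    and mult_assoc:
      "\<lbrakk>x \<in> carrier A; y \<in> carrier A; z \<in> carrier A\<rbrakk> \<Longrightarrow> (x \<otimes> y) \<otimes> z = x \<otimes> (y \<otimes> z)"
    and mult_add_left:
      "\<lbrakk>x \<in> carrier A; y \<in> carrier A; z \<in> carrier A\<rbrakk> \<Longrightarrow> (x \<oplus> y) \<otimes> z = x \<otimes> z \<oplus> y \<otimes> z"
    and mult_add_right:
      "\<lbrakk>x \<in> carrier A; y \<in> carrier A; z \<in> carrier A\<rbrakk> \<Longrightarrow> x \<otimes> (y \<oplus> z) = x \<otimes> y \<oplus> x \<otimes> z"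
    and mult_smult_left:
      "\<lbrakk>x \<in> carrier A; y \<in> carrier A\<rbrakk> \<Longrightarrow> (c \<odot> x) \<otimes> y = c \<odot> (x \<otimes> y)"
    and mult_smult_right:
      "\<lbrakk>x \<in> carrier A; y \<in> carrier A\<rbrakk> \<Longrightarrow> x \<otimes> (c \<odot> y) = c \<odot> (x \<otimes> y)"
    and adj_closed:
      "x \<in> carrier A \<Longrightarrow> adj A x \<in> carrier A"
    and adj_adj:
      "x \<in> carrier A \<Longrightarrow> adj A (adj A x) = x"
    and adj_add:
      "\<lbrakk>x \<in> carrier A; y \<in> carrier A\<rbrakk> \<Longrightarrow> adj A (x \<oplus> y) = adj A x \<oplus> adj A y"
    and adj_smult:
      "x \<in> carrier A \<Longrightarrow> adj A (c \<odot> x) = cnj c \<odot> adj A x"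
    and adj_mult:
      "\<lbrakk>x \<in> carrier A; y \<in> carrier A\<rbrakk> \<Longrightarrow> adj A (x \<otimes> y) = adj A y \<otimes> adj A x"

definition cstar_seminorm :: "('a, 'm) star_algebra_scheme \<Rightarrow> ('a \<Rightarrow> real) \<Rightarrow> bool" where
  "cstar_seminorm A p \<longleftrightarrow>
    (\<forall>x\<in>carrier A. \<forall>y\<in>carrier A. p (x \<oplus>\<^bsub>A\<^esub> y) \<le> p x + p y) \<and>
    (\<forall>c. \<forall>x\<in>carrier A. p (c \<odot>\<^bsub>A\<^esub> x) = cmod c * p x) \<and>
    (\<forall>x\<in>carrier A. \<forall>y\<in>carrier A. p (x \<otimes>\<^bsub>A\<^esub> y) \<le> p x * p y) \<and>
    (\<forall>x\<in>carrier A. p (adj A x \<otimes>\<^bsub>A\<^esub> x) = (p x)\<^sup>2)"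

text \<open>
  The distance is cut off outside of the carrier because the locale \<^locale>\<open>Metric_space\<close> requires
  nonnegativity and symmetry for all elements of the type.
\<close>

definition ndist :: "('a, 'm) cstar_algebra_scheme \<Rightarrow> 'a \<Rightarrow> 'a \<Rightarrow> real" where
  "ndist A x y = (if x \<in> carrier A \<and> y \<in> carrier A then nrm A (x \<ominus>\<^bsub>A\<^esub> y) else 0)"

abbreviation ntopology :: "('a, 'm) cstar_algebra_scheme \<Rightarrow> 'a topology" where
  "ntopology A \<equiv> Metric_space.mtopology (carrier A) (ndist A)"

locale cstar_algebra = star_algebra A
  for A :: "('a, 'm) cstar_algebra_scheme" (structure) +
  assumes nrm_seminorm: "cstar_seminorm A (nrm A)"
    and nrm_eq_zero: "\<lbrakk>x \<in> carrier A; nrm A x = 0\<rbrakk> \<Longrightarrow> x = \<zero>"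
    and complete: "Metric_space.mcomplete (carrier A) (ndist A)"

section \<open>Closed ideals, quotients and homomorphisms\<close>

definition closed_ideal :: "('a, 'm) cstar_algebra_scheme \<Rightarrow> 'a set \<Rightarrow> bool" where
  "closed_ideal A I \<longleftrightarrow>
    submodule I complex_ring A \<and> closedin (ntopology A) I \<and>
    (\<forall>a\<in>carrier A. \<forall>x\<in>I. a \<otimes>\<^bsub>A\<^esub> x \<in> I \<and> x \<otimes>\<^bsub>A\<^esub> a \<in> I)"

text \<open>
  The elements of \<open>A/I\<close> are the cosets of \<open>I\<close>; scalar multiplication and adjoint follow the pattern
  of \<^const>\<open>rcoset_mult\<close>: the union over all representatives of the resulting coset.
\<close>

definition cstar_quot :: "('a, 'm) cstar_algebra_scheme \<Rightarrow> 'a set \<Rightarrow> 'a set cstar_algebra" where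
  "cstar_quot A I =
    \<lparr>carrier = carrier (A Quot I), mult = mult (A Quot I), one = one (A Quot I),
     zero = zero (A Quot I), add = add (A Quot I),
     smult = (\<lambda>c X. \<Union>x\<in>X. I +>\<^bsub>A\<^esub> (c \<odot>\<^bsub>A\<^esub> x)),
     adj = (\<lambda>X. \<Union>x\<in>X. I +>\<^bsub>A\<^esub> adj A x),
     nrm = (\<lambda>X. INF x\<in>X. nrm A x)\<rparr>"

text \<open>For \<open>I \<subseteq> J\<close>, the quotient map \<open>A/I \<rightarrow> A/J\<close> sends \<open>x + I\<close> to \<open>x + J = J + (x + I)\<close>.\<close>

definition quot_map :: "('a, 'm) cstar_algebra_scheme \<Rightarrow> 'a set \<Rightarrow> 'a set \<Rightarrow> 'a set" where
  "quot_map A J X = J <+>\<^bsub>A\<^esub> X"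

definition star_hom ::
  "('a, 'm) cstar_algebra_scheme \<Rightarrow> ('b, 'n) cstar_algebra_scheme \<Rightarrow> ('a \<Rightarrow> 'b) \<Rightarrow> bool" where
  "star_hom A B \<phi> \<longleftrightarrow>
    \<phi> \<in> carrier A \<rightarrow> carrier B \<and>
    (\<forall>x\<in>carrier A. \<forall>y\<in>carrier A. \<phi> (x \<oplus>\<^bsub>A\<^esub> y) = \<phi> x \<oplus>\<^bsub>B\<^esub> \<phi> y) \<and>
    (\<forall>c. \<forall>x\<in>carrier A. \<phi> (c \<odot>\<^bsub>A\<^esub> x) = c \<odot>\<^bsub>B\<^esub> \<phi> x) \<and>
    (\<forall>x\<in>carrier A. \<forall>y\<in>carrier A. \<phi> (x \<otimes>\<^bsub>A\<^esub> y) = \<phi> x \<otimes>\<^bsub>B\<^esub> \<phi> y) \<and>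
    (\<forall>x\<in>carrier A. \<phi> (adj A x) = adj B (\<phi> x))"

section \<open>Gradings by a finite group\<close>

text \<open>
  The last assumption expresses that the algebraic direct sum is one of Banach spaces. The converse
  estimate \<open>nrm (\<Sum>g. f g) \<le> (\<Sum>g. nrm (f g))\<close> always holds.
\<close>

locale graded_cstar_algebra = group G + A: cstar_algebra A
  for G :: "('g, 'k) monoid_scheme" (structure)
    and A :: "('a, 'm) cstar_algebra_scheme" +
  fixes gcomp :: "'g \<Rightarrow> 'a set"
  assumes finite_group: "finite (carrier G)"
    and gcomp_submodule: "g \<in> carrier G \<Longrightarrow> submodule (gcomp g) complex_ring A"
    and gcomp_closed: "g \<in> carrier G \<Longrightarrow> closedin (ntopology A) (gcomp g)"
    and gcomp_mult:
      "\<lbrakk>g \<in> carrier G; h \<in> carrier G; a \<in> gcomp g; b \<in> gcomp h\<rbrakk> \<Longrightarrow> a \<otimes>\<^bsub>A\<^esub> b \<in> gcomp (g \<otimes> h)"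
    and gcomp_adj:
      "\<lbrakk>g \<in> carrier G; a \<in> gcomp g\<rbrakk> \<Longrightarrow> adj A a \<in> gcomp (inv g)"
    and direct_sum:
      "a \<in> carrier A \<Longrightarrow> \<exists>!f. f \<in> (\<Pi>\<^sub>E g\<in>carrier G. gcomp g) \<and> a = finsum A f (carrier G)"
    and direct_sum_norm:
      "\<exists>K. \<forall>f\<in>(\<Pi>\<^sub>E g\<in>carrier G. gcomp g).
         (\<Sum>g\<in>carrier G. nrm A (f g)) \<le> K * nrm A (finsum A f (carrier G))"

definition graded_subspace ::
  "('g, 'k) monoid_scheme \<Rightarrow> ('a, 'm) cstar_algebra_scheme \<Rightarrow> ('g \<Rightarrow> 'a set) \<Rightarrow> 'a set \<Rightarrow> bool"
  where
  "graded_subspace G A gcomp E \<longleftrightarrow>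
    submodule E complex_ring A \<and>
    E = {finsum A f (carrier G) | f. f \<in> (\<Pi> g\<in>carrier G. E \<inter> gcomp g)}"

definition graded_ideal ::
  "('g, 'k) monoid_scheme \<Rightarrow> ('a, 'm) cstar_algebra_scheme \<Rightarrow> ('g \<Rightarrow> 'a set) \<Rightarrow> 'a set \<Rightarrow> bool"
  where
  "graded_ideal G A gcomp I \<longleftrightarrow> closed_ideal A I \<and> graded_subspace G A gcomp I"

text \<open>\<open>(A/I)\<^sub>g = (A\<^sub>g + I)/I\<close> consists of the cosets of the elements of \<open>A\<^sub>g\<close>.\<close>

definition quot_comp ::
  "('a, 'm) cstar_algebra_scheme \<Rightarrow> ('g \<Rightarrow> 'a set) \<Rightarrow> 'a set \<Rightarrow> 'g \<Rightarrow> 'a set set" where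
  "quot_comp A gcomp I g = (\<lambda>x. I +>\<^bsub>A\<^esub> x) ` gcomp g"

definition graded_hom ::
  "('g, 'k) monoid_scheme \<Rightarrow>
    ('a, 'm) cstar_algebra_scheme \<Rightarrow> ('g \<Rightarrow> 'a set) \<Rightarrow>
    ('b, 'n) cstar_algebra_scheme \<Rightarrow> ('g \<Rightarrow> 'b set) \<Rightarrow> ('a \<Rightarrow> 'b) \<Rightarrow> bool" where
  "graded_hom G A compA B compB \<phi> \<longleftrightarrow>
    star_hom A B \<phi> \<and> (\<forall>g\<in>carrier G. \<phi> ` compA g \<subseteq> compB g)"

text \<open>
  HOL cannot quantify over types inside a definition, so the type in which the test algebras \<open>C\<close>
  live is a parameter. The carrier of \<open>C\<close> may be any subset of \<^typ>\<open>'c\<close>; a statement about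
  \<^term>\<open>graded_semiprojective TYPE('c)\<close> with \<^typ>\<open>'c\<close> a type variable covers all C*-algebras.
\<close>

definition graded_semiprojective ::
  "'c itself \<Rightarrow>
    ('g, 'k) monoid_scheme \<Rightarrow> ('a, 'm) cstar_algebra_scheme \<Rightarrow> ('g \<Rightarrow> 'a set) \<Rightarrow> bool" where
  "graded_semiprojective (_ :: 'c itself) G A compA \<longleftrightarrow>
    graded_cstar_algebra G A compA \<and>
    (\<forall>(C :: 'c cstar_algebra) compC (Jn :: nat \<Rightarrow> 'c set) J \<phi>.
      graded_cstar_algebra G C compC \<longrightarrow>
      (\<forall>n. graded_ideal G C compC (Jn n)) \<longrightarrow>
      (\<forall>n. Jn n \<subseteq> Jn (Suc n)) \<longrightarrow>
      J = ntopology C closure_of (\<Union>n. Jn n) \<longrightarrow>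
      graded_hom G A compA (cstar_quot C J) (quot_comp C compC J) \<phi> \<longrightarrow>
      (\<exists>n \<psi>. graded_hom G A compA (cstar_quot C (Jn n)) (quot_comp C compC (Jn n)) \<psi> \<and>
        (\<forall>a\<in>carrier A. quot_map C J (\<psi> a) = \<phi> a)))"

section \<open>The C*-algebra of a finite group\<close>

definition group_unitary :: "'g \<Rightarrow> 'g \<Rightarrow> complex" where
  "group_unitary g = (\<lambda>x. if x = g then 1 else 0)"

text \<open>
  The group algebra: functions on \<open>G\<close> (extended by zero outside of the carrier) with convolution
  and \<open>f\<^sup>*(x) = cnj (f (x\<inverse>))\<close>, so that \<open>u\<^sub>g u\<^sub>h = u\<^sub>g\<^sub>h\<close> and \<open>u\<^sub>g\<^sup>* = u\<^sub>g\<^sup>-\<^sup>1\<close>.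
\<close>

definition group_star_algebra :: "('g, 'k) monoid_scheme \<Rightarrow> ('g \<Rightarrow> complex) star_algebra" where
  "group_star_algebra G =
    \<lparr>carrier = {f. \<forall>x. x \<notin> carrier G \<longrightarrow> f x = 0},
     mult = (\<lambda>f h x. if x \<in> carrier G
                      then \<Sum>y\<in>carrier G. f y * h (inv\<^bsub>G\<^esub> y \<otimes>\<^bsub>G\<^esub> x) else 0),
     one = group_unitary \<one>\<^bsub>G\<^esub>,
     zero = (\<lambda>x. 0),
     add = (\<lambda>f h x. f x + h x),
     smult = (\<lambda>c f x. c * f x),
     adj = (\<lambda>f x. if x \<in> carrier G then cnj (f (inv\<^bsub>G\<^esub> x)) else 0)\<rparr>"

text \<open>
  \<open>C\<^sup>*(G)\<close> is the enveloping C*-algebra of the group algebra: its norm is the largest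
  C*-seminorm, equivalently the supremum of \<open>\<parallel>\<pi>(f)\<parallel>\<close> over all *-representations \<open>\<pi>\<close>. For finite
  \<open>G\<close> the group algebra is already separated and complete in this norm, so no quotient or
  completion is taken.
\<close>

definition group_cstar_algebra :: "('g, 'k) monoid_scheme \<Rightarrow> ('g \<Rightarrow> complex) cstar_algebra" where
  "group_cstar_algebra G =
    star_algebra.extend (group_star_algebra G)
      (cstar_algebra.fields (\<lambda>f. SUP p\<in>Collect (cstar_seminorm (group_star_algebra G)). p f))"

definition group_cstar_comp :: "('g, 'k) monoid_scheme \<Rightarrow> 'g \<Rightarrow> ('g \<Rightarrow> complex) set" where
  "group_cstar_comp G g = {c \<odot>\<^bsub>group_cstar_algebra G\<^esub> group_unitary g | c. True}"

end

theory Submission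
  imports Defs
begin

text \<open>
  A graded homomorphism \<open>C\<^sup>*(G) \<rightarrow> C/J\<close> is given by \<open>v\<^sub>g \<in> C\<^sub>g\<close> with \<open>v\<^sub>g v\<^sub>h \<equiv> v\<^sub>g\<^sub>h\<close> and
  \<open>v\<^sub>g\<^sup>* \<equiv> v\<^bsub>g\<inverse>\<^esub>\<close> modulo \<open>J\<close>. For large \<open>n\<close> these relations hold approximately modulo \<open>J\<^sub>n\<close>. They are
  then made exact modulo \<open>J\<^sub>n\<close> by a Newton iteration: the defect \<open>v\<^sub>g\<^sub>h - v\<^sub>g v\<^sub>h\<close> is almost a
  Hochschild 2-cocycle, hence, by averaging over \<open>G\<close>, almost a coboundary, and subtracting this
  coboundary squares the order of magnitude of the defect. Each term \<open>v\<^sub>h (v\<^bsub>h\<inverse>g\<^esub> - v\<^bsub>h\<inverse>\<^esub> v\<^sub>g)\<close> of the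
  average lies in \<open>C\<^sub>g\<close>, so the correction is homogeneous, and it lies in \<open>J\<close> since the defect does.
  No functional calculus is needed.
\<close>

section \<open>Linear identities in star algebras\<close>

text \<open>The Newton steps become exact only in the limit, and this limit has to meet three
  demands at once: exact relations modulo one \<open>Jn n\<close>, homogeneity, and congruence
  modulo \<open>J\<close> to the family one started from. Convergence is known only for quotient
  norms, whereas homogeneity is a property of elements of \<open>C\<close>. So no quotient algebra
  is analysed: all estimates concern seminorms on \<open>C\<close> itself, one for
  \<open>Jn n\<close>, under which the defect tends to zero, and one for \<open>J\<close>, under
  which it is zero from the start. Each increment is then replaced by a homogeneous representative
  of comparable norm, which exists because the projections to the components are bounded and
  preserve graded ideals, and the resulting series converges in \<open>C\<close>. The relation with
  the adjoint is made exact before the iteration and kept exact by it, so only multiplicativity has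
  to be repaired. Closed ideals are not self-adjoint by definition, so this has to be proved first;
  otherwise the adjoint would not pass to the quotients.\<close>

context star_algebra
begin

lemma smult_cl [simp, intro]: "x \<in> carrier A \<Longrightarrow> c \<odot> x \<in> carrier A"
  by (rule smult_closed) (simp_all add: complex_ring_def)

lemma smult_add_left: "x \<in> carrier A \<Longrightarrow> (c + d) \<odot> x = c \<odot> x \<oplus> d \<odot> x"
  using smult_l_distr[of c d x] by (simp add: complex_ring_def)

lemma smult_add_right: "\<lbrakk>x \<in> carrier A; y \<in> carrier A\<rbrakk> \<Longrightarrow> c \<odot> (x \<oplus> y) = c \<odot> x \<oplus> c \<odot> y"
  by (rule smult_r_distr) (simp_all add: complex_ring_def)

lemma smult_smult [simp]: "x \<in> carrier A \<Longrightarrow> c \<odot> (d \<odot> x) = (c * d) \<odot> x"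
  using smult_assoc1[of c d x] by (simp add: complex_ring_def)

lemma smult_1 [simp]: "x \<in> carrier A \<Longrightarrow> 1 \<odot> x = x"
  using smult_one[of x] by (simp add: complex_ring_def)

lemma smult_0 [simp]: "x \<in> carrier A \<Longrightarrow> 0 \<odot> x = \<zero>"
  using smult_l_null[of x] by (simp add: complex_ring_def)

lemma smult_zero [simp]: "c \<odot> \<zero> = \<zero>"
  using smult_r_null[of c] by (simp add: complex_ring_def)

lemma smult_neg1: "x \<in> carrier A \<Longrightarrow> \<ominus> x = (-1) \<odot> x"
  using smult_add_left[of x 1 "-1"] by (metis M.minus_equality M.a_comm smult_0 smult_1 smult_cl add.right_inverse)

declare mult_closed [simp, intro] adj_closed [simp, intro] adj_adj [simp]

lemma minus_smult: "\<lbrakk>x \<in> carrier A; y \<in> carrier A\<rbrakk> \<Longrightarrow> x \<ominus> y = x \<oplus> (-1) \<odot> y"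
  by (simp add: a_minus_def smult_neg1)

lemma minus_cl [simp, intro]: "\<lbrakk>x \<in> carrier A; y \<in> carrier A\<rbrakk> \<Longrightarrow> x \<ominus> y \<in> carrier A"
  by (simp add: a_minus_def)

lemma mult_zero_left [simp]: "x \<in> carrier A \<Longrightarrow> \<zero> \<otimes> x = \<zero>"
  using mult_smult_left[of x x 0] by simp

lemma mult_zero_right [simp]: "x \<in> carrier A \<Longrightarrow> x \<otimes> \<zero> = \<zero>"
  using mult_smult_right[of x x 0] by simp

lemma adj_zero [simp]: "adj A \<zero> = \<zero>"
  using adj_smult[of \<zero> 0] by simp

lemma smult_adj [simp]: "x \<in> carrier A \<Longrightarrow> adj A (c \<odot> x) = cnj c \<odot> adj A x"
  by (rule adj_smult)

text \<open>Collects equal neighbours once \<open>alg\<close> has bracketed a sum to the right,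
  hence the variants with a tail \<open>y\<close>. Proofs that split coefficients remove these
  rules, since they undo \<open>smult_add_left\<close>.\<close>

lemma smult_collect [simp]:
  "x \<in> carrier A \<Longrightarrow> c \<odot> x \<oplus> d \<odot> x = (c + d) \<odot> x"
  "\<lbrakk>x \<in> carrier A; y \<in> carrier A\<rbrakk> \<Longrightarrow> c \<odot> x \<oplus> (d \<odot> x \<oplus> y) = (c + d) \<odot> x \<oplus> y"
  "x \<in> carrier A \<Longrightarrow> x \<oplus> d \<odot> x = (1 + d) \<odot> x"
  "\<lbrakk>x \<in> carrier A; y \<in> carrier A\<rbrakk> \<Longrightarrow> x \<oplus> (d \<odot> x \<oplus> y) = (1 + d) \<odot> x \<oplus> y"
  "x \<in> carrier A \<Longrightarrow> x \<oplus> x = 2 \<odot> x"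
  "\<lbrakk>x \<in> carrier A; y \<in> carrier A\<rbrakk> \<Longrightarrow> x \<oplus> (x \<oplus> y) = 2 \<odot> x \<oplus> y"
  using smult_add_left[of x 1 d] smult_add_left[of x 1 1] 
  by (simp_all add: smult_add_left M.a_assoc[symmetric])

text \<open>Expands an expression into a right-nested sum of scalar multiples of monomials. The
  order of the summands is left to \<open>linear_identity\<close> or to
  \<open>M.a_ac\<close>.\<close>

lemmas alg = minus_smult smult_add_right M.a_assoc mult_add_left mult_add_right mult_assoc
  mult_smult_left mult_smult_right adj_add adj_mult

lemma diff_eq_iff: "\<lbrakk>x \<in> carrier A; y \<in> carrier A; z \<in> carrier A\<rbrakk> \<Longrightarrow> x \<ominus> y = z \<longleftrightarrow> x = z \<oplus> y"
  by (metis M.add.inv_solve_right a_minus_def minus_cl)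

lemma diff_zero_iff: "\<lbrakk>x \<in> carrier A; y \<in> carrier A\<rbrakk> \<Longrightarrow> x \<ominus> y = \<zero> \<longleftrightarrow> x = y"
  by (simp add: diff_eq_iff)


text \<open>
  Equations between linear combinations are proved by comparing coefficients as functions on the
  underlying type. Rewriting with the laws of addition does not suffice, because the term order does
  not place \<open>x\<close> next to \<open>- x\<close>.
\<close>

definition lincomb :: "('a \<Rightarrow> complex) \<Rightarrow> 'a" where
  "lincomb F = finsum A (\<lambda>x. F x \<odot> x) {x. F x \<noteq> 0}"

text \<open>A relation rather than a function: the coefficients \<open>F\<close> start as a
  schematic variable and are assembled by unification from the shape of \<open>s\<close>.\<close>

definition represents :: "('a \<Rightarrow> complex) \<Rightarrow> 'a \<Rightarrow> bool" where
  "represents F s \<longleftrightarrow> finite {x. F x \<noteq> 0} \<and> {x. F x \<noteq> 0} \<subseteq> carrier A \<and> lincomb F = s"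

lemma finsum_cl [simp, intro]: "(\<And>x. x \<in> S \<Longrightarrow> f x \<in> carrier A) \<Longrightarrow> finsum A f S \<in> carrier A"
  by (rule M.finsum_closed) auto

lemma lincomb_superset:
  assumes "finite S" "{x. F x \<noteq> 0} \<subseteq> S" "S \<subseteq> carrier A"
  shows "lincomb F = finsum A (\<lambda>x. F x \<odot> x) S"
  unfolding lincomb_def
  by (rule add.finprod_mono_neutral_cong_left) (use assms in auto)

lemma represents_atom: "x \<in> carrier A \<Longrightarrow> represents (\<lambda>z. if z = x then 1 else 0) x"
  unfolding represents_def by (auto simp: lincomb_superset[of "{x}"])

lemma represents_zero: "represents (\<lambda>z. 0) \<zero>"
  unfolding represents_def by (simp add: lincomb_def)

lemma finsum_smult:
  "finite S \<Longrightarrow> (\<And>x. x \<in> S \<Longrightarrow> f x \<in> carrier A) \<Longrightarrow> c \<odot> finsum A f S = finsum A (\<lambda>x. c \<odot> f x) S"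
  by (induction rule: finite_induct) (simp_all add: smult_add_right Pi_def)

lemma represents_smult:
  assumes "represents F s"
  shows "represents (\<lambda>z. c * F z) (c \<odot> s)"
proof -
  let ?S = "{x. F x \<noteq> 0}"
  have S: "finite ?S" "?S \<subseteq> carrier A" using assms by (auto simp: represents_def)
  have "lincomb (\<lambda>z. c * F z) = finsum A (\<lambda>x. (c * F x) \<odot> x) ?S"
    by (rule lincomb_superset) (use S in auto)
  also have "\<dots> = finsum A (\<lambda>x. c \<odot> (F x \<odot> x)) ?S"
    by (rule M.finsum_cong') (use S in auto)
  also have "\<dots> = c \<odot> finsum A (\<lambda>x. F x \<odot> x) ?S"
    by (rule finsum_smult[symmetric]) (use S in auto)
  finally have "lincomb (\<lambda>z. c * F z) = c \<odot> s" using assms by (simp add: represents_def lincomb_def)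
  moreover have "{z. c * F z \<noteq> 0} \<subseteq> ?S" by auto
  ultimately show ?thesis using S finite_subset unfolding represents_def by blast
qed

lemma represents_add:
  assumes "represents F s" "represents H t"
  shows "represents (\<lambda>z. F z + H z) (s \<oplus> t)"
proof -
  let ?S = "{x. F x \<noteq> 0} \<union> {x. H x \<noteq> 0}"
  have S: "finite ?S" "?S \<subseteq> carrier A" using assms by (auto simp: represents_def)
  have "lincomb (\<lambda>z. F z + H z) = finsum A (\<lambda>x. (F x + H x) \<odot> x) ?S"
    by (rule lincomb_superset) (use S in auto)
  also have "\<dots> = finsum A (\<lambda>x. F x \<odot> x \<oplus> H x \<odot> x) ?S"
    by (rule M.finsum_cong') (use S in \<open>auto simp: smult_add_left simp del: smult_collect\<close>)
  also have "\<dots> = finsum A (\<lambda>x. F x \<odot> x) ?S \<oplus> finsum A (\<lambda>x. H x \<odot> x) ?S"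
    by (rule M.finsum_addf) (use S in auto)
  also have "finsum A (\<lambda>x. F x \<odot> x) ?S = s"
    using lincomb_superset[of ?S F] S assms by (auto simp: represents_def)
  also have "finsum A (\<lambda>x. H x \<odot> x) ?S = t"
    using lincomb_superset[of ?S H] S assms by (auto simp: represents_def)
  finally have "lincomb (\<lambda>z. F z + H z) = s \<oplus> t" .
  moreover have "{z. F z + H z \<noteq> 0} \<subseteq> ?S" by auto
  ultimately show ?thesis using S finite_subset unfolding represents_def by blast
qed

lemma linear_identity:
  assumes "represents F s" "represents H t" "\<And>z. F z = H z"
  shows "s = t"
proof -
  have "F = H" using assms(3) by auto
  then show ?thesis using assms(1,2) by (simp add: represents_def)
qed

text \<open>The order matters: the atom rule matches every element, so it is tried last and takes
  only what is neither a sum, a multiple nor zero, in particular products. Atoms that coincide do no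
  harm, because their indicator functions add up.\<close>

lemmas represents_intros = represents_add represents_smult represents_zero represents_atom

end

section \<open>Closed ideals are self-adjoint\<close>

context cstar_algebra
begin

lemma nrm_add: "\<lbrakk>x \<in> carrier A; y \<in> carrier A\<rbrakk> \<Longrightarrow> nrm A (x \<oplus> y) \<le> nrm A x + nrm A y"
  using nrm_seminorm by (simp add: cstar_seminorm_def)

lemma nrm_smult [simp]: "x \<in> carrier A \<Longrightarrow> nrm A (c \<odot> x) = cmod c * nrm A x"
  using nrm_seminorm by (simp add: cstar_seminorm_def)

lemma nrm_mult: "\<lbrakk>x \<in> carrier A; y \<in> carrier A\<rbrakk> \<Longrightarrow> nrm A (x \<otimes> y) \<le> nrm A x * nrm A y"
  using nrm_seminorm by (simp add: cstar_seminorm_def)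

lemma nrm_cstar: "x \<in> carrier A \<Longrightarrow> nrm A (adj A x \<otimes> x) = (nrm A x)\<^sup>2"
  using nrm_seminorm by (simp add: cstar_seminorm_def)

lemma nrm_zero [simp]: "nrm A \<zero> = 0"
  using nrm_smult[of \<zero> 0] by simp

lemma nrm_minus: "\<lbrakk>x \<in> carrier A; y \<in> carrier A\<rbrakk> \<Longrightarrow> nrm A (x \<ominus> y) \<le> nrm A x + nrm A y"
  using nrm_add[of x "(-1) \<odot> y"] by (simp add: minus_smult)

lemma nrm_minus_commute: "\<lbrakk>x \<in> carrier A; y \<in> carrier A\<rbrakk> \<Longrightarrow> nrm A (x \<ominus> y) = nrm A (y \<ominus> x)"
proof -
  assume a: "x \<in> carrier A" "y \<in> carrier A"
  then have "x \<ominus> y = (-1) \<odot> (y \<ominus> x)" by (simp add: alg M.a_ac)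
  then show ?thesis using a by simp
qed

text \<open>\<open>cstar_seminorm\<close> does not state positivity; it follows from
  \<open>0 = nrm (x - x) <= 2 nrm x\<close>.\<close>

lemma nrm_nonneg [simp]: "x \<in> carrier A \<Longrightarrow> 0 \<le> nrm A x"
  using nrm_minus[of x x] diff_zero_iff[of x x] by simp

text \<open>The C*-identity gives \<open>nrm y ^ 2 <= nrm (adj y) * nrm y\<close>. Cancel, then use
  the result for \<open>x\<close> and for \<open>adj x\<close>.\<close>

lemma nrm_adj [simp]:
  assumes "x \<in> carrier A"
  shows "nrm A (adj A x) = nrm A x"
proof -
  have le: "nrm A y \<le> nrm A (adj A y)" if "y \<in> carrier A" for y
  proof (cases "nrm A y = 0")
    case False
    have "nrm A y * nrm A y \<le> nrm A (adj A y) * nrm A y"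
      using nrm_mult[of "adj A y" y] nrm_cstar[of y] that by (simp add: power2_eq_square)
    moreover have "nrm A y > 0" using False nrm_nonneg[OF that] by simp
    ultimately show ?thesis by simp
  qed (use that in simp)
  show ?thesis using le[of x] le[of "adj A x"] assms by simp
qed

lemma nrm_cstar': "x \<in> carrier A \<Longrightarrow> nrm A (x \<otimes> adj A x) = (nrm A x)\<^sup>2"
  using nrm_cstar[of "adj A x"] by simp

lemma Metric_space: "Metric_space (carrier A) (ndist A)"
proof
  show "0 \<le> ndist A x y" for x y by (simp add: ndist_def)
  show "ndist A x y = ndist A y x" for x y by (auto simp: ndist_def nrm_minus_commute)
  show "ndist A x y = 0 \<longleftrightarrow> x = y" if "x \<in> carrier A" "y \<in> carrier A" for x y
    using that nrm_eq_zero[of "x \<ominus> y"] diff_zero_iff[of x y] by (auto simp: ndist_def)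
  show "ndist A x z \<le> ndist A x y + ndist A y z"
    if "x \<in> carrier A" "y \<in> carrier A" "z \<in> carrier A" for x y z
  proof -
    have "x \<ominus> z = (x \<ominus> y) \<oplus> (y \<ominus> z)"
      by (use that in \<open>simp add: alg\<close>, rule linear_identity, (rule represents_intros; simp?)+, simp)
    then show ?thesis using nrm_add[of "x \<ominus> y" "y \<ominus> z"] that by (simp add: ndist_def)
  qed
qed

sublocale MS: Metric_space "carrier A" "ndist A"
  by (rule Metric_space)

lemma closedin_approx:
  assumes "closedin (ntopology A) S" "x \<in> carrier A"
    and "\<And>e. e > 0 \<Longrightarrow> \<exists>y\<in>S. nrm A (x \<ominus> y) < e"
  shows "x \<in> S"
proof (rule ccontr)
  assume "x \<notin> S"
  then obtain r where r: "r > 0" "disjnt S (MS.mball x r)"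
    using assms(1,2) unfolding MS.closedin_metric by blast
  obtain y where y: "y \<in> S" "nrm A (x \<ominus> y) < r" using assms(3) r by blast
  have "y \<in> carrier A" using assms(1) y(1) by (auto simp: MS.closedin_metric)
  then have "y \<in> MS.mball x r" using y assms(2) by (simp add: ndist_def)
  then show False using r y by (auto simp: disjnt_iff)
qed

end

section \<open>Powers of \<open>1 + i s a\<close> acting by right multiplication\<close>

context cstar_algebra
begin

text \<open>Right multiplication by \<open>1 + i s a\<close>, spelled out because \<open>A\<close>
  may lack a unit.\<close>

definition twist :: "real \<Rightarrow> 'a \<Rightarrow> 'a \<Rightarrow> 'a" where
  "twist s a y = y \<oplus> (\<i> * s) \<odot> (y \<otimes> a)"

text \<open>A geometric sum in \<open>1 + i s a\<close>, with last exponent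
  \<open>k - 1\<close>.\<close>

primrec twist_sum :: "real \<Rightarrow> 'a \<Rightarrow> nat \<Rightarrow> 'a \<Rightarrow> 'a" where
  "twist_sum s a 0 y = \<zero>"
| "twist_sum s a (Suc k) y = twist_sum s a k y \<oplus> (twist s a ^^ k) y"

context
  fixes s :: real and a assumes a: "a \<in> carrier A" and sa: "adj A a = a"
begin

lemma twist_closed [simp, intro]: "y \<in> carrier A \<Longrightarrow> twist s a y \<in> carrier A"
  using a by (simp add: twist_def)

lemma twist_pow_closed [simp, intro]: "y \<in> carrier A \<Longrightarrow> (twist s a ^^ k) y \<in> carrier A"
  by (induction k) auto

lemma twist_sum_closed [simp, intro]: "y \<in> carrier A \<Longrightarrow> twist_sum s a k y \<in> carrier A"
  by (induction k) auto

lemma mult_twist: "\<lbrakk>u \<in> carrier A; y \<in> carrier A\<rbrakk> \<Longrightarrow> u \<otimes> twist s a y = twist s a (u \<otimes> y)"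
  using a by (simp add: twist_def alg)

lemma mult_twist_pow:
  "\<lbrakk>u \<in> carrier A; y \<in> carrier A\<rbrakk> \<Longrightarrow> u \<otimes> (twist s a ^^ k) y = (twist s a ^^ k) (u \<otimes> y)"
  by (induction k) (auto simp: mult_twist)

lemma mult_twist_sum:
  "\<lbrakk>u \<in> carrier A; y \<in> carrier A\<rbrakk> \<Longrightarrow> u \<otimes> twist_sum s a k y = twist_sum s a k (u \<otimes> y)"
  by (induction k) (auto simp: mult_twist_pow mult_add_right)

text \<open>The formula for a finite geometric sum, in additive form since neither a unit nor
  inverses are at hand.\<close>

lemma twist_sum_mult:
  "y \<in> carrier A \<Longrightarrow> y \<oplus> (\<i> * s) \<odot> (twist_sum s a k y \<otimes> a) = (twist s a ^^ k) y"
proof (induction k)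
  case (Suc k)
  have "y \<oplus> (\<i> * s) \<odot> (twist_sum s a (Suc k) y \<otimes> a)
     = (y \<oplus> (\<i> * s) \<odot> (twist_sum s a k y \<otimes> a)) \<oplus> (\<i> * s) \<odot> ((twist s a ^^ k) y \<otimes> a)"
    using Suc.prems a by (simp add: alg)
  then show ?case
    using Suc by (simp add: twist_def[of s a "(twist s a ^^ k) y"])
qed (use a in simp)

text \<open>Since \<open>a\<close> is self-adjoint, the first-order terms in \<open>(y + i s y a) (y + i s y a)\<^sup>*\<close> cancel.\<close>

lemma nrm_twist:
  assumes y: "y \<in> carrier A"
  shows "(nrm A (twist s a y))\<^sup>2 \<le> (1 + s\<^sup>2 * (nrm A a)\<^sup>2) * (nrm A y)\<^sup>2"
proof -
  have "twist s a y \<otimes> adj A (twist s a y)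
      = y \<otimes> adj A y \<oplus> (s\<^sup>2) \<odot> ((y \<otimes> a) \<otimes> adj A (y \<otimes> a))"
    unfolding twist_def
    by (use a y sa in \<open>simp add: alg\<close>, rule linear_identity, (rule represents_intros; simp?)+,
        simp add: algebra_simps power2_eq_square)
  then have "(nrm A (twist s a y))\<^sup>2
      = nrm A (y \<otimes> adj A y \<oplus> (s\<^sup>2) \<odot> ((y \<otimes> a) \<otimes> adj A (y \<otimes> a)))"
    using nrm_cstar'[of "twist s a y"] y by simp
  also have "\<dots> \<le> nrm A (y \<otimes> adj A y) + nrm A ((s\<^sup>2) \<odot> ((y \<otimes> a) \<otimes> adj A (y \<otimes> a)))"
    by (rule nrm_add) (use a y in auto)
  also have "\<dots> = (nrm A y)\<^sup>2 + s\<^sup>2 * (nrm A (y \<otimes> a))\<^sup>2"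
    using a y nrm_cstar'[of "y \<otimes> a"] by (simp add: nrm_cstar' norm_power)
  also have "\<dots> \<le> (nrm A y)\<^sup>2 + s\<^sup>2 * (nrm A y * nrm A a)\<^sup>2"
  proof (intro add_left_mono mult_left_mono)
    show "(nrm A (y \<otimes> a))\<^sup>2 \<le> (nrm A y * nrm A a)\<^sup>2"
      by (rule power_mono) (use a y nrm_mult in auto)
  qed simp
  finally show ?thesis by (simp add: algebra_simps power_mult_distrib)
qed

lemma nrm_twist_pow:
  assumes y: "y \<in> carrier A"
  shows "(nrm A ((twist s a ^^ k) y))\<^sup>2 \<le> (1 + s\<^sup>2 * (nrm A a)\<^sup>2) ^ k * (nrm A y)\<^sup>2"
proof (induction k)
  case (Suc k)
  have "(nrm A ((twist s a ^^ Suc k) y))\<^sup>2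
     \<le> (1 + s\<^sup>2 * (nrm A a)\<^sup>2) * (nrm A ((twist s a ^^ k) y))\<^sup>2"
    using nrm_twist[of "(twist s a ^^ k) y"] y by simp
  also have "\<dots> \<le> (1 + s\<^sup>2 * (nrm A a)\<^sup>2) * ((1 + s\<^sup>2 * (nrm A a)\<^sup>2) ^ k * (nrm A y)\<^sup>2)"
    by (rule mult_left_mono[OF Suc]) simp
  finally show ?case by (simp add: mult.assoc)
qed simp

lemma twist_mult: "y \<in> carrier A \<Longrightarrow> twist s a y \<otimes> a = twist s a (y \<otimes> a)"
  using a by (simp add: twist_def alg)

lemma twist_pow_mult: "y \<in> carrier A \<Longrightarrow> (twist s a ^^ k) y \<otimes> a = (twist s a ^^ k) (y \<otimes> a)"
  using a by (induction k) (auto simp: twist_mult)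

lemma twist_sum_mult_right:
  "y \<in> carrier A \<Longrightarrow> twist_sum s a k y \<otimes> a = twist_sum s a k (y \<otimes> a)"
  using a by (induction k) (auto simp: twist_pow_mult mult_add_left)

context
  fixes N :: nat assumes N: "s\<^sup>2 * N \<le> 1"
begin

text \<open>On squares of norms one step costs a factor \<open>1 + s^2 t\<close> with
  \<open>t = nrm a ^ 2\<close>, and \<open>(1 + s^2 t)^k <= exp (k s^2 t) <= exp t\<close> as long
  as \<open>s^2 k <= 1\<close>. The bound is therefore uniform in \<open>N\<close>.\<close>

lemma nrm_twist_pow':
  assumes y: "y \<in> carrier A" and k: "k \<le> N"
  shows "nrm A ((twist s a ^^ k) y) \<le> exp ((nrm A a)\<^sup>2) * nrm A y"
proof -
  define t where "t = (nrm A a)\<^sup>2"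
  have t: "t \<ge> 0" by (simp add: t_def)
  have "(1 + s\<^sup>2 * t) ^ k \<le> exp (s\<^sup>2 * t) ^ k"
    by (rule power_mono) (use t in \<open>auto intro: exp_ge_add_one_self_aux\<close>)
  also have "\<dots> = exp (real k * (s\<^sup>2 * t))" by (simp add: exp_of_nat_mult)
  also have "\<dots> \<le> exp t"
  proof -
    have "real k * s\<^sup>2 \<le> real N * s\<^sup>2" using k by (intro mult_right_mono) auto
    then have "real k * s\<^sup>2 \<le> 1" using N by (simp add: mult.commute)
    then have "real k * s\<^sup>2 * t \<le> 1 * t" using t by (rule mult_right_mono)
    then show ?thesis by (simp add: mult.assoc)
  qed
  \<comment> \<open>Weakened to a perfect square, so that taking the root at the end gives
    \<open>exp t\<close> again.\<close>
  also have "\<dots> \<le> (exp t)\<^sup>2" using t by (simp add: power2_eq_square)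
  finally have "(nrm A ((twist s a ^^ k) y))\<^sup>2 \<le> (exp t)\<^sup>2 * (nrm A y)\<^sup>2"
    using nrm_twist_pow[OF y, of k] unfolding t_def
    by (meson order_trans mult_right_mono zero_le_power2)
  then have "(nrm A ((twist s a ^^ k) y))\<^sup>2 \<le> (exp t * nrm A y)\<^sup>2" by (simp add: power_mult_distrib)
  then show ?thesis unfolding t_def
    by (rule power2_le_imp_le) (use y in simp)
qed

lemma nrm_twist_sum:
  assumes y: "y \<in> carrier A" and k: "k \<le> N"
  shows "nrm A (twist_sum s a k y) \<le> k * (exp ((nrm A a)\<^sup>2) * nrm A y)"
  using k
proof (induction k)
  case (Suc k)
  then show ?case
    using nrm_add[of "twist_sum s a k y" "(twist s a ^^ k) y"] nrm_twist_pow'[OF y, of k] y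
    by (simp add: algebra_simps)
qed simp

text \<open>The decisive cancellation: after multiplication by \<open>a\<close> the sum of
  \<open>N\<close> terms collapses to a difference of two terms bounded independently of
  \<open>N\<close>, so it grows only like \<open>1 / |s|\<close>, whereas
  \<open>nrm_twist_sum\<close> grows like \<open>N\<close>.\<close>

lemma nrm_twist_sum_mult:
  assumes y: "y \<in> carrier A"
  shows "\<bar>s\<bar> * nrm A (twist_sum s a N y \<otimes> a) \<le> (1 + exp ((nrm A a)\<^sup>2)) * nrm A y"
proof -
  have "(\<i> * s) \<odot> (twist_sum s a N y \<otimes> a) = (twist s a ^^ N) y \<ominus> y"
    using twist_sum_mult[OF y, of N] y a
    by (subst eq_commute) (simp add: diff_eq_iff M.a_comm)
  then have "\<bar>s\<bar> * nrm A (twist_sum s a N y \<otimes> a) = nrm A ((twist s a ^^ N) y \<ominus> y)"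
    using nrm_smult[of "twist_sum s a N y \<otimes> a" "\<i> * s"] y a by (simp add: norm_mult)
  also have "\<dots> \<le> nrm A ((twist s a ^^ N) y) + nrm A y"
    by (rule nrm_minus) (use y in auto)
  finally show ?thesis using nrm_twist_pow'[OF y, of N] by (simp add: algebra_simps)
qed

end

end

end

section \<open>Closure properties of submodules\<close>

context star_algebra
begin

lemma submodule_closed:
  assumes "submodule I complex_ring A"
  shows "\<And>x. x \<in> I \<Longrightarrow> x \<in> carrier A" and "\<zero> \<in> I"
    and "\<And>x y. \<lbrakk>x \<in> I; y \<in> I\<rbrakk> \<Longrightarrow> x \<oplus> y \<in> I"
    and "\<And>c x. x \<in> I \<Longrightarrow> c \<odot> x \<in> I"
    and "\<And>x y. \<lbrakk>x \<in> I; y \<in> I\<rbrakk> \<Longrightarrow> x \<ominus> y \<in> I"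
proof -
  show c: "x \<in> carrier A" if "x \<in> I" for x using submoduleE(1)[OF assms] that by auto
  show s: "c \<odot> x \<in> I" if "x \<in> I" for c x
    using submoduleE(4)[OF assms, of c x] that by (simp add: complex_ring_def)
  show a: "x \<oplus> y \<in> I" if "x \<in> I" "y \<in> I" for x y using submoduleE(5)[OF assms] that by auto
  obtain x where "x \<in> I" using submoduleE(2)[OF assms] by auto
  then show "\<zero> \<in> I" using s[of x 0] c by simp
  show "x \<ominus> y \<in> I" if "x \<in> I" "y \<in> I" for x y
    using that a s[of y "-1"] c by (simp add: minus_smult)
qed

lemma submodule_finsum:
  assumes I: "submodule I complex_ring A" and f: "\<And>x. x \<in> S \<Longrightarrow> f x \<in> I"
  shows "finsum A f S \<in> I"
proof (cases "finite S")
  case True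
  then show ?thesis
    using f
  proof (induction S rule: finite_induct)
    case (insert x S)
    then have "finsum A f (insert x S) = f x \<oplus> finsum A f S"
      using submodule_closed(1)[OF I] by (intro M.finsum_insert) auto
    then show ?case using insert submodule_closed[OF I] by simp
  qed (use submodule_closed[OF I] in simp)
qed (use submodule_closed[OF I] in \<open>simp add: M.finsum_infinite\<close>)

end

context cstar_algebra
begin

text \<open>Right multiplication by \<open>a\<close> lands in \<open>I\<close>, so every power of
  the twist is the identity modulo \<open>I\<close>, and the sum of \<open>k\<close> powers is
  multiplication by \<open>k\<close>.\<close>

lemma twist_sum_mod:
  assumes I: "submodule I complex_ring A" "\<And>y. y \<in> carrier A \<Longrightarrow> y \<otimes> a \<in> I"
    and a: "a \<in> carrier A" and y: "y \<in> carrier A"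
  shows "of_nat k \<odot> y \<ominus> twist_sum s a k y \<in> I"
proof -
  have twist_c: "(twist s a ^^ k) y \<in> carrier A" for k
    by (induction k) (use a y in \<open>auto simp: twist_def\<close>)
  have sum_c: "twist_sum s a k y \<in> carrier A" for k
    by (induction k) (use y twist_c in auto)
  have pow: "y \<ominus> (twist s a ^^ k) y \<in> I" for k
  proof (induction k)
    case 0
    then show ?case using y submodule_closed(2)[OF I(1)] diff_zero_iff[of y y] by simp
  next
    case (Suc k)
    have "y \<ominus> (twist s a ^^ Suc k) y
        = (y \<ominus> (twist s a ^^ k) y) \<ominus> (\<i> * s) \<odot> ((twist s a ^^ k) y \<otimes> a)"
      using twist_c[of k] a y by (simp add: twist_def[of s a "(twist s a ^^ k) y"] alg)
    then show ?case using Suc submodule_closed(4,5)[OF I(1)] I(2)[OF twist_c[of k]] by metis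
  qed
  show ?thesis
  proof (induction k)
    case 0
    then show ?case using y submodule_closed(2)[OF I(1)] diff_zero_iff[of \<zero> \<zero>] by simp
  next
    case (Suc k)
    have "of_nat (Suc k) \<odot> y \<ominus> twist_sum s a (Suc k) y
        = (of_nat k \<odot> y \<ominus> twist_sum s a k y) \<oplus> (y \<ominus> (twist s a ^^ k) y)"
      by (use y sum_c[of k] twist_c[of k] in \<open>simp add: alg\<close>, rule linear_identity,
          (rule represents_intros; simp?)+, simp add: algebra_simps)
    then show ?case using Suc pow submodule_closed(3)[OF I(1)] by metis
  qed
qed

text \<open>
  With \<open>a = x x\<^sup>*\<close>, the elements \<open>z = x\<^sup>* (1 / N) (\<Sum>k<N. (1 + i s a)\<^sup>k)\<close> for \<open>s = 1 / \<surd>N\<close> lie in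
  \<open>x\<^sup>* + I\<close>. The geometric sum gives \<open>\<parallel>x z a\<parallel> = O(1 / \<surd>N)\<close>, whence \<open>z \<rightarrow> 0\<close> by the C*-identity.
  This replaces the usual approximate unit, which would need functional calculus.
\<close>

lemma closed_ideal_adj:
  assumes I: "closed_ideal A I" and x: "x \<in> I"
  shows "adj A x \<in> I"
proof -
  have sub: "submodule I complex_ring A" and cl: "closedin (ntopology A) I"
    and abs: "\<And>a x. \<lbrakk>a \<in> carrier A; x \<in> I\<rbrakk> \<Longrightarrow> a \<otimes> x \<in> I \<and> x \<otimes> a \<in> I"
    using I by (auto simp: closed_ideal_def)
  have xc: "x \<in> carrier A" using submodule_closed(1)[OF sub x] .
  define a where "a = x \<otimes> adj A x"
  have a: "a \<in> carrier A" "a \<in> I" "adj A a = a" using xc abs[OF _ x] by (auto simp: a_def adj_mult)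
  define K where "K = exp ((nrm A a)\<^sup>2)"
  have K: "K \<ge> 1" by (simp add: K_def)
  show ?thesis
  proof (rule closedin_approx[OF cl])
    show "adj A x \<in> carrier A" using xc by simp
    fix e :: real assume e: "e > 0"
    \<comment> \<open>\<open>L\<close> collects the constants in \<open>T4\<close>, which bounds the
      fourth power of the norm of \<open>T\<close> by \<open>N ^ 3 * sqrt N * L\<close>. For
      \<open>z = T / N\<close> this leaves \<open>L / sqrt N\<close>, and \<open>N\<close> is chosen
      to push it below \<open>e ^ 4\<close>.\<close>
    define L where "L = K ^ 3 * (1 + K) * nrm A a"
    obtain N :: nat where N: "real N > (L / e ^ 4)\<^sup>2" using reals_Archimedean2 by blast
    have N0: "real N > 0" using N by (meson le_less_trans zero_le_power2)
    define s where "s = 1 / sqrt N"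
    have s: "s\<^sup>2 * N \<le> 1" "s > 0" using N0 by (auto simp: s_def power_divide)
    note small = nrm_twist_sum[OF a(1) a(3) s(1) _ order_refl, folded K_def]
      and mult_small = nrm_twist_sum_mult[OF a(1) a(3) s(1), folded K_def]
    define T W where "T = twist_sum s a N (adj A x)" and "W = twist_sum s a N a"
    have T: "T \<in> carrier A" and W: "W \<in> carrier A"
      unfolding T_def W_def using a xc by (auto intro: twist_sum_closed)
    have xT: "x \<otimes> T = W" unfolding T_def W_def a_def
      using mult_twist_sum[of "x \<otimes> adj A x" x "adj A x" s N] xc a by (simp add: a_def)
    \<comment> \<open>Left factors move inside the sum, so the C*-identity trades the square of
      \<open>nrm T\<close> for \<open>N * K * nrm W\<close>, where \<open>W = x T\<close>. The same
      trick applied to \<open>W\<close> reaches \<open>W a\<close>, where the cancellation of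
      \<open>nrm_twist_sum_mult\<close> is available.\<close>
    have "adj A T \<otimes> T = twist_sum s a N (adj A W)"
      using mult_twist_sum[OF a(1) a(3), of "adj A T" "adj A x" s N] T xc xT
      by (simp add: T_def[symmetric] adj_mult[symmetric])
    then have "(nrm A T)\<^sup>2 \<le> N * (K * nrm A W)"
      using small[of "adj A W"] W nrm_cstar[OF T] by simp
    \<comment> \<open>\<open>W\<close> is a sum of powers of the twist applied to \<open>a\<close>,
      so it commutes with \<open>a\<close>; hence \<open>adj W\<close> times \<open>a\<close> is the
      adjoint of \<open>W a\<close>.\<close>
    moreover have "adj A W \<otimes> W = twist_sum s a N (adj A (W \<otimes> a))"
      using mult_twist_sum[OF a(1) a(3), of "adj A W" a s N]
        mult_twist_sum[OF a(1) a(3), of a a s N] twist_sum_mult_right[OF a(1) a(3), of a s N] W a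
      by (simp add: W_def[symmetric]) (metis a(3) adj_mult)
    then have "(nrm A W)\<^sup>2 \<le> N * (K * nrm A (W \<otimes> a))"
      using small[of "adj A (W \<otimes> a)"] W a nrm_cstar[OF W] by simp
    moreover have Wa: "nrm A (W \<otimes> a) \<le> (1 + K) * nrm A a * sqrt N"
      using mult_small[OF a(1)] N0 by (simp add: W_def s_def field_simps)
    ultimately have T2: "(nrm A T)\<^sup>2 \<le> N * (K * nrm A W)" and W2: "(nrm A W)\<^sup>2 \<le> N * (K * nrm A (W \<otimes> a))"
      by auto
    have "((nrm A T)\<^sup>2)\<^sup>2 \<le> (N * (K * nrm A W))\<^sup>2"
      by (rule power_mono[OF T2]) simp
    also have "\<dots> = (real N * K)\<^sup>2 * (nrm A W)\<^sup>2" by (simp add: power_mult_distrib)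
    also have "(nrm A W)\<^sup>2 \<le> N * (K * ((1 + K) * nrm A a * sqrt N))"
    proof -
      have "N * (K * nrm A (W \<otimes> a)) \<le> N * (K * ((1 + K) * nrm A a * sqrt N))"
        using K by (intro mult_left_mono Wa) auto
      then show ?thesis using W2 by linarith
    qed
    finally have "((nrm A T)\<^sup>2)\<^sup>2 \<le> (real N * K)\<^sup>2 * (N * (K * ((1 + K) * nrm A a * sqrt N)))"
      by (simp add: mult_left_mono)
    then have T4: "nrm A T ^ 4 \<le> real N ^ 3 * sqrt N * L"
      by (simp add: L_def power2_eq_square power3_eq_cube power4_eq_xxxx mult_ac del: mult_le_cancel_left mult_le_cancel_right)
    define z where "z = (1 / N) \<odot> T"
    have z: "z \<in> carrier A" using T by (simp add: z_def)
    have "adj A x \<ominus> z = (1 / N) \<odot> (of_nat N \<odot> adj A x \<ominus> T)"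
      using xc T N0 by (simp add: z_def alg)
    moreover have "of_nat N \<odot> adj A x \<ominus> T \<in> I" unfolding T_def
      by (rule twist_sum_mod[OF sub]) (use abs a xc in auto)
    ultimately have "adj A x \<ominus> z \<in> I" using submodule_closed(4)[OF sub] by simp
    moreover have "adj A x \<ominus> (adj A x \<ominus> z) = z"
      using xc z by (simp add: alg)
    moreover have "nrm A z < e"
    proof -
      have "L \<ge> 0" using K a by (simp add: L_def)
      have "L / e ^ 4 < sqrt N" using N by (simp add: real_less_rsqrt)
      then have Ls: "L < e ^ 4 * sqrt N" using e by (simp add: field_simps)
      have "nrm A z ^ 4 = nrm A T ^ 4 / real N ^ 4" using T by (simp add: z_def power_divide norm_divide)
      also have "\<dots> \<le> real N ^ 3 * sqrt N * L / real N ^ 4" using T4 by (simp add: divide_right_mono)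
      also have "\<dots> < real N ^ 3 * sqrt N * (e ^ 4 * sqrt N) / real N ^ 4"
        using Ls N0 by (intro divide_strict_right_mono mult_strict_left_mono) auto
      also have "\<dots> = e ^ 4 * (real N ^ 3 * (sqrt N * sqrt N) / real N ^ 4)" by simp
      also have "sqrt N * sqrt N = real N" by simp
      also have "e ^ 4 * (real N ^ 3 * real N / real N ^ 4) = e ^ 4"
        using N0 by (simp add: power4_eq_xxxx power3_eq_cube)
      finally show ?thesis using e by (meson less_imp_le power_less_imp_less_base)
    qed
    ultimately show "\<exists>y\<in>I. nrm A (adj A x \<ominus> y) < e" by metis
  qed
qed

end

section \<open>Newton steps for almost multiplicative families\<close>

text \<open>To be used with the quotient norms modulo \<open>Jn n\<close> and modulo
  \<open>J\<close>, both as seminorms on the same algebra. The isometry of the adjoint takes the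
  place of the C*-identity, which is much harder to establish for quotient norms.\<close>

locale star_seminorm = star_algebra A for A :: "('a, 'm) star_algebra_scheme" (structure) +
  fixes p :: "'a \<Rightarrow> real"
  assumes p_add: "\<lbrakk>x \<in> carrier A; y \<in> carrier A\<rbrakk> \<Longrightarrow> p (x \<oplus> y) \<le> p x + p y"
    and p_smult: "x \<in> carrier A \<Longrightarrow> p (c \<odot> x) = cmod c * p x"
    and p_mult: "\<lbrakk>x \<in> carrier A; y \<in> carrier A\<rbrakk> \<Longrightarrow> p (x \<otimes> y) \<le> p x * p y"
    and p_adj: "x \<in> carrier A \<Longrightarrow> p (adj A x) = p x"
begin

lemma p_zero: "p \<zero> = 0"
  using p_smult[of \<zero> 0] by simp

lemma p_minus: "\<lbrakk>x \<in> carrier A; y \<in> carrier A\<rbrakk> \<Longrightarrow> p (x \<ominus> y) \<le> p x + p y"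
  using p_add[of x "(-1) \<odot> y"] by (simp add: minus_smult p_smult)

lemma p_nonneg: "x \<in> carrier A \<Longrightarrow> 0 \<le> p x"
  using p_minus[of x x] diff_zero_iff[of x x] p_zero by simp

lemma p_mult_le:
  "\<lbrakk>x \<in> carrier A; y \<in> carrier A; p x \<le> r; p y \<le> t\<rbrakk> \<Longrightarrow> p (x \<otimes> y) \<le> r * t"
  by (meson mult_mono order_trans p_mult p_nonneg)

lemma p_finsum:
  "finite S \<Longrightarrow> (\<And>x. x \<in> S \<Longrightarrow> f x \<in> carrier A) \<Longrightarrow> p (finsum A f S) \<le> (\<Sum>x\<in>S. p (f x))"
proof (induction S rule: finite_induct)
  case (insert x S)
  then have "finsum A f (insert x S) = f x \<oplus> finsum A f S"
    by (intro M.finsum_insert) auto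
  then show ?case using p_add[of "f x" "finsum A f S"] insert by fastforce
qed (simp add: p_zero)

end

locale star_algebra_group = star_algebra A + G?: group G
  for A :: "('a, 'm) star_algebra_scheme" (structure) and G :: "('g, 'k) monoid_scheme" +
  assumes finite_carrier: "finite (carrier G)"
begin

definition avg :: "('g \<Rightarrow> 'a) \<Rightarrow> 'a" where
  "avg \<phi> = (1 / of_nat (card (carrier G))) \<odot> finsum A \<phi> (carrier G)"

lemma card_pos: "card (carrier G) > 0"
  using finite_carrier G.one_closed card_gt_0_iff by blast

lemma avg_closed [simp, intro]: "(\<And>h. h \<in> carrier G \<Longrightarrow> \<phi> h \<in> carrier A) \<Longrightarrow> avg \<phi> \<in> carrier A"
  by (auto simp: avg_def)

lemma finsum_mult_left:
  "finite S \<Longrightarrow> u \<in> carrier A \<Longrightarrow> (\<And>x. x \<in> S \<Longrightarrow> f x \<in> carrier A)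
    \<Longrightarrow> u \<otimes> finsum A f S = finsum A (\<lambda>x. u \<otimes> f x) S"
  by (induction rule: finite_induct) (simp_all add: mult_add_right Pi_def)

lemma finsum_mult_right:
  "finite S \<Longrightarrow> u \<in> carrier A \<Longrightarrow> (\<And>x. x \<in> S \<Longrightarrow> f x \<in> carrier A)
    \<Longrightarrow> finsum A f S \<otimes> u = finsum A (\<lambda>x. f x \<otimes> u) S"
  by (induction rule: finite_induct) (simp_all add: mult_add_left Pi_def)

lemma avg_mult_left:
  "\<lbrakk>u \<in> carrier A; \<And>h. h \<in> carrier G \<Longrightarrow> \<phi> h \<in> carrier A\<rbrakk> \<Longrightarrow> u \<otimes> avg \<phi> = avg (\<lambda>h. u \<otimes> \<phi> h)"
  unfolding avg_def using finite_carrier finsum_cl[of "carrier G" \<phi>]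
  by (subst mult_smult_right) (auto simp: finsum_mult_left)

lemma avg_mult_right:
  "\<lbrakk>u \<in> carrier A; \<And>h. h \<in> carrier G \<Longrightarrow> \<phi> h \<in> carrier A\<rbrakk> \<Longrightarrow> avg \<phi> \<otimes> u = avg (\<lambda>h. \<phi> h \<otimes> u)"
  unfolding avg_def using finite_carrier finsum_cl[of "carrier G" \<phi>]
  by (subst mult_smult_left) (auto simp: finsum_mult_right)

lemma avg_add:
  "\<lbrakk>\<And>h. h \<in> carrier G \<Longrightarrow> \<phi> h \<in> carrier A; \<And>h. h \<in> carrier G \<Longrightarrow> \<psi> h \<in> carrier A\<rbrakk>
    \<Longrightarrow> avg \<phi> \<oplus> avg \<psi> = avg (\<lambda>h. \<phi> h \<oplus> \<psi> h)"
  unfolding avg_def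
  using M.finsum_addf[of \<phi> "carrier G" \<psi>] smult_add_right[of "finsum A \<phi> (carrier G)" "finsum A \<psi> (carrier G)"]
  by (simp add: Pi_def)

lemma avg_cong:
  "\<lbrakk>\<And>h. h \<in> carrier G \<Longrightarrow> \<phi> h = \<psi> h; \<And>h. h \<in> carrier G \<Longrightarrow> \<psi> h \<in> carrier A\<rbrakk> \<Longrightarrow> avg \<phi> = avg \<psi>"
  unfolding avg_def by (metis M.finsum_cong' Pi_I)

lemma avg_const:
  assumes "u \<in> carrier A"
  shows "avg (\<lambda>h. u) = u"
proof -
  have "finsum A (\<lambda>h. u) S = of_nat (card S) \<odot> u" if "finite S" for S :: "'g set"
    using that
  proof (induction S rule: finite_induct)
    case (insert x S)
    then show ?case using assms by (simp add: smult_add_left[of u 1] del: smult_collect)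
  qed (use assms in simp)
  then show ?thesis unfolding avg_def using assms card_pos finite_carrier G.one_closed by auto
qed

lemma avg_shift:
  assumes "a \<in> carrier G" "\<And>h. h \<in> carrier G \<Longrightarrow> \<phi> h \<in> carrier A"
  shows "avg (\<lambda>h. \<phi> (a \<otimes>\<^bsub>G\<^esub> h)) = avg \<phi>"
proof -
  have im: "(\<lambda>h. a \<otimes>\<^bsub>G\<^esub> h) ` carrier G = carrier G"
    using G.surj_const_mult[OF assms(1)] .
  have "finsum A \<phi> ((\<lambda>h. a \<otimes>\<^bsub>G\<^esub> h) ` carrier G) = finsum A (\<lambda>h. \<phi> (a \<otimes>\<^bsub>G\<^esub> h)) (carrier G)"
    by (rule M.finsum_reindex) (use assms im G.inj_on_cmult in auto)
  then show ?thesis unfolding avg_def im by simp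
qed

definition defect :: "('g \<Rightarrow> 'a) \<Rightarrow> 'g \<Rightarrow> 'g \<Rightarrow> 'a" where
  "defect f a b = f (a \<otimes>\<^bsub>G\<^esub> b) \<ominus> f a \<otimes> f b"

definition correction :: "('g \<Rightarrow> 'a) \<Rightarrow> 'g \<Rightarrow> 'a" where
  "correction f b = avg (\<lambda>h. f h \<otimes> defect f (inv\<^bsub>G\<^esub> h) b)
     \<ominus> defect f \<one>\<^bsub>G\<^esub> b \<oplus> f \<one>\<^bsub>G\<^esub> \<otimes> defect f \<one>\<^bsub>G\<^esub> b"

text \<open>Averaging with the image under \<open>c b -> adj (c (inv b))\<close> makes the
  correction compatible with the adjoint, so that \<open>adj (f g) = f (inv g)\<close> survives
  every Newton step exactly.\<close>

definition sym_correction :: "('g \<Rightarrow> 'a) \<Rightarrow> 'g \<Rightarrow> 'a" where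
  "sym_correction f b = (1/2) \<odot> (correction f b \<oplus> adj A (correction f (inv\<^bsub>G\<^esub> b)))"

definition newton :: "('g \<Rightarrow> 'a) \<Rightarrow> 'g \<Rightarrow> 'a" where
  "newton f b = f b \<oplus> sym_correction f b"

text \<open>The bracket is the Hochschild coboundary of \<open>correction f\<close>, formed as if
  \<open>f\<close> were an action from both sides. The residue is the part of the defect that the
  step does not remove to first order.\<close>

definition residue :: "('g \<Rightarrow> 'a) \<Rightarrow> 'g \<Rightarrow> 'g \<Rightarrow> 'a" where
  "residue f a b = defect f a b
     \<ominus> (f a \<otimes> correction f b \<ominus> correction f (a \<otimes>\<^bsub>G\<^esub> b) \<oplus> correction f a \<otimes> f b)"

context
  fixes f assumes f: "\<And>g. g \<in> carrier G \<Longrightarrow> f g \<in> carrier A"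
begin

lemma defect_closed [simp, intro]: "\<lbrakk>a \<in> carrier G; b \<in> carrier G\<rbrakk> \<Longrightarrow> defect f a b \<in> carrier A"
  using f by (auto simp: defect_def)

lemma correction_closed [simp, intro]: "b \<in> carrier G \<Longrightarrow> correction f b \<in> carrier A"
  using f unfolding correction_def by (intro M.a_closed minus_cl avg_closed mult_closed) auto

lemma sym_correction_closed [simp, intro]: "b \<in> carrier G \<Longrightarrow> sym_correction f b \<in> carrier A"
  unfolding sym_correction_def by auto

lemma newton_closed [simp, intro]: "b \<in> carrier G \<Longrightarrow> newton f b \<in> carrier A"
  using f unfolding newton_def by auto

text \<open>Both sides equal \<open>f (a b c) - f a f b f c\<close>. The identity is exact for
  arbitrary \<open>f\<close>; it is only almost the 2-cocycle identity because \<open>f\<close> is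
  only almost an action.\<close>

lemma defect_cocycle:
  assumes "a \<in> carrier G" "b \<in> carrier G" "c \<in> carrier G"
  shows "f a \<otimes> defect f b c \<oplus> defect f a (b \<otimes>\<^bsub>G\<^esub> c) = defect f (a \<otimes>\<^bsub>G\<^esub> b) c \<oplus> defect f a b \<otimes> f c"
  unfolding defect_def
  by (use assms f in \<open>simp add: alg G.m_assoc\<close>, rule linear_identity, (rule represents_intros; simp?)+,
      simp add: algebra_simps)

text \<open>
  The defect is a Hochschild 2-cocycle up to second-order terms, and averaging over the group
  exhibits it as the coboundary of \<^const>\<open>correction\<close>, again up to second-order terms. The summands
  of the correction not involving the average are needed because \<open>f \<one>\<close> does not act as a unit.
\<close>

lemma residue_quadratic:
  assumes a: "a \<in> carrier G" and b: "b \<in> carrier G"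
  shows "residue f a b = avg (\<lambda>h. defect f a h \<otimes> defect f (inv\<^bsub>G\<^esub> h) b)
     \<oplus> avg (\<lambda>h. defect f h (inv\<^bsub>G\<^esub> h)) \<otimes> defect f a b
     \<oplus> defect f a \<one>\<^bsub>G\<^esub> \<otimes> defect f \<one>\<^bsub>G\<^esub> b \<oplus> defect f \<one>\<^bsub>G\<^esub> \<one>\<^bsub>G\<^esub> \<otimes> defect f a b"
proof -
  let ?E = "defect f" and ?e = "f \<one>\<^bsub>G\<^esub>"
  define Y where "Y c = avg (\<lambda>h. f h \<otimes> ?E (inv\<^bsub>G\<^esub> h) c)" for c
  define Q where "Q = avg (\<lambda>h. ?E a h \<otimes> ?E (inv\<^bsub>G\<^esub> h) b)"
  define S where "S = avg (\<lambda>h. ?E h (inv\<^bsub>G\<^esub> h))"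
  define Z where "Z = avg (\<lambda>h. f h \<otimes> ?E (inv\<^bsub>G\<^esub> h \<otimes>\<^bsub>G\<^esub> a) b)"
  have Yc: "Y c \<in> carrier A" if "c \<in> carrier G" for c
    unfolding Y_def using f that by (intro avg_closed mult_closed) auto
  have Qc: "Q \<in> carrier A" and Sc: "S \<in> carrier A" and Zc: "Z \<in> carrier A"
    unfolding Q_def S_def Z_def using f a b by (intro avg_closed mult_closed; auto)+
  have ab: "a \<otimes>\<^bsub>G\<^esub> b \<in> carrier G" using a b by simp
  \<comment> \<open>Translation of the average by \<open>a\<close>: \<open>f a f h\<close> is
    \<open>f (a h)\<close> up to a defect, and multiplied by the other defect this gives the
    quadratic term \<open>Q\<close>.\<close>
  have "f a \<otimes> Y b \<oplus> Q = avg (\<lambda>h. f a \<otimes> (f h \<otimes> ?E (inv\<^bsub>G\<^esub> h) b)) \<oplus> Q"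
    unfolding Y_def using f a b by (subst avg_mult_left) auto
  also have "\<dots> = avg (\<lambda>h. f a \<otimes> (f h \<otimes> ?E (inv\<^bsub>G\<^esub> h) b) \<oplus> ?E a h \<otimes> ?E (inv\<^bsub>G\<^esub> h) b)"
    unfolding Q_def using f a b by (intro avg_add) auto
  also have "\<dots> = avg (\<lambda>h. f (a \<otimes>\<^bsub>G\<^esub> h) \<otimes> ?E (inv\<^bsub>G\<^esub> (a \<otimes>\<^bsub>G\<^esub> h) \<otimes>\<^bsub>G\<^esub> a) b)"
  proof (rule avg_cong)
    fix h assume h: "h \<in> carrier G"
    have g: "inv\<^bsub>G\<^esub> (a \<otimes>\<^bsub>G\<^esub> h) \<otimes>\<^bsub>G\<^esub> a = inv\<^bsub>G\<^esub> h"
      using a h by (simp add: G.inv_mult_group G.m_assoc)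
    have "f (a \<otimes>\<^bsub>G\<^esub> h) = f a \<otimes> f h \<oplus> ?E a h"
      using f a h by (simp add: defect_def) (metis M.a_comm defect_def diff_eq_iff G.m_closed minus_cl mult_closed)
    then show "f a \<otimes> (f h \<otimes> ?E (inv\<^bsub>G\<^esub> h) b) \<oplus> ?E a h \<otimes> ?E (inv\<^bsub>G\<^esub> h) b
        = f (a \<otimes>\<^bsub>G\<^esub> h) \<otimes> ?E (inv\<^bsub>G\<^esub> (a \<otimes>\<^bsub>G\<^esub> h) \<otimes>\<^bsub>G\<^esub> a) b"
      unfolding g using f a b h by (simp add: alg)
  qed (use f a b in auto)
  also have "\<dots> = Z"
    unfolding Z_def by (rule avg_shift[OF a]) (use f a b in auto)
  finally have 1: "f a \<otimes> Y b \<oplus> Q = Z" .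
  \<comment> \<open>The average of \<open>f h f (inv h)\<close> is not a unit but \<open>f 1\<close>
    up to an average of defects. It will multiply \<open>defect f a b\<close>, which produces the
    second quadratic term.\<close>
  have fS: "avg (\<lambda>h. f h \<otimes> f (inv\<^bsub>G\<^esub> h)) \<oplus> S = ?e"
  proof -
    have "avg (\<lambda>h. f h \<otimes> f (inv\<^bsub>G\<^esub> h)) \<oplus> S = avg (\<lambda>h. f h \<otimes> f (inv\<^bsub>G\<^esub> h) \<oplus> ?E h (inv\<^bsub>G\<^esub> h))"
      unfolding S_def by (rule avg_add) (use f in auto)
    also have "\<dots> = avg (\<lambda>h. ?e)"
      by (rule avg_cong) (use f in \<open>auto simp: defect_def alg M.a_ac\<close>)
    finally show ?thesis using f by (simp add: avg_const)
  qed
  define F where "F = avg (\<lambda>h. f h \<otimes> f (inv\<^bsub>G\<^esub> h))"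
  have Fc: "F \<in> carrier A" unfolding F_def using f by (intro avg_closed mult_closed) auto
  \<comment> \<open>The cocycle identity at \<open>(inv h, a, b)\<close>, multiplied by
    \<open>f h\<close> from the left and averaged over \<open>h\<close>.\<close>
  have "F \<otimes> ?E a b \<oplus> Y (a \<otimes>\<^bsub>G\<^esub> b)
      = avg (\<lambda>h. f h \<otimes> (f (inv\<^bsub>G\<^esub> h) \<otimes> ?E a b \<oplus> ?E (inv\<^bsub>G\<^esub> h) (a \<otimes>\<^bsub>G\<^esub> b)))"
    unfolding Y_def F_def using f a b
    by (subst avg_mult_right, simp, simp, subst avg_add) (auto intro!: avg_cong simp: alg)
  also have "\<dots> = avg (\<lambda>h. f h \<otimes> (?E (inv\<^bsub>G\<^esub> h \<otimes>\<^bsub>G\<^esub> a) b \<oplus> ?E (inv\<^bsub>G\<^esub> h) a \<otimes> f b))"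
    by (rule avg_cong) (use f a b in \<open>auto simp: defect_cocycle\<close>)
  also have "\<dots> = Z \<oplus> Y a \<otimes> f b"
    unfolding Y_def Z_def using f a b
    by (subst avg_mult_right, simp, simp, subst avg_add) (auto intro!: avg_cong simp: alg)
  finally have 2: "F \<otimes> ?E a b \<oplus> Y (a \<otimes>\<^bsub>G\<^esub> b) = Z \<oplus> Y a \<otimes> f b" .
  note cl = f[OF a] f[OF b] f[OF G.one_closed] Yc[OF a] Yc[OF b] Yc[OF ab] Qc Sc Zc Fc defect_closed[OF a b]
    defect_closed[OF G.one_closed a] defect_closed[OF G.one_closed b] defect_closed[OF G.one_closed ab]
    defect_closed[OF a G.one_closed]
  have F: "F = ?e \<ominus> S" using fS cl by (metis F_def diff_eq_iff)
  have Yab: "Y (a \<otimes>\<^bsub>G\<^esub> b) = f a \<otimes> Y b \<oplus> Q \<oplus> Y a \<otimes> f b \<ominus> (?e \<ominus> S) \<otimes> ?E a b"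
    using 2 unfolding 1[symmetric] F
    by (subst eq_commute, subst diff_eq_iff) (use cl in \<open>auto simp: M.a_comm\<close>)
  \<comment> \<open>The cocycle identity at \<open>(1, a, b)\<close>. It governs the difference
    between \<open>defect f a b\<close> and \<open>f 1\<close> times it, which the last two summands
    of \<open>correction\<close> compensate.\<close>
  have Eab: "?E \<one>\<^bsub>G\<^esub> (a \<otimes>\<^bsub>G\<^esub> b) = ?E a b \<oplus> ?E \<one>\<^bsub>G\<^esub> a \<otimes> f b \<ominus> ?e \<otimes> ?E a b"
    using defect_cocycle[OF G.one_closed a b] a b
    by (subst eq_commute, subst diff_eq_iff) (use cl in \<open>auto simp: M.a_comm\<close>)
  have Ea1: "?E a \<one>\<^bsub>G\<^esub> = f a \<ominus> f a \<otimes> ?e" and E11: "?E \<one>\<^bsub>G\<^esub> \<one>\<^bsub>G\<^esub> = ?e \<ominus> ?e \<otimes> ?e"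
    using a by (simp_all add: defect_def)
  show ?thesis
    unfolding residue_def correction_def Y_def[symmetric] Q_def[symmetric] S_def[symmetric]
      Yab Eab Ea1 E11
    by (use cl in \<open>simp add: alg\<close>, rule linear_identity, (rule represents_intros; simp?)+,
      simp add: algebra_simps)
qed

context
  assumes f_adj: "\<And>g. g \<in> carrier G \<Longrightarrow> adj A (f g) = f (inv\<^bsub>G\<^esub> g)"
begin

lemma sym_correction_adj: "g \<in> carrier G \<Longrightarrow> adj A (sym_correction f g) = sym_correction f (inv\<^bsub>G\<^esub> g)"
  unfolding sym_correction_def by (simp add: adj_add M.a_comm)

lemma newton_adj: "g \<in> carrier G \<Longrightarrow> adj A (newton f g) = newton f (inv\<^bsub>G\<^esub> g)"
  unfolding newton_def using f by (simp add: adj_add f_adj sym_correction_adj)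

text \<open>Since \<open>adj (defect f (inv b) (inv a)) = defect f a b\<close>, the linear part of
  the new defect is the mean of a residue and an adjoint residue. Beyond that only the product of
  two corrections remains, so everything is of second order.\<close>

lemma defect_newton:
  assumes a: "a \<in> carrier G" and b: "b \<in> carrier G"
  shows "defect (newton f) a b =
    (1/2) \<odot> (residue f a b \<oplus> adj A (residue f (inv\<^bsub>G\<^esub> b) (inv\<^bsub>G\<^esub> a)))
      \<ominus> sym_correction f a \<otimes> sym_correction f b"
  unfolding residue_def newton_def defect_def sym_correction_def
  by (use a b f in \<open>simp add: alg f_adj G.inv_mult_group[symmetric]\<close>, 
      rule linear_identity, (rule represents_intros; simp?)+,
      simp add: algebra_simps)

end

end

end

locale star_seminorm_group = star_seminorm A p + star_algebra_group A G
  for A :: "('a, 'm) star_algebra_scheme" (structure) and p and G :: "('g, 'k) monoid_scheme"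
begin

lemma p_avg:
  assumes "\<And>h. h \<in> carrier G \<Longrightarrow> \<phi> h \<in> carrier A" "\<And>h. h \<in> carrier G \<Longrightarrow> p (\<phi> h) \<le> r"
  shows "p (avg \<phi>) \<le> r"
proof -
  have "p (finsum A \<phi> (carrier G)) \<le> (\<Sum>h\<in>carrier G. p (\<phi> h))"
    by (rule p_finsum) (use assms finite_carrier in auto)
  also have "\<dots> \<le> real (card (carrier G)) * r"
    using sum_bounded_above[of "carrier G" "\<lambda>h. p (\<phi> h)" r] assms by simp
  finally have "p (finsum A \<phi> (carrier G)) / card (carrier G) \<le> r"
    using card_pos by (simp add: pos_divide_le_eq mult.commute)
  moreover have "p (avg \<phi>) = p (finsum A \<phi> (carrier G)) / card (carrier G)"
    unfolding avg_def using assms(1) by (subst p_smult) (auto simp: norm_divide)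
  ultimately show ?thesis by simp
qed

text \<open>The adjoint relation is exact here; only multiplicativity holds up to the error
  \<open>e\<close>.\<close>

definition almost_hom :: "real \<Rightarrow> real \<Rightarrow> ('g \<Rightarrow> 'a) \<Rightarrow> bool" where
  "almost_hom M e f \<longleftrightarrow>
     (\<forall>g\<in>carrier G. f g \<in> carrier A \<and> adj A (f g) = f (inv\<^bsub>G\<^esub> g) \<and> p (f g) \<le> M) \<and>
     (\<forall>a\<in>carrier G. \<forall>b\<in>carrier G. p (defect f a b) \<le> e)"

context
  fixes f M e assumes ah: "almost_hom M e f" and M: "M \<ge> 1" and e: "e \<ge> 0"
begin

private lemma f: "g \<in> carrier G \<Longrightarrow> f g \<in> carrier A" "g \<in> carrier G \<Longrightarrow> adj A (f g) = f (inv\<^bsub>G\<^esub> g)"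
    "g \<in> carrier G \<Longrightarrow> p (f g) \<le> M"
    "\<lbrakk>a \<in> carrier G; b \<in> carrier G\<rbrakk> \<Longrightarrow> p (defect f a b) \<le> e"
    "\<lbrakk>a \<in> carrier G; b \<in> carrier G\<rbrakk> \<Longrightarrow> defect f a b \<in> carrier A"
  using ah by (auto simp: almost_hom_def intro!: defect_closed)

text \<open>Each of the three summands of \<open>correction\<close> is at most \<open>M * e\<close>,
  the middle one because \<open>M >= 1\<close>.\<close>

lemma p_correction:
  assumes b: "b \<in> carrier G"
  shows "p (correction f b) \<le> 3 * M * e"
proof -
  let ?Y = "avg (\<lambda>h. f h \<otimes> defect f (inv\<^bsub>G\<^esub> h) b)" and ?D = "defect f \<one>\<^bsub>G\<^esub> b"
  have Y: "?Y \<in> carrier A" "p ?Y \<le> M * e"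
    using b f by (auto intro!: p_avg avg_closed p_mult_le)
  have D: "?D \<in> carrier A" "p ?D \<le> e" using f b by auto
  have eD: "p (f \<one>\<^bsub>G\<^esub> \<otimes> ?D) \<le> M * e" using f b by (intro p_mult_le) auto
  have "p (correction f b) \<le> p (?Y \<ominus> ?D) + p (f \<one>\<^bsub>G\<^esub> \<otimes> ?D)"
    unfolding correction_def by (rule p_add) (use Y D f in auto)
  moreover have "p (?Y \<ominus> ?D) \<le> p ?Y + p ?D" using p_minus Y D by auto
  moreover have "e \<le> M * e" using mult_right_mono[OF M e] by simp
  ultimately show ?thesis using Y D eD by linarith
qed

lemma p_sym_correction:
  assumes b: "b \<in> carrier G"
  shows "p (sym_correction f b) \<le> 3 * M * e"
proof -
  let ?c = "correction f b" and ?d = "adj A (correction f (inv\<^bsub>G\<^esub> b))"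
  have c: "?c \<in> carrier A" "?d \<in> carrier A" using b f(1) by (auto intro!: correction_closed)
  have "p (sym_correction f b) = (1/2) * p (?c \<oplus> ?d)"
    unfolding sym_correction_def using c by (subst p_smult) auto
  also have "p (?c \<oplus> ?d) \<le> p ?c + p ?d" using c by (rule p_add)
  also have "p ?d = p (correction f (inv\<^bsub>G\<^esub> b))"
    using b f(1) by (intro p_adj correction_closed) auto
  finally show ?thesis using p_correction[OF b] p_correction[of "inv\<^bsub>G\<^esub> b"] b by simp
qed

lemma p_residue:
  assumes a: "a \<in> carrier G" and b: "b \<in> carrier G"
  shows "residue f a b \<in> carrier A" "p (residue f a b) \<le> 4 * e\<^sup>2"
proof -
  show "residue f a b \<in> carrier A"
    unfolding residue_def using a b f(1) by (intro minus_cl M.a_closed mult_closed) (auto intro!: correction_closed defect_closed)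
  let ?E = "defect f"
  let ?w = "avg (\<lambda>h. ?E a h \<otimes> ?E (inv\<^bsub>G\<^esub> h) b)" and ?S = "avg (\<lambda>h. ?E h (inv\<^bsub>G\<^esub> h))"
  let ?x = "?S \<otimes> ?E a b" and ?y = "?E a \<one>\<^bsub>G\<^esub> \<otimes> ?E \<one>\<^bsub>G\<^esub> b" and ?z = "?E \<one>\<^bsub>G\<^esub> \<one>\<^bsub>G\<^esub> \<otimes> ?E a b"
  have S: "?S \<in> carrier A" "p ?S \<le> e" using f(4,5) by (auto intro!: avg_closed p_avg)
  have w: "?w \<in> carrier A" "p ?w \<le> e * e"
    using f a b by (auto intro!: p_avg avg_closed p_mult_le)
  have x: "?x \<in> carrier A" "p ?x \<le> e * e"
    and y: "?y \<in> carrier A" "p ?y \<le> e * e"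
    and z: "?z \<in> carrier A" "p ?z \<le> e * e"
    using S f a b by (auto intro!: p_mult_le)
  have "residue f a b = ?w \<oplus> ?x \<oplus> ?y \<oplus> ?z"
    using f(1) a b by (rule residue_quadratic)
  moreover have "p (?w \<oplus> ?x \<oplus> ?y \<oplus> ?z) \<le> p (?w \<oplus> ?x \<oplus> ?y) + p ?z"
    and "p (?w \<oplus> ?x \<oplus> ?y) \<le> p (?w \<oplus> ?x) + p ?y" and "p (?w \<oplus> ?x) \<le> p ?w + p ?x"
    by (intro p_add M.a_closed w x y z)+
  ultimately show "p (residue f a b) \<le> 4 * e\<^sup>2"
    using w x y z by (simp add: power2_eq_square)
qed

text \<open>The two residues contribute \<open>4 * e ^ 2\<close> on average and the product of
  corrections \<open>(3 * M * e) ^ 2\<close>; with \<open>M >= 1\<close> the total is at most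
  \<open>13 * M ^ 2 * e ^ 2\<close>.\<close>

lemma almost_hom_newton: "almost_hom (M + 3 * M * e) (13 * M\<^sup>2 * e\<^sup>2) (newton f)"
  unfolding almost_hom_def
proof (intro conjI ballI)
  fix g assume g: "g \<in> carrier G"
  show "newton f g \<in> carrier A" using f(1) g by (rule newton_closed)
  show "adj A (newton f g) = newton f (inv\<^bsub>G\<^esub> g)" using f(1,2) g by (rule newton_adj)
  show "p (newton f g) \<le> M + 3 * M * e"
    unfolding newton_def
    using p_add[of "f g" "sym_correction f g"] f(1,3)[OF g] p_sym_correction[OF g]
      sym_correction_closed[OF f(1) g] by simp
next
  fix a b assume a: "a \<in> carrier G" and b: "b \<in> carrier G"
  let ?r = "residue f a b" and ?s = "residue f (inv\<^bsub>G\<^esub> b) (inv\<^bsub>G\<^esub> a)"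
  let ?c = "sym_correction f"
  have c: "?c a \<in> carrier A" "?c b \<in> carrier A" using sym_correction_closed[OF f(1)] a b by auto
  have r: "?r \<in> carrier A" "?s \<in> carrier A" using p_residue a b by auto
  have "p (defect (newton f) a b) = p ((1/2) \<odot> (?r \<oplus> adj A ?s) \<ominus> ?c a \<otimes> ?c b)"
    by (subst defect_newton[OF _ _ a b]) (use f in auto)
  also have "\<dots> \<le> p ((1/2) \<odot> (?r \<oplus> adj A ?s)) + p (?c a \<otimes> ?c b)"
    by (rule p_minus) (use r c in auto)
  also have "p ((1/2) \<odot> (?r \<oplus> adj A ?s)) = (1/2) * p (?r \<oplus> adj A ?s)"
    using r by (subst p_smult) auto
  also have "p (?r \<oplus> adj A ?s) \<le> p ?r + p (adj A ?s)" by (rule p_add) (use r in auto)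
  also have "p (adj A ?s) = p ?s" by (rule p_adj) (use r in auto)
  also have "p (?c a \<otimes> ?c b) \<le> (3 * M * e) * (3 * M * e)"
    using p_sym_correction a b c by (intro p_mult_le) auto
  finally have "p (defect (newton f) a b) \<le> (1/2) * (4 * e\<^sup>2 + 4 * e\<^sup>2) + 9 * M\<^sup>2 * e\<^sup>2"
    using p_residue(2)[OF a b] p_residue(2)[of "inv\<^bsub>G\<^esub> b" "inv\<^bsub>G\<^esub> a"] a b
    by (simp add: power2_eq_square algebra_simps)
  moreover have "1 * e\<^sup>2 \<le> M\<^sup>2 * e\<^sup>2" using M by (intro mult_right_mono) auto
  ultimately show "p (defect (newton f) a b) \<le> 13 * M\<^sup>2 * e\<^sup>2" by simp
qed

end

lemma almost_hom_mono: "\<lbrakk>almost_hom M e f; M \<le> M'; e \<le> e'\<rbrakk> \<Longrightarrow> almost_hom M' e' f"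
  unfolding almost_hom_def by force

text \<open>With \<open>L = M + 1\<close> and the starting defect \<open>1 / (26 * L ^ 2)\<close>,
  the factor \<open>13 * L ^ 2 * e\<close> in the quadratic estimate is at most
  \<open>1 / 2\<close>, so each step at least halves the defect. The same factor bounds the k-th
  correction by \<open>1 / 2 ^ (k + 1)\<close>; the corrections sum to at most 1, which keeps all
  norms below \<open>L\<close> and lets one constant serve for every step.\<close>

lemma newton_iterates:
  assumes f: "almost_hom M (1 / (26 * (M + 1)\<^sup>2)) f" and M: "M \<ge> 0"
  shows "almost_hom (M + 1 - 1 / 2 ^ k) (1 / (26 * (M + 1)\<^sup>2) / 2 ^ k) ((newton ^^ k) f)"
proof (induction k)
  case 0
  show ?case using f by simp
next
  case (Suc k)
  define L where "L = M + 1"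
  define e where "e = 1 / (26 * L\<^sup>2) / 2 ^ k"
  have L: "L \<ge> 1" using M by (simp add: L_def)
  have e: "e \<ge> 0" by (simp add: e_def)
  have "almost_hom L e ((newton ^^ k) f)"
    by (rule almost_hom_mono[OF Suc]) (auto simp: L_def e_def)
  have Suc': "almost_hom (L - 1 / 2 ^ k) e ((newton ^^ k) f)" using Suc by (simp add: L_def e_def)
  then have nw: "almost_hom (L + 3 * L * e) (13 * L\<^sup>2 * e\<^sup>2) (newton ((newton ^^ k) f))"
    by (intro almost_hom_newton[OF almost_hom_mono[OF Suc'] L e]) auto
  have Le: "13 * L\<^sup>2 * e = 1 / 2 ^ k / 2" using L by (simp add: e_def)
  have "13 * L\<^sup>2 * e\<^sup>2 = (13 * L\<^sup>2 * e) * e" by (simp add: power2_eq_square)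
  also have "\<dots> \<le> (1 / 2) * e" unfolding Le using e
    by (intro mult_right_mono) (auto simp: field_simps)
  finally have e2: "13 * L\<^sup>2 * e\<^sup>2 \<le> 1 / (26 * L\<^sup>2) / 2 ^ Suc k" by (simp add: e_def)
  have "3 * L \<le> 13 * L\<^sup>2" using L by (simp add: power2_eq_square mult_mono)
  then have "3 * L * e \<le> 13 * L\<^sup>2 * e" using e by (rule mult_right_mono)
  then have c: "3 * L * e \<le> 1 / 2 ^ Suc k" unfolding Le by simp
  \<comment> \<open>\<open>almost_hom_newton\<close> was applied with the coarse bound
    \<open>L\<close> and would let the norms pass beyond \<open>L\<close>. Starting again from the
    sharper \<open>L - 1 / 2 ^ k\<close> leaves room for the next correction.\<close>
  have "p (newton ((newton ^^ k) f) g) \<le> L - 1 / 2 ^ Suc k" if g: "g \<in> carrier G" for g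
  proof -
    have fg: "(newton ^^ k) f g \<in> carrier A" "p ((newton ^^ k) f g) \<le> L - 1 / 2 ^ k"
      using Suc' g by (auto simp: almost_hom_def)
    have "p (sym_correction ((newton ^^ k) f) g) \<le> 3 * L * e"
      by (rule p_sym_correction[OF almost_hom_mono[OF Suc'] L e g]) auto
    moreover have "sym_correction ((newton ^^ k) f) g \<in> carrier A"
      by (rule sym_correction_closed) (use Suc' g in \<open>auto simp: almost_hom_def\<close>)
    ultimately have "p (newton ((newton ^^ k) f) g) \<le> (L - 1 / 2 ^ k) + 3 * L * e"
      unfolding newton_def[of "(newton ^^ k) f"] using p_add[OF fg(1), of "sym_correction ((newton ^^ k) f) g"] fg by simp
    then show ?thesis using c by (simp add: field_simps)
  qed
  then show ?case
    using almost_hom_mono[OF nw order_refl e2] unfolding almost_hom_def L_def by auto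
qed

text \<open>Summability of the steps, which makes the iterates Cauchy for the seminorm
  \<open>p\<close>.\<close>

lemma newton_iterates_step:
  assumes f: "almost_hom M (1 / (26 * (M + 1)\<^sup>2)) f" and M: "M \<ge> 0" and g: "g \<in> carrier G"
  shows "p ((newton ^^ Suc k) f g \<ominus> (newton ^^ k) f g) \<le> 1 / 2 ^ k"
proof -
  define L where "L = M + 1"
  define e where "e = 1 / (26 * L\<^sup>2) / 2 ^ k"
  have L: "L \<ge> 1" using M by (simp add: L_def)
  have e: "e \<ge> 0" by (simp add: e_def)
  have ah: "almost_hom L e ((newton ^^ k) f)"
    by (rule almost_hom_mono[OF newton_iterates[OF f M]]) (auto simp: L_def e_def)
  let ?f = "(newton ^^ k) f"
  have c: "?f g \<in> carrier A" "sym_correction ?f g \<in> carrier A"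
    using ah g by (auto simp: almost_hom_def intro!: sym_correction_closed)
  have eq: "(newton ^^ Suc k) f g \<ominus> ?f g = sym_correction ?f g"
    using c by (simp add: newton_def diff_eq_iff M.a_comm)
  have "p (sym_correction ?f g) \<le> 3 * L * e"
    by (rule p_sym_correction[OF ah L e g])
  moreover have "3 * L \<le> 13 * L\<^sup>2" using L by (simp add: power2_eq_square mult_mono)
  then have "3 * L * e \<le> 13 * L\<^sup>2 * e" using e by (rule mult_right_mono)
  moreover have "13 * L\<^sup>2 * e = 1 / 2 ^ k / 2" using L by (simp add: e_def)
  moreover have "(1::real) / 2 ^ k / 2 \<le> 1 / 2 ^ k" by (simp add: field_simps)
  ultimately show ?thesis unfolding eq by (metis order_trans)
qed

end

section \<open>Quotient norms and limits of ideals\<close>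

text \<open>The algebraic conditions under which addition, scalars, product and adjoint respect
  congruence. The adjoint clause has no counterpart in \<open>closed_ideal\<close>; it is what
  \<open>closed_ideal_adj\<close> provides.\<close>

definition (in star_algebra) star_ideal :: "'a set \<Rightarrow> bool" where
  "star_ideal I \<longleftrightarrow> submodule I complex_ring A \<and>
    (\<forall>a\<in>carrier A. \<forall>x\<in>I. a \<otimes> x \<in> I \<and> x \<otimes> a \<in> I) \<and> (\<forall>x\<in>I. adj A x \<in> I)"

lemma (in cstar_algebra) closed_ideal_star_ideal: "closed_ideal A I \<Longrightarrow> star_ideal I"
  using closed_ideal_adj by (auto simp: closed_ideal_def star_ideal_def)

section \<open>Congruences modulo a self-adjoint ideal\<close>

context star_algebra
begin

context
  fixes I assumes I: "star_ideal I"
begin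

lemma star_ideal_closed:
  shows "\<And>x. x \<in> I \<Longrightarrow> x \<in> carrier A" and "\<zero> \<in> I"
    and "\<And>x y. \<lbrakk>x \<in> I; y \<in> I\<rbrakk> \<Longrightarrow> x \<oplus> y \<in> I"
    and "\<And>c x. x \<in> I \<Longrightarrow> c \<odot> x \<in> I"
    and "\<And>x y. \<lbrakk>x \<in> I; y \<in> I\<rbrakk> \<Longrightarrow> x \<ominus> y \<in> I"
    and "\<And>a x. \<lbrakk>a \<in> carrier A; x \<in> I\<rbrakk> \<Longrightarrow> a \<otimes> x \<in> I"
    and "\<And>a x. \<lbrakk>a \<in> carrier A; x \<in> I\<rbrakk> \<Longrightarrow> x \<otimes> a \<in> I"
    and "\<And>x. x \<in> I \<Longrightarrow> adj A x \<in> I"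
proof -
  have sub: "submodule I complex_ring A" using I by (simp add: star_ideal_def)
  show "x \<in> carrier A" if "x \<in> I" for x using submodule_closed(1)[OF sub that] .
  show "\<zero> \<in> I" using submodule_closed(2)[OF sub] .
  show "x \<oplus> y \<in> I" if "x \<in> I" "y \<in> I" for x y using submodule_closed(3)[OF sub that] .
  show "c \<odot> x \<in> I" if "x \<in> I" for c x using submodule_closed(4)[OF sub that] .
  show "x \<ominus> y \<in> I" if "x \<in> I" "y \<in> I" for x y using submodule_closed(5)[OF sub that] .
qed (use I in \<open>simp_all add: star_ideal_def\<close>)

lemma cong_refl: "x \<in> carrier A \<Longrightarrow> x \<ominus> x \<in> I"
  using diff_zero_iff[of x x] star_ideal_closed(2) by simp

lemma cong_sym:
  assumes "x \<ominus> y \<in> I" "x \<in> carrier A" "y \<in> carrier A"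
  shows "y \<ominus> x \<in> I"
proof -
  have "y \<ominus> x = (-1) \<odot> (x \<ominus> y)" using assms by (simp add: alg M.a_ac)
  then show ?thesis using star_ideal_closed(4)[OF assms(1)] by simp
qed

lemma cong_trans:
  assumes "x \<ominus> y \<in> I" "y \<ominus> z \<in> I" "x \<in> carrier A" "y \<in> carrier A" "z \<in> carrier A"
  shows "x \<ominus> z \<in> I"
proof -
  have "x \<ominus> z = (x \<ominus> y) \<oplus> (y \<ominus> z)"
    by (use assms in \<open>simp add: alg\<close>, rule linear_identity, (rule represents_intros; simp?)+, simp)
  then show ?thesis using star_ideal_closed(3)[OF assms(1,2)] by simp
qed

lemma cong_add:
  assumes "x \<ominus> x' \<in> I" "y \<ominus> y' \<in> I"
    and "x \<in> carrier A" "x' \<in> carrier A" "y \<in> carrier A" "y' \<in> carrier A"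
  shows "(x \<oplus> y) \<ominus> (x' \<oplus> y') \<in> I"
proof -
  have "(x \<oplus> y) \<ominus> (x' \<oplus> y') = (x \<ominus> x') \<oplus> (y \<ominus> y')"
    by (use assms in \<open>simp add: alg\<close>, rule linear_identity, (rule represents_intros; simp?)+, simp)
  then show ?thesis using star_ideal_closed(3)[OF assms(1,2)] by simp
qed

lemma cong_smult:
  assumes "x \<ominus> x' \<in> I" "x \<in> carrier A" "x' \<in> carrier A"
  shows "c \<odot> x \<ominus> c \<odot> x' \<in> I"
proof -
  have "c \<odot> x \<ominus> c \<odot> x' = c \<odot> (x \<ominus> x')" using assms by (simp add: alg)
  then show ?thesis using star_ideal_closed(4)[OF assms(1)] by simp
qed

lemma cong_mult:
  assumes "x \<ominus> x' \<in> I" "y \<ominus> y' \<in> I"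
    and "x \<in> carrier A" "x' \<in> carrier A" "y \<in> carrier A" "y' \<in> carrier A"
  shows "x \<otimes> y \<ominus> x' \<otimes> y' \<in> I"
proof -
  have "x \<otimes> y \<ominus> x' \<otimes> y' = (x \<ominus> x') \<otimes> y \<oplus> x' \<otimes> (y \<ominus> y')"
    by (use assms in \<open>simp add: alg\<close>, rule linear_identity, (rule represents_intros; simp?)+, simp)
  then show ?thesis using star_ideal_closed(3,6,7) assms by simp
qed

lemma cong_adj:
  assumes "x \<ominus> x' \<in> I" "x \<in> carrier A" "x' \<in> carrier A"
  shows "adj A x \<ominus> adj A x' \<in> I"
proof -
  have "adj A x \<ominus> adj A x' = adj A (x \<ominus> x')" using assms by (simp add: alg)
  then show ?thesis using star_ideal_closed(8)[OF assms(1)] by simp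
qed

lemma cong_finsum:
  assumes "finite S" "\<And>x. x \<in> S \<Longrightarrow> f x \<ominus> f' x \<in> I"
    and "\<And>x. x \<in> S \<Longrightarrow> f x \<in> carrier A" "\<And>x. x \<in> S \<Longrightarrow> f' x \<in> carrier A"
  shows "finsum A f S \<ominus> finsum A f' S \<in> I"
  using assms
proof (induction S rule: finite_induct)
  case (insert x S)
  have "finsum A f (insert x S) = f x \<oplus> finsum A f S" "finsum A f' (insert x S) = f' x \<oplus> finsum A f' S"
    using insert by (auto intro!: M.finsum_insert)
  then show ?case using insert by (auto intro!: cong_add)
qed (use cong_refl[of \<zero>] in simp)

end

end

section \<open>Quotient norms as seminorms on the algebra\<close>

context cstar_algebra
begin

text \<open>The norm of the coset of \<open>x\<close>, pulled back to \<open>A\<close>, so that the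
  quotients by different ideals can be compared on the same elements.\<close>

definition quot_norm :: "'a set \<Rightarrow> 'a \<Rightarrow> real" where
  "quot_norm I x = Inf (nrm A ` {z \<in> carrier A. x \<ominus> z \<in> I})"

lemma quot_norm_le: "\<lbrakk>z \<in> carrier A; x \<ominus> z \<in> I\<rbrakk> \<Longrightarrow> quot_norm I x \<le> nrm A z"
  unfolding quot_norm_def by (rule cInf_lower) (auto intro!: bdd_belowI[of _ 0])

context
  fixes I assumes I: "star_ideal I"
begin

lemma quot_norm_approx:
  assumes "x \<in> carrier A" "quot_norm I x < r"
  obtains z where "z \<in> carrier A" "x \<ominus> z \<in> I" "nrm A z < r"
proof -
  have "nrm A ` {z \<in> carrier A. x \<ominus> z \<in> I} \<noteq> {}" using cong_refl[OF I assms(1)] assms(1) by auto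
  then obtain v where "v \<in> nrm A ` {z \<in> carrier A. x \<ominus> z \<in> I}" "v < r"
    using cInf_lessD[of _ r] assms(2) unfolding quot_norm_def by meson
  then show thesis using that by auto
qed

lemma quot_norm_le_nrm: "x \<in> carrier A \<Longrightarrow> quot_norm I x \<le> nrm A x"
  using quot_norm_le cong_refl[OF I] by auto

lemma quot_norm_nonneg:
  assumes "x \<in> carrier A"
  shows "0 \<le> quot_norm I x"
proof (rule ccontr)
  assume "\<not> ?thesis"
  then obtain z where "z \<in> carrier A" "nrm A z < 0" using quot_norm_approx[OF assms, of 0] by auto
  then show False by (meson leD nrm_nonneg)
qed

lemma quot_norm_smult_le:
  assumes "x \<in> carrier A"
  shows "quot_norm I (c \<odot> x) \<le> cmod c * quot_norm I x"
proof (rule field_le_epsilon)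
  fix e :: real assume e: "e > 0"
  \<comment> \<open>The summand 1 keeps the denominator positive when \<open>c = 0\<close>.\<close>
  define d where "d = e / (cmod c + 1)"
  have d: "d > 0" using e by (simp add: d_def add_nonneg_pos)
  obtain z where z: "z \<in> carrier A" "x \<ominus> z \<in> I" "nrm A z < quot_norm I x + d"
    using quot_norm_approx[OF assms, of "quot_norm I x + d"] d by auto
  have "quot_norm I (c \<odot> x) \<le> nrm A (c \<odot> z)"
    by (rule quot_norm_le) (use z assms cong_smult[OF I] in auto)
  also have "\<dots> = cmod c * nrm A z" using z by simp
  also have "\<dots> \<le> cmod c * (quot_norm I x + d)" using z by (intro mult_left_mono) auto
  also have "cmod c * d \<le> (cmod c + 1) * d" using d by simp
  then have "cmod c * (quot_norm I x + d) \<le> cmod c * quot_norm I x + (cmod c + 1) * d"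
    by (simp add: algebra_simps)
  also have "(cmod c + 1) * d = e" unfolding d_def
    by (metis add_nonneg_pos less_numeral_extra(1,3) nonzero_mult_div_cancel_left norm_ge_zero times_divide_eq_right)
  finally show "quot_norm I (c \<odot> x) \<le> cmod c * quot_norm I x + e" .
qed

lemma quot_norm_adj_le:
  assumes "x \<in> carrier A"
  shows "quot_norm I (adj A x) \<le> quot_norm I x"
proof (rule field_le_epsilon)
  fix e :: real assume e: "e > 0"
  obtain z where z: "z \<in> carrier A" "x \<ominus> z \<in> I" "nrm A z < quot_norm I x + e"
    using quot_norm_approx[OF assms, of "quot_norm I x + e"] e by auto
  have "quot_norm I (adj A x) \<le> nrm A (adj A z)"
    by (rule quot_norm_le) (use z assms cong_adj[OF I] in auto)
  then show "quot_norm I (adj A x) \<le> quot_norm I x + e" using z by simp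
qed

lemma star_seminorm_quot_norm: "star_seminorm A (quot_norm I)"
proof unfold_locales
  fix x y assume x: "x \<in> carrier A" and y: "y \<in> carrier A"
  show "quot_norm I (x \<oplus> y) \<le> quot_norm I x + quot_norm I y"
  proof (rule field_le_epsilon)
    fix e :: real assume e: "e > 0"
    obtain z where z: "z \<in> carrier A" "x \<ominus> z \<in> I" "nrm A z < quot_norm I x + e/2"
      using quot_norm_approx[OF x, of "quot_norm I x + e/2"] e by auto
    obtain w where w: "w \<in> carrier A" "y \<ominus> w \<in> I" "nrm A w < quot_norm I y + e/2"
      using quot_norm_approx[OF y, of "quot_norm I y + e/2"] e by auto
    have "quot_norm I (x \<oplus> y) \<le> nrm A (z \<oplus> w)"
      by (rule quot_norm_le) (use x y z w cong_add[OF I] in auto)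
    also have "\<dots> \<le> nrm A z + nrm A w" using z w by (simp add: nrm_add)
    finally show "quot_norm I (x \<oplus> y) \<le> quot_norm I x + quot_norm I y + e" using z w by simp
  qed
  show "quot_norm I (x \<otimes> y) \<le> quot_norm I x * quot_norm I y"
  proof -
    have le: "quot_norm I (x \<otimes> y) \<le> (quot_norm I x + e) * (quot_norm I y + e)" if e: "e > 0" for e
    proof -
      obtain z where z: "z \<in> carrier A" "x \<ominus> z \<in> I" "nrm A z < quot_norm I x + e"
        using quot_norm_approx[OF x, of "quot_norm I x + e"] e by auto
      obtain w where w: "w \<in> carrier A" "y \<ominus> w \<in> I" "nrm A w < quot_norm I y + e"
        using quot_norm_approx[OF y, of "quot_norm I y + e"] e by auto
      have "quot_norm I (x \<otimes> y) \<le> nrm A (z \<otimes> w)"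
        by (rule quot_norm_le) (use x y z w cong_mult[OF I] in auto)
      also have "\<dots> \<le> nrm A z * nrm A w" using z w by (simp add: nrm_mult)
      also have "\<dots> \<le> (quot_norm I x + e) * (quot_norm I y + e)"
        using z w by (intro mult_mono) (use nrm_nonneg[OF z(1)] nrm_nonneg[OF w(1)] in linarith)+
      finally show ?thesis .
    qed
    \<comment> \<open>The error of a product of near-optimal representatives is not linear in
      \<open>e\<close>, so \<open>e\<close> is sent to 0 instead of being split.\<close>
    have "((\<lambda>e. (quot_norm I x + e) * (quot_norm I y + e)) \<longlongrightarrow> (quot_norm I x + 0) * (quot_norm I y + 0)) (at_right 0)"
      by (intro tendsto_intros)
    then have "quot_norm I (x \<otimes> y) \<le> (quot_norm I x + 0) * (quot_norm I y + 0)"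
      by (rule tendsto_lowerbound) (use le in \<open>auto simp: eventually_at_filter\<close>)
    then show ?thesis by simp
  qed
  show "quot_norm I (adj A x) = quot_norm I x"
    using quot_norm_adj_le[OF x] quot_norm_adj_le[of "adj A x"] x by simp
  show "quot_norm I (c \<odot> x) = cmod c * quot_norm I x" for c
  proof (cases "c = 0")
    case True
    then show ?thesis using quot_norm_smult_le[OF x, of 0] quot_norm_nonneg[of \<zero>] x by simp
  next
    case False
    have "cmod c * quot_norm I x = cmod c * quot_norm I (inverse c \<odot> (c \<odot> x))" using x False by simp
    also have "\<dots> \<le> cmod c * (cmod (inverse c) * quot_norm I (c \<odot> x))"
      using x by (intro mult_left_mono quot_norm_smult_le) auto
    also have "\<dots> = quot_norm I (c \<odot> x)" using False by (simp add: norm_inverse)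
    finally show ?thesis using quot_norm_smult_le[OF x, of c] by simp
  qed
qed

lemma quot_norm_zero: "x \<in> I \<Longrightarrow> quot_norm I x = 0"
proof -
  assume x: "x \<in> I"
  have "x \<in> carrier A" using x star_ideal_closed(1)[OF I] by auto
  moreover have "x \<ominus> \<zero> \<in> I" using x star_ideal_closed(2,5)[OF I] by auto
  ultimately show ?thesis using quot_norm_le[of \<zero> x I] quot_norm_nonneg[of x] by simp
qed

lemma quot_norm_mono:
  assumes "I \<subseteq> J" "x \<in> carrier A"
  shows "quot_norm J x \<le> quot_norm I x"
proof (rule field_le_epsilon)
  fix e :: real assume e: "e > 0"
  obtain z where z: "z \<in> carrier A" "x \<ominus> z \<in> I" "nrm A z < quot_norm I x + e"
    using quot_norm_approx[OF assms(2), of "quot_norm I x + e"] e by auto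
  then show "quot_norm J x \<le> quot_norm I x + e" using quot_norm_le[of z x J] assms(1) by auto
qed

lemma quot_norm_zeroD:
  assumes "closedin (ntopology A) I" "x \<in> carrier A" "quot_norm I x \<le> 0"
  shows "x \<in> I"
proof (rule closedin_approx[OF assms(1,2)])
  fix e :: real assume "e > 0"
  then obtain z where z: "z \<in> carrier A" "x \<ominus> z \<in> I" "nrm A z < e"
    using quot_norm_approx[OF assms(2), of e] assms(3) by auto
  moreover have "x \<ominus> (x \<ominus> z) = z" using z assms by (simp add: alg)
  ultimately show "\<exists>y\<in>I. nrm A (x \<ominus> y) < e" by metis
qed

end

section \<open>Closures of increasing unions of ideals\<close>

context
  fixes Jn :: "nat \<Rightarrow> 'a set" and J
  assumes Jn: "\<And>n. star_ideal (Jn n)" and inc: "\<And>n. Jn n \<subseteq> Jn (Suc n)"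
    and J: "J = ntopology A closure_of (\<Union>n. Jn n)"
begin

lemma Jn_mono: "m \<le> n \<Longrightarrow> Jn m \<subseteq> Jn n"
  using lift_Suc_mono_le[of Jn] inc by blast

text \<open>A representative \<open>z\<close> of \<open>x\<close> modulo \<open>Jn n\<close> with
  small norm is the same as a point \<open>x - z\<close> of \<open>Jn n\<close> close to
  \<open>x\<close>. This is how relations that are exact modulo \<open>J\<close> become approximate
  relations modulo some \<open>Jn n\<close>.\<close>

lemma limit_ideal_iff: "x \<in> J \<longleftrightarrow> x \<in> carrier A \<and> (\<forall>e>0. \<exists>n. quot_norm (Jn n) x < e)"
proof (intro iffI conjI allI impI)
  assume x: "x \<in> J"
  then have *: "x \<in> carrier A" "\<And>e. e > 0 \<Longrightarrow> \<exists>n. \<exists>y\<in>Jn n. y \<in> MS.mball x e"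
    unfolding J MS.metric_closure_of by auto
  show "x \<in> carrier A" by fact
  fix e :: real assume "e > 0"
  then obtain n y where y: "y \<in> Jn n" "y \<in> MS.mball x e" using *(2) by blast
  have yc: "y \<in> carrier A" and "nrm A (x \<ominus> y) < e" using y(2) by (auto simp: ndist_def)
  moreover have "x \<ominus> (x \<ominus> y) = y" using * yc by (simp add: alg)
  then have "quot_norm (Jn n) x \<le> nrm A (x \<ominus> y)" using y * yc by (intro quot_norm_le) auto
  ultimately show "\<exists>n. quot_norm (Jn n) x < e" by (meson le_less_trans)
next
  assume *: "x \<in> carrier A \<and> (\<forall>e>0. \<exists>n. quot_norm (Jn n) x < e)"
  show "x \<in> J"
    unfolding J MS.metric_closure_of
  proof (intro CollectI conjI allI impI)
    fix r :: real assume "r > 0"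
    then obtain n where "quot_norm (Jn n) x < r" using * by blast
    then obtain z where z: "z \<in> carrier A" "x \<ominus> z \<in> Jn n" "nrm A z < r"
      using quot_norm_approx[OF Jn] * by blast
    moreover have "x \<ominus> (x \<ominus> z) = z" using z * by (simp add: alg)
    ultimately have "x \<ominus> z \<in> MS.mball x r" using * by (simp add: ndist_def)
    then show "\<exists>y\<in>\<Union>n. Jn n. y \<in> MS.mball x r" using z by blast
  qed (use * in auto)
qed

text \<open>Larger ideals have smaller quotient norms, so smallness persists. This allows a common
  index for finitely many elements.\<close>

lemma limit_ideal_upward:
  assumes "x \<in> J" "e > 0"
  shows "\<exists>n. \<forall>m\<ge>n. quot_norm (Jn m) x < e"
proof -
  obtain n where n: "quot_norm (Jn n) x < e" and x: "x \<in> carrier A" using assms limit_ideal_iff by blast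
  then show ?thesis using quot_norm_mono[OF Jn Jn_mono x] by (meson le_less_trans)
qed

text \<open>\<open>J\<close> is given only as a closure. By \<open>limit_ideal_iff\<close> each
  property of an ideal becomes an estimate for the seminorms.\<close>

lemma star_ideal_limit: "star_ideal J"
proof -
  interpret S: star_seminorm A "quot_norm (Jn n)" for n
    by (rule star_seminorm_quot_norm[OF Jn])
  \<comment> \<open>Covers scalars, products and the adjoint, where one element of \<open>J\<close>
    dominates the result uniformly in \<open>n\<close>. A sum needs a common index instead.\<close>
  have scale: "y \<in> J" if x: "x \<in> J" and y: "y \<in> carrier A" and c: "\<And>n. quot_norm (Jn n) y \<le> c * quot_norm (Jn n) x"
    for x y c
    unfolding limit_ideal_iff
  proof (intro conjI allI impI)
    fix e :: real assume e: "e > 0"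
    have xc: "x \<in> carrier A" using x limit_ideal_iff by blast
    obtain n where n: "quot_norm (Jn n) x < e / (\<bar>c\<bar> + 1)"
      using x limit_ideal_iff e by (metis abs_ge_zero add_nonneg_pos divide_pos_pos zero_less_one)
    have "quot_norm (Jn n) y \<le> c * quot_norm (Jn n) x" by fact
    also have "\<dots> \<le> (\<bar>c\<bar> + 1) * quot_norm (Jn n) x" using S.p_nonneg[OF xc] by (intro mult_right_mono) auto
    also have "\<dots> < (\<bar>c\<bar> + 1) * (e / (\<bar>c\<bar> + 1))" using n by (intro mult_strict_left_mono) auto
    also have "\<dots> = e" by (simp add: add_nonneg_eq_0_iff)
    finally show "\<exists>n. quot_norm (Jn n) y < e" by blast
  qed fact
  have Jc: "x \<in> carrier A" if "x \<in> J" for x using that limit_ideal_iff by blast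
  have smult: "c \<odot> x \<in> J" if "x \<in> J" for c x
    by (rule scale[OF that, of _ "cmod c"]) (use Jc[OF that] S.p_smult in auto)
  have "submodule J complex_ring A"
  proof (rule submoduleI)
    show "J \<subseteq> carrier A" using Jc by auto
    have "quot_norm (Jn n) \<zero> = 0" for n by (rule S.p_zero)
    then show "\<zero> \<in> J" unfolding limit_ideal_iff by auto
    show "\<ominus> a \<in> J" if "a \<in> J" for a using smult[OF that, of "-1"] Jc[OF that] by (simp add: smult_neg1)
    show "a \<odot> x \<in> J" if "x \<in> J" for a x using smult that .
    show "a \<oplus> b \<in> J" if a: "a \<in> J" and b: "b \<in> J" for a b
      unfolding limit_ideal_iff
    proof (intro conjI allI impI)
      fix e :: real assume e: "e > 0"
      obtain n m where n: "\<forall>k\<ge>n. quot_norm (Jn k) a < e/2" and m: "\<forall>k\<ge>m. quot_norm (Jn k) b < e/2"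
        using limit_ideal_upward[OF a, of "e/2"] limit_ideal_upward[OF b, of "e/2"] e by auto
      then have "quot_norm (Jn (max n m)) a < e/2" "quot_norm (Jn (max n m)) b < e/2" by auto
      then have "quot_norm (Jn (max n m)) (a \<oplus> b) < e" using S.p_add[OF Jc[OF a] Jc[OF b], of "max n m"] by linarith
      then show "\<exists>n. quot_norm (Jn n) (a \<oplus> b) < e" by blast
    qed (use Jc a b in auto)
  qed
  moreover have "a \<otimes> x \<in> J" "x \<otimes> a \<in> J" if x: "x \<in> J" and a: "a \<in> carrier A" for a x
  proof -
    have q: "quot_norm (Jn n) a \<le> nrm A a" for n by (rule quot_norm_le_nrm[OF Jn a])
    show "a \<otimes> x \<in> J"
      by (rule scale[OF x, of _ "nrm A a"]) (use Jc[OF x] a q S.p_nonneg in \<open>auto intro!: S.p_mult_le\<close>)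
    show "x \<otimes> a \<in> J"
      by (rule scale[OF x, of _ "nrm A a"], use Jc[OF x] a in simp, subst mult.commute)
        (use Jc[OF x] a q S.p_nonneg in \<open>auto intro!: S.p_mult_le\<close>)
  qed
  moreover have "adj A x \<in> J" if x: "x \<in> J" for x
    by (rule scale[OF x, of _ 1]) (use Jc[OF x] S.p_adj in auto)
  ultimately show ?thesis unfolding star_ideal_def by blast
qed

lemma Jn_subset_limit: "Jn n \<subseteq> J"
proof
  fix x assume x: "x \<in> Jn n"
  then have "quot_norm (Jn n) x = 0" by (rule quot_norm_zero[OF Jn])
  then show "x \<in> J" using star_ideal_closed(1)[OF Jn x] unfolding limit_ideal_iff by metis
qed

lemma closedin_limit: "closedin (ntopology A) J"
  unfolding J by simp

end

text \<open>Completeness with an explicit rate: the tail of a geometric series of ratio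
  \<open>1/2\<close> is twice its first term. The conclusion about closed sets is what keeps a limit
  of homogeneous elements homogeneous.\<close>

lemma geometric_limit:
  assumes y: "\<And>k::nat. y k \<in> carrier A" and d: "\<And>k. nrm A (y (Suc k) \<ominus> y k) \<le> c / 2 ^ k"
  obtains w where "w \<in> carrier A" "\<And>k. nrm A (w \<ominus> y k) \<le> 2 * c / 2 ^ k"
    "\<And>S. closedin (ntopology A) S \<Longrightarrow> range y \<subseteq> S \<Longrightarrow> w \<in> S"
proof -
  have tri: "nrm A (u \<ominus> w) \<le> nrm A (u \<ominus> v) + nrm A (v \<ominus> w)"
    if "u \<in> carrier A" "v \<in> carrier A" "w \<in> carrier A" for u v w
    using MS.triangle[OF that] that by (simp add: ndist_def)
  have "0 \<le> nrm A (y (Suc 0) \<ominus> y 0)" using y by simp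
  also have "\<dots> \<le> c" using d[of 0] by simp
  finally have c0: "c \<ge> 0" .
  \<comment> \<open>The subtracted term makes the induction close: each increment is exactly the
    amount by which it shrinks.\<close>
  have tail: "nrm A (y (k + m) \<ominus> y k) \<le> 2 * c / 2 ^ k - 2 * c / 2 ^ (k + m)" for k m
  proof (induction m)
    case 0
    show ?case using diff_zero_iff[of "y k" "y k"] y by simp
  next
    case (Suc m)
    have "nrm A (y (k + Suc m) \<ominus> y k) \<le> nrm A (y (Suc (k + m)) \<ominus> y (k + m)) + nrm A (y (k + m) \<ominus> y k)"
      using tri[OF y y y] by simp
    also have "\<dots> \<le> c / 2 ^ (k + m) + (2 * c / 2 ^ k - 2 * c / 2 ^ (k + m))" using Suc d[of "k + m"] by simp
    also have "c / 2 ^ (k + m) = 2 * c / 2 ^ (k + m) - 2 * c / 2 ^ (k + Suc m)" by (simp add: field_simps)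
    finally show ?case by simp
  qed
  have tail': "nrm A (y (k + m) \<ominus> y k) \<le> 2 * c / 2 ^ k" for k m
  proof -
    have "0 \<le> 2 * c / 2 ^ (k + m)" using c0 by simp
    then show ?thesis using tail[of k m] by linarith
  qed
  have small: "\<exists>N. 4 * c / 2 ^ N < e" if "e > 0" for e :: real
  proof -
    have "(\<lambda>N. 4 * c * (1/2) ^ N) \<longlonglongrightarrow> 4 * c * 0" by (intro tendsto_intros LIMSEQ_power_zero) simp
    then have "\<forall>\<^sub>F N in sequentially. 4 * c * (1/2) ^ N < e" by (rule order_tendstoD) (use that in simp)
    then show ?thesis by (auto simp: eventually_sequentially power_divide)
  qed
  have "MS.MCauchy y"
    unfolding MS.MCauchy_def
  proof (intro conjI allI impI)
    fix e :: real assume "e > 0"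
    then obtain N where N: "4 * c / 2 ^ N < e" using small by blast
    have "ndist A (y n) (y n') < e" if "N \<le> n" "N \<le> n'" for n n'
    proof -
      have "nrm A (y n \<ominus> y n') \<le> nrm A (y n \<ominus> y N) + nrm A (y n' \<ominus> y N)"
        using tri[of "y n" "y N" "y n'"] nrm_minus_commute[of "y n'" "y N"] y by simp
      also have "\<dots> \<le> 2 * c / 2 ^ N + 2 * c / 2 ^ N"
        using tail'[of N "n - N"] tail'[of N "n' - N"] that by (intro add_mono) auto
      also have "\<dots> = 4 * c / 2 ^ N" by simp
      finally show ?thesis using N y by (simp add: ndist_def)
    qed
    then show "\<exists>N. \<forall>n n'. N \<le> n \<longrightarrow> N \<le> n' \<longrightarrow> ndist A (y n) (y n') < e" by blast
  qed (use y in auto)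
  then obtain w where w: "limitin (ntopology A) y w sequentially"
    using complete unfolding MS.mcomplete_def by blast
  then have wc: "w \<in> carrier A" and lim: "\<And>e. e > 0 \<Longrightarrow> \<exists>N. \<forall>n\<ge>N. nrm A (y n \<ominus> w) < e"
    using y unfolding MS.limit_metric_sequentially by (auto simp: ndist_def)
  have "nrm A (w \<ominus> y k) \<le> 2 * c / 2 ^ k" for k
  proof (rule field_le_epsilon)
    fix e :: real assume "e > 0"
    then obtain N where N: "\<And>n. n \<ge> N \<Longrightarrow> nrm A (y n \<ominus> w) < e" using lim by blast
    have "nrm A (w \<ominus> y k) \<le> nrm A (w \<ominus> y (k + N)) + nrm A (y (k + N) \<ominus> y k)"
      using tri wc y by blast
    also have "nrm A (w \<ominus> y (k + N)) < e" using N[of "k + N"] nrm_minus_commute[OF wc y] by simp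
    finally show "nrm A (w \<ominus> y k) \<le> 2 * c / 2 ^ k + e" using tail'[of k N] by simp
  qed
  moreover have "w \<in> S" if "closedin (ntopology A) S" "range y \<subseteq> S" for S
    using that w unfolding MS.metric_closedin_iff_sequentially_closed by blast
  ultimately show thesis using wc that by blast
qed

end

section \<open>Lifting homogeneous multiplicative families\<close>

context graded_cstar_algebra
begin

sublocale SG: star_algebra_group A G
  by unfold_locales (rule finite_group)

lemma gcomp_carrier: "\<lbrakk>g \<in> carrier G; x \<in> gcomp g\<rbrakk> \<Longrightarrow> x \<in> carrier A"
  using A.submodule_closed(1)[OF gcomp_submodule] .

text \<open>The homogeneous projections are bounded; here the equivalence of the direct sum norm
  with the given norm enters. The constant is replaced by its absolute value so that later estimates
  can be multiplied by it.\<close>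

lemma component_bound:
  "\<exists>K\<ge>0. \<forall>g\<in>carrier G. \<forall>f. (\<forall>h\<in>carrier G. f h \<in> gcomp h) \<longrightarrow>
     nrm A (f g) \<le> K * nrm A (finsum A f (carrier G))"
proof -
  obtain K where K: "\<And>f. f \<in> (\<Pi>\<^sub>E g\<in>carrier G. gcomp g) \<Longrightarrow>
      (\<Sum>g\<in>carrier G. nrm A (f g)) \<le> K * nrm A (finsum A f (carrier G))"
    using direct_sum_norm by blast
  have "nrm A (f g) \<le> \<bar>K\<bar> * nrm A (finsum A f (carrier G))"
    if g: "g \<in> carrier G" and f: "\<And>h. h \<in> carrier G \<Longrightarrow> f h \<in> gcomp h" for f g
  proof -
    let ?f = "restrict f (carrier G)"
    have fc: "\<And>h. h \<in> carrier G \<Longrightarrow> f h \<in> carrier A" using f gcomp_carrier by blast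
    have eq: "finsum A ?f (carrier G) = finsum A f (carrier G)"
      by (rule A.M.finsum_cong') (use fc in auto)
    have "nrm A (f g) \<le> (\<Sum>h\<in>carrier G. nrm A (?f h))"
      using member_le_sum[OF g, of "\<lambda>h. nrm A (?f h)"] fc finite_group g by simp
    also have "\<dots> \<le> K * nrm A (finsum A ?f (carrier G))"
      by (rule K) (use f in auto)
    also have "\<dots> \<le> \<bar>K\<bar> * nrm A (finsum A ?f (carrier G))"
      using fc by (intro mult_right_mono) (auto simp: eq)
    finally show ?thesis by (simp add: eq)
  qed
  then show ?thesis by (intro exI[of _ "\<bar>K\<bar>"]) simp
qed

text \<open>A nearly optimal representative \<open>z\<close> of \<open>x\<close> modulo
  \<open>I\<close> need not be homogeneous, but its component of degree \<open>g\<close> still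
  represents \<open>x\<close>: \<open>x - z\<close> lies in the graded ideal \<open>I\<close>, hence
  so does its component. The constant is uniform, as the lemma is applied to infinitely many
  increments.\<close>

lemma homogeneous_approx:
  "\<exists>K. \<forall>I g x e. graded_ideal G A gcomp I \<longrightarrow> g \<in> carrier G \<longrightarrow> x \<in> gcomp g \<longrightarrow>
     A.quot_norm I x < e \<longrightarrow> (\<exists>y\<in>gcomp g. x \<ominus>\<^bsub>A\<^esub> y \<in> I \<and> nrm A y \<le> K * e)"
proof -
  obtain K where K: "K \<ge> 0" "\<forall>g\<in>carrier G. \<forall>f. (\<forall>h\<in>carrier G. f h \<in> gcomp h) \<longrightarrow>
       nrm A (f g) \<le> K * nrm A (finsum A f (carrier G))"
    using component_bound by blast
  have "\<exists>y\<in>gcomp g. x \<ominus>\<^bsub>A\<^esub> y \<in> I \<and> nrm A y \<le> K * e"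
    if gr: "graded_ideal G A gcomp I" and g: "g \<in> carrier G" and x: "x \<in> gcomp g"
      and e: "A.quot_norm I x < e" for I x g e
  proof -
    have I: "A.star_ideal I" using gr A.closed_ideal_star_ideal unfolding graded_ideal_def by blast
    have xc: "x \<in> carrier A" using gcomp_carrier g x by blast
    obtain z where z: "z \<in> carrier A" "x \<ominus>\<^bsub>A\<^esub> z \<in> I" "nrm A z < e"
      using A.quot_norm_approx[OF I xc e] by blast
    obtain f where f: "f \<in> (\<Pi> g\<in>carrier G. I \<inter> gcomp g)" "x \<ominus>\<^bsub>A\<^esub> z = finsum A f (carrier G)"
      using gr z(2) unfolding graded_ideal_def graded_subspace_def by blast
    have fc: "\<And>h. h \<in> carrier G \<Longrightarrow> f h \<in> carrier A" using f(1) gcomp_carrier by blast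
    have sum: "finsum A f (carrier G) = f g \<oplus>\<^bsub>A\<^esub> finsum A f (carrier G - {g})"
      using A.M.finsum_insert[of "carrier G - {g}" g f] g finite_group fc by (simp add: insert_absorb Pi_def)
    \<comment> \<open>The components of \<open>z\<close>: \<open>x\<close> contributes only in
      degree \<open>g\<close>, and \<open>f\<close> decomposes \<open>x - z\<close>.\<close>
    let ?f = "\<lambda>h. if h = g then x \<ominus>\<^bsub>A\<^esub> f g else (-1) \<odot>\<^bsub>A\<^esub> f h"
    have "finsum A ?f (carrier G) = ?f g \<oplus>\<^bsub>A\<^esub> finsum A ?f (carrier G - {g})"
      using A.M.finsum_insert[of "carrier G - {g}" g ?f] g finite_group fc xc by (simp add: insert_absorb Pi_def)
    also have "finsum A ?f (carrier G - {g}) = finsum A (\<lambda>h. (-1) \<odot>\<^bsub>A\<^esub> f h) (carrier G - {g})"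
      by (rule A.M.finsum_cong') (use fc in auto)
    also have "\<dots> = (-1) \<odot>\<^bsub>A\<^esub> finsum A f (carrier G - {g})"
      by (rule A.finsum_smult[symmetric]) (use fc finite_group in auto)
    also have "?f g \<oplus>\<^bsub>A\<^esub> \<dots> = x \<ominus>\<^bsub>A\<^esub> (x \<ominus>\<^bsub>A\<^esub> z)"
      unfolding f(2) sum using fc g xc A.finsum_cl[of "carrier G - {g}" f] by (simp add: A.alg)
    also have "\<dots> = z" using xc z by (simp add: A.alg)
    finally have fz: "finsum A ?f (carrier G) = z" .
    have "nrm A (?f g) \<le> K * nrm A (finsum A ?f (carrier G))"
    proof (rule K(2)[rule_format, OF g])
      fix h assume h: "h \<in> carrier G"
      have "f h \<in> gcomp h" using h f(1) by auto
      then show "?f h \<in> gcomp h" using x A.submodule_closed(4,5)[OF gcomp_submodule[OF h]] by auto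
    qed
    then have "nrm A (x \<ominus>\<^bsub>A\<^esub> f g) \<le> K * e"
      using z(3) K(1) by (simp add: fz) (meson less_imp_le mult_left_mono order_trans)
    moreover have "x \<ominus>\<^bsub>A\<^esub> f g \<in> gcomp g"
      using g x f(1) A.submodule_closed(5)[OF gcomp_submodule[OF g]] by auto
    moreover have "x \<ominus>\<^bsub>A\<^esub> (x \<ominus>\<^bsub>A\<^esub> f g) = f g" using xc fc g by (simp add: A.alg)
    then have "x \<ominus>\<^bsub>A\<^esub> (x \<ominus>\<^bsub>A\<^esub> f g) \<in> I" using f(1) g by auto
    ultimately show ?thesis by blast
  qed
  then show ?thesis by blast
qed

text \<open>The sequence is Cauchy only modulo \<open>I\<close>, while completeness and closedness
  of \<open>gcomp g\<close> live in \<open>A\<close>. So each increment is exchanged, modulo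
  \<open>I\<close>, for a homogeneous element of geometrically small norm, and the series is summed
  in \<open>A\<close>. The partial sums stay congruent to \<open>x k\<close> modulo
  \<open>I\<close>, and to \<open>x 0\<close> modulo \<open>J\<close>.\<close>

lemma homogeneous_limit:
  assumes gr: "graded_ideal G A gcomp I" and IJ: "I \<subseteq> J"
    and J: "A.star_ideal J" "closedin (ntopology A) J"
    and g: "g \<in> carrier G" and x: "\<And>k::nat. x k \<in> gcomp g"
    and d: "\<And>k. A.quot_norm I (x (Suc k) \<ominus>\<^bsub>A\<^esub> x k) \<le> 1 / 2 ^ k"
    and dJ: "\<And>k. x (Suc k) \<ominus>\<^bsub>A\<^esub> x k \<in> J"
  shows "\<exists>w\<in>gcomp g. (\<exists>K. \<forall>k. A.quot_norm I (w \<ominus>\<^bsub>A\<^esub> x k) \<le> K / 2 ^ k) \<and> w \<ominus>\<^bsub>A\<^esub> x 0 \<in> J"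
proof -
  have I: "A.star_ideal I" using gr A.closed_ideal_star_ideal unfolding graded_ideal_def by blast
  have xc: "x k \<in> carrier A" for k using gcomp_carrier[OF g x] .
  note gc = A.submodule_closed[OF gcomp_submodule[OF g]]
  obtain K where K: "\<forall>I g x e. graded_ideal G A gcomp I \<longrightarrow> g \<in> carrier G \<longrightarrow> x \<in> gcomp g \<longrightarrow>
      A.quot_norm I x < e \<longrightarrow> (\<exists>y\<in>gcomp g. x \<ominus>\<^bsub>A\<^esub> y \<in> I \<and> nrm A y \<le> K * e)"
    using homogeneous_approx ..
  have "\<exists>y\<in>gcomp g. (x (Suc k) \<ominus>\<^bsub>A\<^esub> x k) \<ominus>\<^bsub>A\<^esub> y \<in> I \<and> nrm A y \<le> K * (2 / 2 ^ k)" for k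
  proof (rule K[rule_format, OF gr g])
    show "x (Suc k) \<ominus>\<^bsub>A\<^esub> x k \<in> gcomp g" by (intro gc(5) x)
    \<comment> \<open>The infimum in the quotient norm need not be attained, hence the strict
      inequality and the factor 2.\<close>
    have "(1::real) / 2 ^ k < 2 / 2 ^ k" by (simp add: divide_strict_right_mono)
    with d[of k] show "A.quot_norm I (x (Suc k) \<ominus>\<^bsub>A\<^esub> x k) < 2 / 2 ^ k" by linarith
  qed
  then have "\<forall>k. \<exists>y. y \<in> gcomp g \<and> (x (Suc k) \<ominus>\<^bsub>A\<^esub> x k) \<ominus>\<^bsub>A\<^esub> y \<in> I \<and> nrm A y \<le> 2 * K / 2 ^ k"
    by (simp add: Bex_def mult.commute)
  from choice[OF this] obtain y where y: "\<And>k. y k \<in> gcomp g"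
    "\<And>k. (x (Suc k) \<ominus>\<^bsub>A\<^esub> x k) \<ominus>\<^bsub>A\<^esub> y k \<in> I" "\<And>k. nrm A (y k) \<le> 2 * K / 2 ^ k"
    by blast
  have yc: "y k \<in> carrier A" for k using gcomp_carrier[OF g y(1)] .
  define s where "s = rec_nat (x 0) (\<lambda>k t. t \<oplus>\<^bsub>A\<^esub> y k)"
  have s0: "s 0 = x 0" and sS: "\<And>k. s (Suc k) = s k \<oplus>\<^bsub>A\<^esub> y k" by (simp_all add: s_def)
  have sg: "s k \<in> gcomp g" for k by (induction k) (auto simp: s0 sS x y gc(3))
  have sc: "s k \<in> carrier A" for k using gcomp_carrier[OF g sg] .
  have diff: "s (Suc k) \<ominus>\<^bsub>A\<^esub> s k = y k" for k using sc yc by (simp add: sS A.diff_eq_iff A.M.a_comm)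
  have xs: "x k \<ominus>\<^bsub>A\<^esub> s k \<in> I" for k
  proof (induction k)
    case 0
    show ?case using A.cong_refl[OF I xc] by (simp add: s0)
  next
    case (Suc k)
    have "x (Suc k) \<ominus>\<^bsub>A\<^esub> s (Suc k) = ((x (Suc k) \<ominus>\<^bsub>A\<^esub> x k) \<ominus>\<^bsub>A\<^esub> y k) \<oplus>\<^bsub>A\<^esub> (x k \<ominus>\<^bsub>A\<^esub> s k)"
      by (use xc yc sc in \<open>simp add: A.alg sS\<close>, rule A.linear_identity, (rule A.represents_intros; simp?)+, simp)
    then show ?case using A.star_ideal_closed(3)[OF I y(2) Suc] by simp
  qed
  \<comment> \<open>The exchanged increment differs from the original one, which lies in
    \<open>J\<close>, by an element of \<open>I\<close>, and \<open>I\<close> is contained in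
    \<open>J\<close>.\<close>
  have yJ: "y k \<in> J" for k
  proof -
    have "y k = (x (Suc k) \<ominus>\<^bsub>A\<^esub> x k) \<ominus>\<^bsub>A\<^esub> ((x (Suc k) \<ominus>\<^bsub>A\<^esub> x k) \<ominus>\<^bsub>A\<^esub> y k)"
      by (use xc[of k] xc[of "Suc k"] yc[of k] in \<open>simp add: A.alg\<close>, rule A.linear_identity, (rule A.represents_intros; simp?)+, simp)
    then show ?thesis using A.star_ideal_closed(5)[OF J(1) dJ] y(2) IJ by (metis subsetD)
  qed
  have sJ: "s k \<ominus>\<^bsub>A\<^esub> x 0 \<in> J" for k
  proof (induction k)
    case 0
    show ?case using A.cong_refl[OF J(1) xc] by (simp add: s0)
  next
    case (Suc k)
    have "s (Suc k) \<ominus>\<^bsub>A\<^esub> x 0 = (s k \<ominus>\<^bsub>A\<^esub> x 0) \<oplus>\<^bsub>A\<^esub> y k"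
      using xc sc yc by (simp add: sS A.alg A.M.a_ac)
    then show ?case using A.star_ideal_closed(3)[OF J(1) Suc yJ] by simp
  qed
  obtain w where w: "w \<in> carrier A" "\<And>k. nrm A (w \<ominus>\<^bsub>A\<^esub> s k) \<le> 2 * (2 * K) / 2 ^ k"
    "\<And>S. closedin (ntopology A) S \<Longrightarrow> range s \<subseteq> S \<Longrightarrow> w \<in> S"
    using A.geometric_limit[of s "2 * K"] sc diff y(3) by metis
  have wg: "w \<in> gcomp g" by (rule w(3)) (use gcomp_closed[OF g] sg in auto)
  have "A.quot_norm I (w \<ominus>\<^bsub>A\<^esub> x k) \<le> (4 * K) / 2 ^ k" for k
  proof -
    have "(w \<ominus>\<^bsub>A\<^esub> x k) \<ominus>\<^bsub>A\<^esub> (w \<ominus>\<^bsub>A\<^esub> s k) = s k \<ominus>\<^bsub>A\<^esub> x k"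
      by (use w(1) xc[of k] sc[of k] in \<open>simp add: A.alg\<close>, rule A.linear_identity, (rule A.represents_intros; simp?)+, simp)
    then have "A.quot_norm I (w \<ominus>\<^bsub>A\<^esub> x k) \<le> nrm A (w \<ominus>\<^bsub>A\<^esub> s k)"
      using w(1) xc[of k] sc[of k] A.cong_sym[OF I xs] by (intro A.quot_norm_le) auto
    then show ?thesis using w(2)[of k] by simp
  qed
  moreover have "w \<ominus>\<^bsub>A\<^esub> x 0 \<in> J"
  proof (rule A.closedin_approx[OF J(2)])
    fix e :: real assume e: "e > 0"
    have "(\<lambda>N. 4 * K * (1/2) ^ N) \<longlonglongrightarrow> 4 * K * 0" by (intro tendsto_intros LIMSEQ_power_zero) simp
    then have "\<forall>\<^sub>F N in sequentially. 4 * K * (1/2) ^ N < e" by (rule order_tendstoD) (use e in simp)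
    then obtain N where N: "4 * K * (1/2) ^ N < e" by (auto simp: eventually_sequentially)
    have "(w \<ominus>\<^bsub>A\<^esub> x 0) \<ominus>\<^bsub>A\<^esub> (s N \<ominus>\<^bsub>A\<^esub> x 0) = w \<ominus>\<^bsub>A\<^esub> s N"
      by (use w(1) xc[of 0] sc[of N] in \<open>simp add: A.alg\<close>, rule A.linear_identity, (rule A.represents_intros; simp?)+, simp)
    then have "nrm A ((w \<ominus>\<^bsub>A\<^esub> x 0) \<ominus>\<^bsub>A\<^esub> (s N \<ominus>\<^bsub>A\<^esub> x 0)) < e"
      using w(2)[of N] N by (simp add: power_divide)
    then show "\<exists>y\<in>J. nrm A ((w \<ominus>\<^bsub>A\<^esub> x 0) \<ominus>\<^bsub>A\<^esub> y) < e" using sJ by blast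
  qed (use w(1) xc in auto)
  ultimately show ?thesis using wg by blast
qed

lemma newton_homogeneous:
  assumes f: "\<And>g. g \<in> carrier G \<Longrightarrow> f g \<in> gcomp g" and g: "g \<in> carrier G"
  shows "SG.newton f g \<in> gcomp g"
proof -
  have D: "SG.defect f a b \<in> gcomp (a \<otimes> b)" if "a \<in> carrier G" "b \<in> carrier G" for a b
    unfolding SG.defect_def using that f
    by (intro A.submodule_closed(5)[OF gcomp_submodule] gcomp_mult) auto
  have corr: "SG.correction f b \<in> gcomp b" if b: "b \<in> carrier G" for b
  proof -
    note gc = A.submodule_closed[OF gcomp_submodule[OF b]]
    have "f h \<otimes>\<^bsub>A\<^esub> SG.defect f (inv h) b \<in> gcomp b" if h: "h \<in> carrier G" for h
      using gcomp_mult[OF h _ f[OF h] D[of "inv h" b]] h b by (simp add: m_assoc[symmetric])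
    then have "SG.avg (\<lambda>h. f h \<otimes>\<^bsub>A\<^esub> SG.defect f (inv h) b) \<in> gcomp b"
      unfolding SG.avg_def by (intro gc(4) A.submodule_finsum[OF gcomp_submodule[OF b]])
    moreover have d: "SG.defect f \<one> b \<in> gcomp b" using D[of \<one> b] b by simp
    moreover have "f \<one> \<otimes>\<^bsub>A\<^esub> SG.defect f \<one> b \<in> gcomp b"
      using gcomp_mult[OF _ b f d, of \<one>] b by simp
    ultimately show ?thesis unfolding SG.correction_def by (intro gc(3,5))
  qed
  have "adj A (SG.correction f (inv g)) \<in> gcomp g"
    using gcomp_adj[OF _ corr[of "inv g"]] g by simp
  then show ?thesis
    unfolding SG.newton_def SG.sym_correction_def
    using f[OF g] corr[OF g] A.submodule_closed(3,4)[OF gcomp_submodule[OF g]] by blast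
qed

text \<open>One iteration is watched through two seminorms. Modulo a suitable \<open>Jn n\<close>
  its defect tends to zero, so the limit is exact there; modulo \<open>J\<close> the defect vanishes
  throughout, so the limit still represents the given family.\<close>

lemma multiplicative_lift:
  assumes Jn: "\<And>n. graded_ideal G A gcomp (Jn n)" and inc: "\<And>n. Jn n \<subseteq> Jn (Suc n)"
    and J: "J = ntopology A closure_of (\<Union>n. Jn n)"
    and v: "\<And>g. g \<in> carrier G \<Longrightarrow> v g \<in> gcomp g"
    and v_mult: "\<And>g h. \<lbrakk>g \<in> carrier G; h \<in> carrier G\<rbrakk> \<Longrightarrow> v (g \<otimes> h) \<ominus>\<^bsub>A\<^esub> v g \<otimes>\<^bsub>A\<^esub> v h \<in> J"
    and v_adj: "\<And>g. g \<in> carrier G \<Longrightarrow> v (inv g) \<ominus>\<^bsub>A\<^esub> adj A (v g) \<in> J"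
  shows "\<exists>n w. (\<forall>g\<in>carrier G. w g \<in> gcomp g \<and> w g \<ominus>\<^bsub>A\<^esub> v g \<in> J \<and>
      w (inv g) \<ominus>\<^bsub>A\<^esub> adj A (w g) \<in> Jn n \<and>
      (\<forall>h\<in>carrier G. w (g \<otimes> h) \<ominus>\<^bsub>A\<^esub> w g \<otimes>\<^bsub>A\<^esub> w h \<in> Jn n))"
proof -
  have In: "A.star_ideal (Jn n)" "closedin (ntopology A) (Jn n)" for n
    using Jn[of n] A.closed_ideal_star_ideal unfolding graded_ideal_def closed_ideal_def by auto
  have IJ: "A.star_ideal J" "closedin (ntopology A) J" and JnJ: "Jn n \<subseteq> J" for n
    using A.star_ideal_limit[OF In(1) inc J] A.closedin_limit[OF In(1) inc J]
      A.Jn_subset_limit[OF In(1) inc J] by auto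
  note Jcl = A.star_ideal_closed[OF IJ(1)]
  have vc: "v g \<in> carrier A" if "g \<in> carrier G" for g using gcomp_carrier v that by blast
  \<comment> \<open>Symmetrising makes the adjoint relation exact in the algebra; by
    \<open>v_adj\<close> it changes \<open>v\<close> only within \<open>J\<close>.\<close>
  define f where "f g = (1/2) \<odot>\<^bsub>A\<^esub> (v g \<oplus>\<^bsub>A\<^esub> adj A (v (inv g)))" for g
  have fc: "f g \<in> carrier A" if "g \<in> carrier G" for g unfolding f_def using vc that by auto
  have fg: "f g \<in> gcomp g" if g: "g \<in> carrier G" for g
    unfolding f_def using gcomp_adj[OF _ v[of "inv g"]] v[OF g] g A.submodule_closed(3,4)[OF gcomp_submodule[OF g]]
    by simp
  have f_adj: "adj A (f g) = f (inv g)" if "g \<in> carrier G" for g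
    unfolding f_def using vc that by (simp add: A.adj_add A.M.a_comm)
  have fv: "f g \<ominus>\<^bsub>A\<^esub> v g \<in> J" if g: "g \<in> carrier G" for g
  proof -
    have "v g \<ominus>\<^bsub>A\<^esub> adj A (v (inv g)) \<in> J" using v_adj[of "inv g"] g by simp
    from Jcl(4)[OF this, of "-1/2"] show ?thesis
      using vc g by (simp add: f_def A.alg A.M.a_ac)
  qed
  have defJ: "SG.defect f a b \<in> J" if a: "a \<in> carrier G" and b: "b \<in> carrier G" for a b
  proof -
    have "f (a \<otimes> b) \<ominus>\<^bsub>A\<^esub> v a \<otimes>\<^bsub>A\<^esub> v b \<in> J"
      using A.cong_trans[OF IJ(1) fv[of "a \<otimes> b"] v_mult[OF a b]] fc vc a b by simp
    moreover have "v a \<otimes>\<^bsub>A\<^esub> v b \<ominus>\<^bsub>A\<^esub> f a \<otimes>\<^bsub>A\<^esub> f b \<in> J"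
      using A.cong_sym[OF IJ(1) A.cong_mult[OF IJ(1) fv[OF a] fv[OF b]]] fc vc a b by simp
    ultimately show ?thesis
      unfolding SG.defect_def using A.cong_trans[OF IJ(1)] fc vc a b by blast
  qed
  define M where "M = (\<Sum>g\<in>carrier G. nrm A (f g))"
  have M: "nrm A (f g) \<le> M" if "g \<in> carrier G" for g
    unfolding M_def using member_le_sum[OF that, of "\<lambda>g. nrm A (f g)"] fc finite_group by simp
  have M0: "M \<ge> 0" unfolding M_def using fc by (intro sum_nonneg) auto
  \<comment> \<open>The threshold below which \<open>newton_iterates\<close> converges.\<close>
  define e where "e = 1 / (26 * (M + 1)\<^sup>2)"
  have e: "e > 0" using M0 by (simp add: e_def)
  have "\<forall>ab\<in>carrier G \<times> carrier G. \<exists>n. \<forall>m\<ge>n. A.quot_norm (Jn m) (SG.defect f (fst ab) (snd ab)) < e"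
    using A.limit_ideal_upward[OF In(1) inc J defJ e] by auto
  then obtain N where N: "\<And>ab m. ab \<in> carrier G \<times> carrier G \<Longrightarrow> m \<ge> N ab
      \<Longrightarrow> A.quot_norm (Jn m) (SG.defect f (fst ab) (snd ab)) < e" by metis
  \<comment> \<open>The sum dominates each of the finitely many indices, so one ideal
    \<open>Jn n\<close> serves all pairs.\<close>
  define n where "n = (\<Sum>ab\<in>carrier G \<times> carrier G. N ab)"
  have n: "A.quot_norm (Jn n) (SG.defect f a b) \<le> e" if "a \<in> carrier G" "b \<in> carrier G" for a b
  proof -
    have "N (a, b) \<le> n" unfolding n_def using finite_group that
      by (intro member_le_sum) auto
    then show ?thesis using N[of "(a, b)" n] that by auto
  qed
  let ?q = "A.quot_norm (Jn n)" and ?r = "A.quot_norm J"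
  interpret S: star_seminorm A ?q by (rule A.star_seminorm_quot_norm[OF In(1)])
  interpret SJ: star_seminorm A ?r by (rule A.star_seminorm_quot_norm[OF IJ(1)])
  interpret Q: star_seminorm_group A ?q G ..
  interpret R: star_seminorm_group A ?r G ..
  define x where "x k = (SG.newton ^^ k) f" for k
  have xg: "x k g \<in> gcomp g" if "g \<in> carrier G" for k g
    using that by (induction k arbitrary: g) (auto simp: x_def fg intro: newton_homogeneous)
  have xc: "x k g \<in> carrier A" if "g \<in> carrier G" for k g using gcomp_carrier[OF that xg[OF that]] .
  have ah: "Q.almost_hom M e f"
    unfolding Q.almost_hom_def using fc f_adj n M A.quot_norm_le_nrm[OF In(1)] by (meson order_trans)
  have ahk: "Q.almost_hom (M + 1) (e / 2 ^ k) (x k)" for k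
    unfolding x_def by (rule Q.almost_hom_mono[OF Q.newton_iterates[OF ah[unfolded e_def] M0, of k]])
      (auto simp: e_def)
  have step: "?q (x (Suc k) g \<ominus>\<^bsub>A\<^esub> x k g) \<le> 1 / 2 ^ k" if "g \<in> carrier G" for k g
    unfolding x_def by (rule Q.newton_iterates_step[OF ah[unfolded e_def] M0 that])
  \<comment> \<open>With \<open>e = 0\<close> the estimates of \<open>almost_hom_newton\<close>
    reproduce themselves: the family stays multiplicative modulo \<open>J\<close>, and by
    \<open>p_sym_correction\<close> the corrections have quotient norm 0.\<close>
  have ahJ: "R.almost_hom (M + 1) 0 (x k)" for k
  proof (induction k)
    case 0
    have "?r (f g) \<le> M + 1" if "g \<in> carrier G" for g
      using A.quot_norm_le_nrm[OF IJ(1) fc[OF that]] M[OF that] by linarith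
    then show ?case unfolding R.almost_hom_def x_def
      using fc f_adj A.quot_norm_zero[OF IJ(1) defJ] by simp
  next
    case (Suc k)
    show ?case using R.almost_hom_newton[OF Suc] M0 by (simp add: x_def)
  qed
  have stepJ: "x (Suc k) g \<ominus>\<^bsub>A\<^esub> x k g \<in> J" if g: "g \<in> carrier G" for k g
  proof -
    have c: "SG.sym_correction (x k) g \<in> carrier A" by (rule SG.sym_correction_closed) (simp_all add: xc g)
    have "x (Suc k) g \<ominus>\<^bsub>A\<^esub> x k g = SG.sym_correction (x k) g"
      using c xc[OF g] by (simp add: x_def SG.newton_def[of "(SG.newton ^^ k) f"] A.diff_eq_iff A.M.a_comm)
    moreover have "SG.sym_correction (x k) g \<in> J"
      using R.p_sym_correction[OF ahJ[of k] _ _ g] M0 by (intro A.quot_norm_zeroD[OF IJ c]) auto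
    ultimately show ?thesis by simp
  qed
  have "\<forall>g\<in>carrier G. \<exists>w. w \<in> gcomp g \<and> (\<exists>K. \<forall>k. ?q (w \<ominus>\<^bsub>A\<^esub> x k g) \<le> K / 2 ^ k) \<and> w \<ominus>\<^bsub>A\<^esub> x 0 g \<in> J"
    using homogeneous_limit[OF Jn JnJ IJ, of _ "\<lambda>k. x k _"] xg step stepJ by (simp add: Bex_def)
  from bchoice[OF this] obtain w where w: "\<forall>g\<in>carrier G. w g \<in> gcomp g \<and>
      (\<exists>K. \<forall>k. ?q (w g \<ominus>\<^bsub>A\<^esub> x k g) \<le> K / 2 ^ k) \<and> w g \<ominus>\<^bsub>A\<^esub> x 0 g \<in> J" by blast
  then have "\<forall>g\<in>carrier G. \<exists>K. \<forall>k. ?q (w g \<ominus>\<^bsub>A\<^esub> x k g) \<le> K / 2 ^ k" by blast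
  from bchoice[OF this] obtain K where K: "\<And>g k. g \<in> carrier G \<Longrightarrow> ?q (w g \<ominus>\<^bsub>A\<^esub> x k g) \<le> K g / 2 ^ k"
    by blast
  have wg: "w g \<in> gcomp g" and wJ: "w g \<ominus>\<^bsub>A\<^esub> x 0 g \<in> J" if "g \<in> carrier G" for g using w that by auto
  have wc: "w g \<in> carrier A" if "g \<in> carrier G" for g using gcomp_carrier[OF that wg[OF that]] .
  \<comment> \<open>A fixed element whose quotient norm is below every \<open>c / 2 ^ k\<close> has
    quotient norm 0, and the ideal is closed.\<close>
  have vanish: "y \<in> Jn n" if y: "y \<in> carrier A" and c: "\<And>k. ?q y \<le> c / 2 ^ k" for y c
  proof (rule A.quot_norm_zeroD[OF In y])
    have "(\<lambda>N. c * (1/2) ^ N) \<longlonglongrightarrow> c * 0" by (intro tendsto_intros LIMSEQ_power_zero) simp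
    then have "?q y \<le> c * 0" by (rule LIMSEQ_le_const) (use c in \<open>auto simp: power_divide\<close>)
    then show "?q y \<le> 0" by simp
  qed
  have adj: "w (inv g) \<ominus>\<^bsub>A\<^esub> adj A (w g) \<in> Jn n" if g: "g \<in> carrier G" for g
  proof (rule vanish)
    have gi: "inv g \<in> carrier G" using g by simp
    show "w (inv g) \<ominus>\<^bsub>A\<^esub> adj A (w g) \<in> carrier A" using wc g by simp
    fix k
    have xa: "adj A (x k g) = x k (inv g)" using ahk[of k] g by (auto simp: Q.almost_hom_def)
    have "w (inv g) \<ominus>\<^bsub>A\<^esub> adj A (w g) = (w (inv g) \<ominus>\<^bsub>A\<^esub> x k (inv g)) \<ominus>\<^bsub>A\<^esub> adj A (w g \<ominus>\<^bsub>A\<^esub> x k g)"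
      by (use wc[OF g] wc[OF gi] xc[OF g, of k] xc[OF gi, of k] xa in \<open>simp add: A.alg\<close>, rule A.linear_identity,
        (rule A.represents_intros; simp?)+, simp)
    then have "?q (w (inv g) \<ominus>\<^bsub>A\<^esub> adj A (w g)) \<le> ?q (w (inv g) \<ominus>\<^bsub>A\<^esub> x k (inv g)) + ?q (adj A (w g \<ominus>\<^bsub>A\<^esub> x k g))"
      using S.p_minus wc xc g gi by simp
    also have "?q (adj A (w g \<ominus>\<^bsub>A\<^esub> x k g)) = ?q (w g \<ominus>\<^bsub>A\<^esub> x k g)" using wc xc g by (intro S.p_adj) auto
    also have "?q (w (inv g) \<ominus>\<^bsub>A\<^esub> x k (inv g)) + \<dots> \<le> K (inv g) / 2 ^ k + K g / 2 ^ k"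
      by (intro add_mono K g gi)
    finally show "?q (w (inv g) \<ominus>\<^bsub>A\<^esub> adj A (w g)) \<le> (K (inv g) + K g) / 2 ^ k"
      by (simp add: add_divide_distrib)
  qed
  have mult: "w (a \<otimes> b) \<ominus>\<^bsub>A\<^esub> w a \<otimes>\<^bsub>A\<^esub> w b \<in> Jn n" if a: "a \<in> carrier G" and b: "b \<in> carrier G" for a b
  proof (rule vanish)
    have ab: "a \<otimes> b \<in> carrier G" using a b by simp
    show "w (a \<otimes> b) \<ominus>\<^bsub>A\<^esub> w a \<otimes>\<^bsub>A\<^esub> w b \<in> carrier A" using wc a b by simp
    fix k
    note c = wc[OF a] wc[OF b] wc[OF ab] xc[OF a, of k] xc[OF b, of k] xc[OF ab, of k]
    \<comment> \<open>Exchanging the left and then the right factor for its iterate leaves three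
      errors of the limit and one defect, all bounded by a multiple of \<open>1 / 2 ^ k\<close> with
      a factor not depending on \<open>k\<close>.\<close>
    let ?a = "w (a \<otimes> b) \<ominus>\<^bsub>A\<^esub> x k (a \<otimes> b)" and ?b = "SG.defect (x k) a b"
      and ?c = "(w a \<ominus>\<^bsub>A\<^esub> x k a) \<otimes>\<^bsub>A\<^esub> w b" and ?d = "x k a \<otimes>\<^bsub>A\<^esub> (w b \<ominus>\<^bsub>A\<^esub> x k b)"
    have bc: "?b \<in> carrier A" using c by (simp add: SG.defect_def)
    have "w (a \<otimes> b) \<ominus>\<^bsub>A\<^esub> w a \<otimes>\<^bsub>A\<^esub> w b = ((?a \<oplus>\<^bsub>A\<^esub> ?b) \<ominus>\<^bsub>A\<^esub> ?c) \<ominus>\<^bsub>A\<^esub> ?d"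
      unfolding SG.defect_def
      by (use c in \<open>simp add: A.alg\<close>, rule A.linear_identity,
        (rule A.represents_intros; simp?)+, simp)
    moreover have "?q (((?a \<oplus>\<^bsub>A\<^esub> ?b) \<ominus>\<^bsub>A\<^esub> ?c) \<ominus>\<^bsub>A\<^esub> ?d) \<le> ?q ((?a \<oplus>\<^bsub>A\<^esub> ?b) \<ominus>\<^bsub>A\<^esub> ?c) + ?q ?d"
      "?q ((?a \<oplus>\<^bsub>A\<^esub> ?b) \<ominus>\<^bsub>A\<^esub> ?c) \<le> ?q (?a \<oplus>\<^bsub>A\<^esub> ?b) + ?q ?c" "?q (?a \<oplus>\<^bsub>A\<^esub> ?b) \<le> ?q ?a + ?q ?b"
      using c bc by (intro S.p_minus S.p_add; simp)+
    moreover have "?q ?b \<le> e / 2 ^ k" using ahk[of k] a b by (auto simp: Q.almost_hom_def)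
    moreover have "?q ?a \<le> K (a \<otimes> b) / 2 ^ k" by (rule K[OF ab])
    moreover have "?q ?c \<le> (K a / 2 ^ k) * ?q (w b)" using c K[OF a] by (intro S.p_mult_le) auto
    moreover have "?q ?d \<le> (M + 1) * (K b / 2 ^ k)"
      using c K[OF b] ahk[of k] a by (intro S.p_mult_le) (auto simp: Q.almost_hom_def)
    ultimately show "?q (w (a \<otimes> b) \<ominus>\<^bsub>A\<^esub> w a \<otimes>\<^bsub>A\<^esub> w b)
        \<le> (K (a \<otimes> b) + e + K a * ?q (w b) + (M + 1) * K b) / 2 ^ k"
      by (simp add: add_divide_distrib)
  qed
  have "w g \<ominus>\<^bsub>A\<^esub> v g \<in> J" if g: "g \<in> carrier G" for g
    using A.cong_trans[OF IJ(1) wJ[OF g]] fv[OF g] wc fc vc g by (simp add: x_def)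
  then show ?thesis using wg adj mult by (intro exI[of _ n] exI[of _ w]) simp
qed

end

section \<open>The graded C*-algebra of a finite group\<close>

lemma cring_complex_ring: "cring complex_ring"
proof -
  have "\<exists>y. y + x = 0" for x :: complex by (metis add.left_inverse)
  then show ?thesis
    by (intro cringI abelian_groupI comm_monoidI) (auto simp: complex_ring_def algebra_simps)
qed

lemma group_star_algebra_simps [simp]:
  "carrier (group_star_algebra G) = {f. \<forall>x. x \<notin> carrier G \<longrightarrow> f x = 0}"
  "mult (group_star_algebra G) f h = (\<lambda>x. if x \<in> carrier G
     then \<Sum>y\<in>carrier G. f y * h (inv\<^bsub>G\<^esub> y \<otimes>\<^bsub>G\<^esub> x) else 0)"
  "zero (group_star_algebra G) = (\<lambda>x. 0)"
  "add (group_star_algebra G) f h = (\<lambda>x. f x + h x)"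
  "smult (group_star_algebra G) c f = (\<lambda>x. c * f x)"
  "adj (group_star_algebra G) f = (\<lambda>x. if x \<in> carrier G then cnj (f (inv\<^bsub>G\<^esub> x)) else 0)"
  by (simp_all add: group_star_algebra_def)

lemma group_cstar_algebra_simps [simp]:
  "carrier (group_cstar_algebra G) = carrier (group_star_algebra G)"
  "mult (group_cstar_algebra G) = mult (group_star_algebra G)"
  "zero (group_cstar_algebra G) = zero (group_star_algebra G)"
  "add (group_cstar_algebra G) = add (group_star_algebra G)"
  "smult (group_cstar_algebra G) = smult (group_star_algebra G)"
  "adj (group_cstar_algebra G) = adj (group_star_algebra G)"
  "nrm (group_cstar_algebra G) = (\<lambda>f. SUP p\<in>Collect (cstar_seminorm (group_star_algebra G)). p f)"
  by (simp_all add: group_cstar_algebra_def star_algebra.extend_def cstar_algebra.fields_def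
      group_star_algebra_def)

lemma cstar_seminorm_group_cstar_algebra:
  "cstar_seminorm (group_cstar_algebra G) p \<longleftrightarrow> cstar_seminorm (group_star_algebra G) p"
  by (simp add: cstar_seminorm_def)

section \<open>The convolution algebra of a finite group\<close>

locale finite_group = group G for G :: "('g, 'k) monoid_scheme" (structure) +
  assumes finite_G: "finite (carrier G)"
begin

lemma sum_shift: "z \<in> carrier G \<Longrightarrow> (\<Sum>y\<in>carrier G. F (z \<otimes> y)) = (\<Sum>y\<in>carrier G. (F y :: complex))"
  by (rule sum.reindex_bij_betw) (auto simp: bij_betw_def inj_on_cmult surj_const_mult)

lemma sum_inv: "(\<Sum>y\<in>carrier G. F (inv y)) = (\<Sum>y\<in>carrier G. (F y :: complex))"
  by (rule sum.reindex_bij_witness[of _ "\<lambda>y. inv y" "\<lambda>y. inv y"]) auto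

lemma abelian_group_group_star_algebra: "abelian_group (group_star_algebra G)"
proof (rule abelian_groupI)
  fix f assume "f \<in> carrier (group_star_algebra G)"
  then show "\<exists>h\<in>carrier (group_star_algebra G). h \<oplus>\<^bsub>group_star_algebra G\<^esub> f = \<zero>\<^bsub>group_star_algebra G\<^esub>"
    by (intro bexI[of _ "\<lambda>x. - f x"]) auto
qed (auto simp: add_ac)

text \<open>Exchange the sums and translate the inner variable by \<open>inv z\<close>.\<close>

lemma convolution_assoc:
  assumes x: "x \<in> carrier G"
  shows "(\<Sum>y\<in>carrier G. (\<Sum>z\<in>carrier G. f z * h (inv z \<otimes> y)) * k (inv y \<otimes> x))
    = (\<Sum>z\<in>carrier G. f z * (\<Sum>y\<in>carrier G. h y * (k (inv y \<otimes> (inv z \<otimes> x)) :: complex)))"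
proof -
  have "(\<Sum>y\<in>carrier G. (\<Sum>z\<in>carrier G. f z * h (inv z \<otimes> y)) * k (inv y \<otimes> x))
      = (\<Sum>z\<in>carrier G. \<Sum>y\<in>carrier G. f z * (h (inv z \<otimes> y) * k (inv y \<otimes> x)))"
    by (simp add: sum_distrib_right mult.assoc) (rule sum.swap)
  also have "\<dots> = (\<Sum>z\<in>carrier G. \<Sum>y\<in>carrier G. f z * (h y * k (inv y \<otimes> (inv z \<otimes> x))))"
  proof (rule sum.cong[OF refl])
    fix z assume z: "z \<in> carrier G"
    have "(\<Sum>y\<in>carrier G. f z * (h (inv z \<otimes> y) * k (inv y \<otimes> x)))
        = (\<Sum>y\<in>carrier G. f z * (h (inv z \<otimes> y) * k (inv (inv z \<otimes> y) \<otimes> (inv z \<otimes> x))))"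
    proof (rule sum.cong[OF refl])
      fix y assume y: "y \<in> carrier G"
      have "inv (inv z \<otimes> y) \<otimes> (inv z \<otimes> x) = inv y \<otimes> x"
        using x y z by (simp add: inv_mult_group m_assoc) (metis inv_closed m_assoc r_inv l_one m_closed)
      then show "f z * (h (inv z \<otimes> y) * k (inv y \<otimes> x))
          = f z * (h (inv z \<otimes> y) * k (inv (inv z \<otimes> y) \<otimes> (inv z \<otimes> x)))" by simp
    qed
    also have "\<dots> = (\<Sum>y\<in>carrier G. f z * (h y * k (inv y \<otimes> (inv z \<otimes> x))))"
      using sum_shift[of "inv z" "\<lambda>y. f z * (h y * k (inv y \<otimes> (inv z \<otimes> x)))"] z by simp
    finally show "(\<Sum>y\<in>carrier G. f z * (h (inv z \<otimes> y) * k (inv y \<otimes> x)))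
        = (\<Sum>y\<in>carrier G. f z * (h y * k (inv y \<otimes> (inv z \<otimes> x))))" .
  qed
  finally show ?thesis by (simp add: sum_distrib_left)
qed

text \<open>Substituting \<open>y = x u\<close> turns the convolution of the adjoints into the
  conjugate of the original sum.\<close>

lemma convolution_adj:
  assumes x: "x \<in> carrier G"
  shows "cnj (\<Sum>y\<in>carrier G. f y * h (inv y \<otimes> inv x))
    = (\<Sum>y\<in>carrier G. cnj (h (inv y)) * cnj (f (inv (inv y \<otimes> x))))"
proof -
  have "(\<Sum>y\<in>carrier G. cnj (h (inv y)) * cnj (f (inv (inv y \<otimes> x))))
      = (\<Sum>u\<in>carrier G. cnj (h (inv (x \<otimes> u))) * cnj (f (inv (inv (x \<otimes> u) \<otimes> x))))"
    by (rule sum_shift[OF x, symmetric])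
  also have "\<dots> = (\<Sum>u\<in>carrier G. cnj (f u * h (inv u \<otimes> inv x)))"
    by (rule sum.cong[OF refl]) (use x in \<open>simp add: inv_mult_group m_assoc mult.commute\<close>)
  finally show ?thesis by simp
qed

lemma star_algebra_group_star_algebra: "star_algebra (group_star_algebra G)"
proof (intro star_algebra.intro star_algebra_axioms.intro)
  let ?A = "group_star_algebra G"
  show "Module.module complex_ring ?A"
    by (rule moduleI[OF cring_complex_ring abelian_group_group_star_algebra])
      (auto simp: complex_ring_def algebra_simps)
  fix x y z :: "'g \<Rightarrow> complex" and c :: complex
  assume xyz: "x \<in> carrier ?A" "y \<in> carrier ?A" "z \<in> carrier ?A"
  show "x \<otimes>\<^bsub>?A\<^esub> y \<otimes>\<^bsub>?A\<^esub> z = x \<otimes>\<^bsub>?A\<^esub> (y \<otimes>\<^bsub>?A\<^esub> z)"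
    by (rule ext) (simp add: convolution_assoc[symmetric])
  show "adj ?A (x \<otimes>\<^bsub>?A\<^esub> y) = adj ?A y \<otimes>\<^bsub>?A\<^esub> adj ?A x"
    using convolution_adj[of _ x y] by (intro ext) (simp del: cnj_sum)
qed (auto simp: algebra_simps sum.distrib sum_distrib_left intro!: ext)

end

sublocale finite_group \<subseteq> S: star_algebra "group_star_algebra G"
  by (rule star_algebra_group_star_algebra)

section \<open>The left regular representation\<close>

context finite_group
begin

abbreviation \<A> where "\<A> \<equiv> group_star_algebra G"

definition ip :: "('g \<Rightarrow> complex) \<Rightarrow> ('g \<Rightarrow> complex) \<Rightarrow> complex" where
  "ip \<xi> \<eta> = (\<Sum>x\<in>carrier G. \<xi> x * cnj (\<eta> x))"

definition l2 :: "('g \<Rightarrow> complex) \<Rightarrow> real" where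
  "l2 \<xi> = L2_set (\<lambda>x. cmod (\<xi> x)) (carrier G)"

lemma l2_nonneg [simp]: "0 \<le> l2 \<xi>" by (simp add: l2_def)

lemma l2_add: "l2 (\<lambda>x. \<xi> x + \<eta> x) \<le> l2 \<xi> + l2 \<eta>"
proof -
  have "l2 (\<lambda>x. \<xi> x + \<eta> x) \<le> L2_set (\<lambda>x. cmod (\<xi> x) + cmod (\<eta> x)) (carrier G)"
    unfolding l2_def by (rule L2_set_mono) (auto simp: norm_triangle_ineq)
  also have "\<dots> \<le> l2 \<xi> + l2 \<eta>" unfolding l2_def by (rule L2_set_triangle_ineq)
  finally show ?thesis .
qed

lemma l2_smult: "l2 (\<lambda>x. c * \<xi> x) = cmod c * l2 \<xi>"
  by (simp add: l2_def norm_mult L2_set_right_distrib)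

lemma l2_eq_0_iff: "l2 \<xi> = 0 \<longleftrightarrow> (\<forall>x\<in>carrier G. \<xi> x = 0)"
  unfolding l2_def using finite_G by (simp add: L2_set_eq_0_iff)

lemma norm_le_l2: "x \<in> carrier G \<Longrightarrow> cmod (\<xi> x) \<le> l2 \<xi>"
  unfolding l2_def using member_le_L2_set[OF finite_G, of x "\<lambda>x. cmod (\<xi> x)"] by simp

lemma norm_ip_le: "cmod (ip \<xi> \<eta>) \<le> l2 \<xi> * l2 \<eta>"
proof -
  have "cmod (ip \<xi> \<eta>) \<le> (\<Sum>x\<in>carrier G. \<bar>cmod (\<xi> x)\<bar> * \<bar>cmod (\<eta> x)\<bar>)"
    unfolding ip_def by (rule order_trans[OF norm_sum]) (simp add: norm_mult)
  also have "\<dots> \<le> l2 \<xi> * l2 \<eta>" unfolding l2_def by (rule L2_set_mult_ineq)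
  finally show ?thesis .
qed

lemma ip_self: "ip \<xi> \<xi> = of_real ((l2 \<xi>)\<^sup>2)"
  unfolding ip_def l2_def L2_set_def
  by (simp add: sum_nonneg complex_norm_square[symmetric])

text \<open>Left convolution is a *-representation on the Hilbert space of functions: translate
  \<open>x\<close> by \<open>y\<close>, then replace \<open>y\<close> by its inverse.\<close>

lemma ip_convolution:
  "ip (f \<otimes>\<^bsub>\<A>\<^esub> \<xi>) \<eta> = ip \<xi> (adj \<A> f \<otimes>\<^bsub>\<A>\<^esub> \<eta>)"
proof -
  have "ip (f \<otimes>\<^bsub>\<A>\<^esub> \<xi>) \<eta> = (\<Sum>y\<in>carrier G. \<Sum>x\<in>carrier G. f y * \<xi> (inv y \<otimes> x) * cnj (\<eta> x))"
    unfolding ip_def by (simp add: sum_distrib_right) (rule sum.swap)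
  also have "\<dots> = (\<Sum>y\<in>carrier G. \<Sum>x\<in>carrier G. f y * \<xi> x * cnj (\<eta> (y \<otimes> x)))"
  proof (rule sum.cong[OF refl])
    fix y assume y: "y \<in> carrier G"
    have "(\<Sum>x\<in>carrier G. f y * \<xi> (inv y \<otimes> x) * cnj (\<eta> x))
        = (\<Sum>x\<in>carrier G. f y * \<xi> (inv y \<otimes> (y \<otimes> x)) * cnj (\<eta> (y \<otimes> x)))"
      by (rule sum_shift[OF y, symmetric])
    also have "\<dots> = (\<Sum>x\<in>carrier G. f y * \<xi> x * cnj (\<eta> (y \<otimes> x)))"
      by (rule sum.cong[OF refl]) (use y in \<open>simp add: m_assoc[symmetric]\<close>)
    finally show "(\<Sum>x\<in>carrier G. f y * \<xi> (inv y \<otimes> x) * cnj (\<eta> x))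
        = (\<Sum>x\<in>carrier G. f y * \<xi> x * cnj (\<eta> (y \<otimes> x)))" .
  qed
  also have "\<dots> = (\<Sum>x\<in>carrier G. \<xi> x * (\<Sum>y\<in>carrier G. f y * cnj (\<eta> (y \<otimes> x))))"
    by (subst sum.swap) (simp add: sum_distrib_left mult_ac)
  also have "\<dots> = (\<Sum>x\<in>carrier G. \<xi> x * (\<Sum>y\<in>carrier G. f (inv y) * cnj (\<eta> (inv y \<otimes> x))))"
    using sum_inv[of "\<lambda>y. f y * cnj (\<eta> (y \<otimes> _))"] by simp
  also have "\<dots> = ip \<xi> (adj \<A> f \<otimes>\<^bsub>\<A>\<^esub> \<eta>)"
    unfolding ip_def by (simp add: sum_distrib_left)
  finally show ?thesis .
qed

text \<open>
  The operator norm of the left regular representation is a faithful C*-seminorm, which makes the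
  norm of \<open>C\<^sup>*(G)\<close> definite.
\<close>

definition reg_norm :: "('g \<Rightarrow> complex) \<Rightarrow> real" where
  "reg_norm f = (SUP \<xi>\<in>{\<xi> \<in> carrier \<A>. l2 \<xi> \<le> 1}. l2 (f \<otimes>\<^bsub>\<A>\<^esub> \<xi>))"

text \<open>Only finiteness of the constant matters: it makes the supremum in
  \<open>reg_norm\<close> a genuine one. The outer sum comes from bounding the 2-norm by the
  1-norm.\<close>

lemma l2_convolution_crude:
  "l2 (f \<otimes>\<^bsub>\<A>\<^esub> \<xi>) \<le> (\<Sum>x\<in>carrier G. \<Sum>y\<in>carrier G. cmod (f y)) * l2 \<xi>"
proof -
  have "l2 (f \<otimes>\<^bsub>\<A>\<^esub> \<xi>) \<le> (\<Sum>x\<in>carrier G. cmod ((f \<otimes>\<^bsub>\<A>\<^esub> \<xi>) x))"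
    unfolding l2_def by (rule L2_set_le_sum) auto
  also have "\<dots> \<le> (\<Sum>x\<in>carrier G. (\<Sum>y\<in>carrier G. cmod (f y)) * l2 \<xi>)"
  proof (rule sum_mono)
    fix x assume x: "x \<in> carrier G"
    have "cmod ((f \<otimes>\<^bsub>\<A>\<^esub> \<xi>) x) \<le> (\<Sum>y\<in>carrier G. cmod (f y) * cmod (\<xi> (inv y \<otimes> x)))"
      using x by (simp add: norm_mult[symmetric] norm_sum)
    also have "\<dots> \<le> (\<Sum>y\<in>carrier G. cmod (f y) * l2 \<xi>)"
      using x by (intro sum_mono mult_left_mono norm_le_l2) auto
    finally show "cmod ((f \<otimes>\<^bsub>\<A>\<^esub> \<xi>) x) \<le> (\<Sum>y\<in>carrier G. cmod (f y)) * l2 \<xi>"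
      by (simp add: sum_distrib_right)
  qed
  finally show ?thesis unfolding sum_distrib_right[symmetric] .
qed

lemma reg_norm_bdd: "bdd_above ((\<lambda>\<xi>. l2 (f \<otimes>\<^bsub>\<A>\<^esub> \<xi>)) ` {\<xi> \<in> carrier \<A>. l2 \<xi> \<le> 1})"
proof (rule bdd_aboveI2)
  let ?C = "\<Sum>x\<in>carrier G. \<Sum>y\<in>carrier G. cmod (f y)"
  fix \<xi> assume "\<xi> \<in> {\<xi> \<in> carrier \<A>. l2 \<xi> \<le> 1}"
  then have "?C * l2 \<xi> \<le> ?C * 1" by (intro mult_left_mono sum_nonneg) auto
  then show "l2 (f \<otimes>\<^bsub>\<A>\<^esub> \<xi>) \<le> ?C" using l2_convolution_crude[of f \<xi>] by linarith
qed

lemma l2_zero [simp]: "l2 (\<lambda>x. 0) = 0" by (simp add: l2_eq_0_iff)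

lemma reg_norm_nonneg: "0 \<le> reg_norm f"
proof -
  have "l2 (f \<otimes>\<^bsub>\<A>\<^esub> \<zero>\<^bsub>\<A>\<^esub>) \<le> reg_norm f"
    unfolding reg_norm_def by (rule cSUP_upper[OF _ reg_norm_bdd]) simp
  then show ?thesis using l2_nonneg order_trans by blast
qed

lemma l2_convolution:
  assumes \<xi>: "\<xi> \<in> carrier \<A>"
  shows "l2 (f \<otimes>\<^bsub>\<A>\<^esub> \<xi>) \<le> reg_norm f * l2 \<xi>"
proof (cases "l2 \<xi> = 0")
  case True
  then have "\<xi> = \<zero>\<^bsub>\<A>\<^esub>" using \<xi> by (auto simp: l2_eq_0_iff)
  then show ?thesis by (simp cong: if_cong)
next
  case False
  then have pos: "l2 \<xi> > 0" using l2_nonneg[of \<xi>] by linarith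
  let ?\<eta> = "\<lambda>x. of_real (inverse (l2 \<xi>)) * \<xi> x"
  have "l2 ?\<eta> = 1" using pos l2_smult[of "of_real (inverse (l2 \<xi>))" \<xi>] by (simp add: norm_inverse)
  then have "l2 (f \<otimes>\<^bsub>\<A>\<^esub> ?\<eta>) \<le> reg_norm f"
    unfolding reg_norm_def by (intro cSUP_upper[OF _ reg_norm_bdd]) (use \<xi> in auto)
  moreover have "f \<otimes>\<^bsub>\<A>\<^esub> ?\<eta> = (\<lambda>x. of_real (inverse (l2 \<xi>)) * (f \<otimes>\<^bsub>\<A>\<^esub> \<xi>) x)"
    by (auto simp: sum_distrib_left mult_ac)
  ultimately have "inverse (l2 \<xi>) * l2 (f \<otimes>\<^bsub>\<A>\<^esub> \<xi>) \<le> reg_norm f"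
    using l2_smult[of "of_real (inverse (l2 \<xi>))" "f \<otimes>\<^bsub>\<A>\<^esub> \<xi>"] pos by (simp add: norm_inverse)
  then show ?thesis using pos by (simp add: field_simps)
qed

lemma reg_norm_le:
  assumes "\<And>\<xi>. \<xi> \<in> carrier \<A> \<Longrightarrow> l2 (f \<otimes>\<^bsub>\<A>\<^esub> \<xi>) \<le> c * l2 \<xi>" "c \<ge> 0"
  shows "reg_norm f \<le> c"
  unfolding reg_norm_def
proof (rule cSUP_least)
  have "\<zero>\<^bsub>\<A>\<^esub> \<in> {\<xi> \<in> carrier \<A>. l2 \<xi> \<le> 1}" by simp
  then show "{\<xi> \<in> carrier \<A>. l2 \<xi> \<le> 1} \<noteq> {}" by blast
  fix \<xi> assume \<xi>: "\<xi> \<in> {\<xi> \<in> carrier \<A>. l2 \<xi> \<le> 1}"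
  then have "c * l2 \<xi> \<le> c * 1" using assms(2) by (intro mult_left_mono) auto
  then show "l2 (f \<otimes>\<^bsub>\<A>\<^esub> \<xi>) \<le> c" using assms(1)[of \<xi>] \<xi> by simp
qed

lemma cstar_seminorm_reg_norm: "cstar_seminorm \<A> reg_norm"
  unfolding cstar_seminorm_def
proof (intro conjI ballI allI)
  have smult_le: "reg_norm (c \<odot>\<^bsub>\<A>\<^esub> f) \<le> cmod c * reg_norm f" if f: "f \<in> carrier \<A>" for c f
  proof (rule reg_norm_le)
    fix \<xi> assume \<xi>: "\<xi> \<in> carrier \<A>"
    have "l2 ((c \<odot>\<^bsub>\<A>\<^esub> f) \<otimes>\<^bsub>\<A>\<^esub> \<xi>) = l2 (c \<odot>\<^bsub>\<A>\<^esub> (f \<otimes>\<^bsub>\<A>\<^esub> \<xi>))"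
      using S.mult_smult_left[OF f \<xi>] by simp
    also have "\<dots> = cmod c * l2 (f \<otimes>\<^bsub>\<A>\<^esub> \<xi>)" unfolding group_star_algebra_simps(5) by (rule l2_smult)
    finally show "l2 ((c \<odot>\<^bsub>\<A>\<^esub> f) \<otimes>\<^bsub>\<A>\<^esub> \<xi>) \<le> cmod c * reg_norm f * l2 \<xi>"
      using mult_left_mono[OF l2_convolution[OF \<xi>, of f], of "cmod c"] by (simp only: mult.assoc norm_ge_zero)
  qed (simp add: reg_norm_nonneg)
  have mult_le: "reg_norm (f \<otimes>\<^bsub>\<A>\<^esub> h) \<le> reg_norm f * reg_norm h"
    if f: "f \<in> carrier \<A>" and h: "h \<in> carrier \<A>" for f h
  proof (rule reg_norm_le)
    fix \<xi> assume \<xi>: "\<xi> \<in> carrier \<A>"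
    have "l2 ((f \<otimes>\<^bsub>\<A>\<^esub> h) \<otimes>\<^bsub>\<A>\<^esub> \<xi>) = l2 (f \<otimes>\<^bsub>\<A>\<^esub> (h \<otimes>\<^bsub>\<A>\<^esub> \<xi>))"
      using S.mult_assoc[OF f h \<xi>] by simp
    also have "\<dots> \<le> reg_norm f * l2 (h \<otimes>\<^bsub>\<A>\<^esub> \<xi>)" by (rule l2_convolution) (rule S.mult_closed[OF h \<xi>])
    also have "\<dots> \<le> reg_norm f * (reg_norm h * l2 \<xi>)"
      by (intro mult_left_mono l2_convolution \<xi> reg_norm_nonneg)
    finally show "l2 ((f \<otimes>\<^bsub>\<A>\<^esub> h) \<otimes>\<^bsub>\<A>\<^esub> \<xi>) \<le> reg_norm f * reg_norm h * l2 \<xi>" by (simp only: mult.assoc)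
  qed (simp add: reg_norm_nonneg)
  fix f assume f: "f \<in> carrier \<A>"
  show "reg_norm (c \<odot>\<^bsub>\<A>\<^esub> f) = cmod c * reg_norm f" for c
  proof (cases "c = 0")
    case True
    then show ?thesis using smult_le[OF f, of 0] reg_norm_nonneg[of "c \<odot>\<^bsub>\<A>\<^esub> f"] by simp
  next
    case False
    have "reg_norm f = reg_norm (inverse c \<odot>\<^bsub>\<A>\<^esub> (c \<odot>\<^bsub>\<A>\<^esub> f))" using False by (simp add: mult.assoc[symmetric])
    also have "\<dots> \<le> cmod (inverse c) * reg_norm (c \<odot>\<^bsub>\<A>\<^esub> f)" by (rule smult_le) (rule S.smult_cl[OF f])
    finally have "cmod c * reg_norm f \<le> reg_norm (c \<odot>\<^bsub>\<A>\<^esub> f)"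
      using False by (simp add: norm_inverse norm_divide field_simps del: group_star_algebra_simps)
    then show ?thesis using smult_le[OF f, of c] by (rule antisym[rotated])
  qed
  \<comment> \<open>The argument for operator norms: the square of the 2-norm of
    \<open>h \<xi>\<close> is the inner product of \<open>\<xi>\<close> with
    \<open>adj h h \<xi>\<close>, estimated by Cauchy-Schwarz.\<close>
  have sq: "(reg_norm h)\<^sup>2 \<le> reg_norm (adj \<A> h \<otimes>\<^bsub>\<A>\<^esub> h)" if h: "h \<in> carrier \<A>" for h
  proof -
    let ?s = "adj \<A> h \<otimes>\<^bsub>\<A>\<^esub> h"
    have "reg_norm h \<le> sqrt (reg_norm ?s)"
    proof (rule reg_norm_le)
      fix \<xi> assume \<xi>: "\<xi> \<in> carrier \<A>"
      have "complex_of_real ((l2 (h \<otimes>\<^bsub>\<A>\<^esub> \<xi>))\<^sup>2) = ip \<xi> (adj \<A> h \<otimes>\<^bsub>\<A>\<^esub> (h \<otimes>\<^bsub>\<A>\<^esub> \<xi>))"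
        unfolding ip_self[symmetric] by (rule ip_convolution)
      also have "adj \<A> h \<otimes>\<^bsub>\<A>\<^esub> (h \<otimes>\<^bsub>\<A>\<^esub> \<xi>) = ?s \<otimes>\<^bsub>\<A>\<^esub> \<xi>"
        by (rule S.mult_assoc[symmetric, OF S.adj_closed[OF h] h \<xi>])
      finally have "cmod (complex_of_real ((l2 (h \<otimes>\<^bsub>\<A>\<^esub> \<xi>))\<^sup>2)) \<le> l2 \<xi> * l2 (?s \<otimes>\<^bsub>\<A>\<^esub> \<xi>)"
        using norm_ip_le by (simp only:)
      also have "\<dots> \<le> l2 \<xi> * (reg_norm ?s * l2 \<xi>)"
        by (intro mult_left_mono l2_convolution \<xi> l2_nonneg)
      finally have "(l2 (h \<otimes>\<^bsub>\<A>\<^esub> \<xi>))\<^sup>2 \<le> reg_norm ?s * (l2 \<xi>)\<^sup>2"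
        unfolding norm_of_real by (simp only: abs_power2 power2_eq_square mult_ac)
      then have "sqrt ((l2 (h \<otimes>\<^bsub>\<A>\<^esub> \<xi>))\<^sup>2) \<le> sqrt (reg_norm ?s * (l2 \<xi>)\<^sup>2)" by (rule real_sqrt_le_mono)
      then show "l2 (h \<otimes>\<^bsub>\<A>\<^esub> \<xi>) \<le> sqrt (reg_norm ?s) * l2 \<xi>"
        unfolding real_sqrt_mult real_sqrt_abs by (simp only: abs_of_nonneg l2_nonneg)
    qed (rule real_sqrt_ge_zero[OF reg_norm_nonneg])
    then have "(reg_norm h)\<^sup>2 \<le> (sqrt (reg_norm ?s))\<^sup>2" by (rule power_mono) (rule reg_norm_nonneg)
    then show ?thesis unfolding real_sqrt_pow2[OF reg_norm_nonneg] .
  qed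
  have adj_le: "reg_norm h \<le> reg_norm (adj \<A> h)" if h: "h \<in> carrier \<A>" for h
  proof (cases "reg_norm h = 0")
    case True
    then show ?thesis using reg_norm_nonneg by (simp only:)
  next
    case False
    have "reg_norm h * reg_norm h \<le> reg_norm (adj \<A> h) * reg_norm h"
      using order_trans[OF sq[OF h] mult_le[OF S.adj_closed[OF h] h]] by (simp only: power2_eq_square)
    moreover have "reg_norm h > 0" using False reg_norm_nonneg[of h] by linarith
    ultimately show ?thesis by (rule mult_right_le_imp_le)
  qed
  have "reg_norm (adj \<A> f) \<le> reg_norm f" using adj_le[OF S.adj_closed[OF f]] unfolding S.adj_adj[OF f] .
  then have "reg_norm (adj \<A> f) * reg_norm f \<le> reg_norm f * reg_norm f"
    by (rule mult_right_mono) (rule reg_norm_nonneg)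
  then show "reg_norm (adj \<A> f \<otimes>\<^bsub>\<A>\<^esub> f) = (reg_norm f)\<^sup>2"
    using sq[OF f] mult_le[OF S.adj_closed[OF f] f] unfolding power2_eq_square by linarith
  fix h assume h: "h \<in> carrier \<A>"
  show "reg_norm (f \<otimes>\<^bsub>\<A>\<^esub> h) \<le> reg_norm f * reg_norm h" by (rule mult_le[OF f h])
  show "reg_norm (f \<oplus>\<^bsub>\<A>\<^esub> h) \<le> reg_norm f + reg_norm h"
  proof (rule reg_norm_le)
    fix \<xi> assume \<xi>: "\<xi> \<in> carrier \<A>"
    have "l2 ((f \<oplus>\<^bsub>\<A>\<^esub> h) \<otimes>\<^bsub>\<A>\<^esub> \<xi>) = l2 ((f \<otimes>\<^bsub>\<A>\<^esub> \<xi>) \<oplus>\<^bsub>\<A>\<^esub> (h \<otimes>\<^bsub>\<A>\<^esub> \<xi>))"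
      using S.mult_add_left[OF f h \<xi>] by simp
    also have "\<dots> \<le> l2 (f \<otimes>\<^bsub>\<A>\<^esub> \<xi>) + l2 (h \<otimes>\<^bsub>\<A>\<^esub> \<xi>)" unfolding group_star_algebra_simps(4) by (rule l2_add)
    also have "\<dots> \<le> reg_norm f * l2 \<xi> + reg_norm h * l2 \<xi>" by (intro add_mono l2_convolution \<xi>)
    finally show "l2 ((f \<oplus>\<^bsub>\<A>\<^esub> h) \<otimes>\<^bsub>\<A>\<^esub> \<xi>) \<le> (reg_norm f + reg_norm h) * l2 \<xi>" by (simp only: distrib_right)
  qed (intro add_nonneg_nonneg reg_norm_nonneg)
qed

lemma l2_group_unitary: "l2 (group_unitary \<one>) = 1"
proof -
  have "(\<Sum>x\<in>carrier G. (cmod (group_unitary \<one> x))\<^sup>2) = (\<Sum>x\<in>carrier G. if x = \<one> then 1 else 0)"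
    by (rule sum.cong) (auto simp: group_unitary_def)
  then show ?thesis unfolding l2_def L2_set_def using finite_G by simp
qed

lemma group_unitary_closed [simp, intro]: "g \<in> carrier G \<Longrightarrow> group_unitary g \<in> carrier \<A>"
  by (auto simp: group_unitary_def)

lemma convolution_group_unitary:
  assumes "f \<in> carrier \<A>" "g \<in> carrier G"
  shows "(f \<otimes>\<^bsub>\<A>\<^esub> group_unitary g) x = (if x \<in> carrier G then f (x \<otimes> inv g) else 0)"
proof (cases "x \<in> carrier G")
  case True
  have eq: "inv y \<otimes> x = g \<longleftrightarrow> y = x \<otimes> inv g" if "y \<in> carrier G" for y
    using True assms(2) that by (metis inv_closed inv_inv inv_solve_left inv_solve_right)
  have "(\<Sum>y\<in>carrier G. f y * group_unitary g (inv y \<otimes> x)) = (\<Sum>y\<in>carrier G. if y = x \<otimes> inv g then f y else 0)"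
    by (rule sum.cong) (auto simp: group_unitary_def eq)
  then show ?thesis using True assms(2) finite_G by simp
qed (use assms in simp)

lemma group_unitary_mult:
  "\<lbrakk>g \<in> carrier G; h \<in> carrier G\<rbrakk> \<Longrightarrow> group_unitary g \<otimes>\<^bsub>\<A>\<^esub> group_unitary h = group_unitary (g \<otimes> h)"
proof (rule ext)
  fix x assume g: "g \<in> carrier G" and h: "h \<in> carrier G"
  have "x \<otimes> inv h = g \<longleftrightarrow> x = g \<otimes> h" if "x \<in> carrier G"
    using that g h by (metis inv_closed inv_inv inv_solve_right)
  then show "(group_unitary g \<otimes>\<^bsub>\<A>\<^esub> group_unitary h) x = group_unitary (g \<otimes> h) x"
    using convolution_group_unitary[OF group_unitary_closed[OF g] h, of x] g h by (auto simp: group_unitary_def)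
qed

lemma group_unitary_adj:
  "g \<in> carrier G \<Longrightarrow> adj \<A> (group_unitary g) = group_unitary (inv g)"
  by (rule ext) (auto simp: group_unitary_def)

text \<open>Testing on the unit vector \<open>group_unitary \<one>\<close> returns \<open>f\<close>
  itself.\<close>

lemma norm_le_reg_norm:
  assumes f: "f \<in> carrier \<A>" and x: "x \<in> carrier G"
  shows "cmod (f x) \<le> reg_norm f"
proof -
  have "f \<otimes>\<^bsub>\<A>\<^esub> group_unitary \<one> = f"
    by (rule ext) (use convolution_group_unitary[OF f one_closed] f in auto)
  then have "l2 f \<le> reg_norm f"
    using l2_convolution[OF group_unitary_closed[OF one_closed], of f] l2_group_unitary by simp
  then show ?thesis using norm_le_l2[OF x, of f] by linarith
qed

section \<open>Bounds valid for every C*-seminorm\<close>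

context
  fixes p assumes p: "cstar_seminorm \<A> p"
begin

lemma seminorm_rules:
  "\<lbrakk>x \<in> carrier \<A>; y \<in> carrier \<A>\<rbrakk> \<Longrightarrow> p (x \<oplus>\<^bsub>\<A>\<^esub> y) \<le> p x + p y"
  "x \<in> carrier \<A> \<Longrightarrow> p (c \<odot>\<^bsub>\<A>\<^esub> x) = cmod c * p x"
  "\<lbrakk>x \<in> carrier \<A>; y \<in> carrier \<A>\<rbrakk> \<Longrightarrow> p (x \<otimes>\<^bsub>\<A>\<^esub> y) \<le> p x * p y"
  "x \<in> carrier \<A> \<Longrightarrow> p (adj \<A> x \<otimes>\<^bsub>\<A>\<^esub> x) = (p x)\<^sup>2"
  using p unfolding cstar_seminorm_def by blast+

lemma seminorm_zero: "p (\<lambda>x. 0) = 0"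
  using seminorm_rules(2)[of "\<lambda>x. 0" 0] by simp

lemma seminorm_nonneg:
  assumes "x \<in> carrier \<A>"
  shows "0 \<le> p x"
proof -
  have "p (x \<oplus>\<^bsub>\<A>\<^esub> (-1) \<odot>\<^bsub>\<A>\<^esub> x) \<le> p x + p ((-1) \<odot>\<^bsub>\<A>\<^esub> x)"
    by (rule seminorm_rules(1)[OF assms S.smult_cl[OF assms]])
  also have "p ((-1) \<odot>\<^bsub>\<A>\<^esub> x) = p x" using seminorm_rules(2)[OF assms, of "-1"] by simp
  finally show ?thesis using seminorm_zero by simp
qed

text \<open>The C*-identity gives \<open>p (u_g) ^ 2 = p (u_1)\<close> for all \<open>g\<close>. For
  \<open>g = 1\<close> this forces \<open>p (u_1)\<close> to be 0 or 1.\<close>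

lemma seminorm_group_unitary: "g \<in> carrier G \<Longrightarrow> p (group_unitary g) \<le> 1"
proof -
  assume g: "g \<in> carrier G"
  have sq: "(p (group_unitary h))\<^sup>2 = p (group_unitary \<one>)" if "h \<in> carrier G" for h
    using seminorm_rules(4)[OF group_unitary_closed[OF that]] group_unitary_adj[OF that]
      group_unitary_mult[of "inv h" h] that by (simp del: group_star_algebra_simps)
  have "p (group_unitary \<one>) * (p (group_unitary \<one>) - 1) = 0"
    using sq[OF one_closed] by (simp add: power2_eq_square algebra_simps)
  then have "p (group_unitary \<one>) \<le> 1" by auto
  then have "(p (group_unitary g))\<^sup>2 \<le> 1\<^sup>2" using sq[OF g] by simp
  then show ?thesis by (rule power2_le_imp_le) simp
qed

text \<open>A bound not depending on \<open>p\<close>, which makes the supremum over all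
  C*-seminorms finite. The induction adds one group element to the support at a time.\<close>

lemma seminorm_le_sum:
  assumes f: "f \<in> carrier \<A>"
  shows "p f \<le> (\<Sum>g\<in>carrier G. cmod (f g))"
proof -
  have "p (\<lambda>x. if x \<in> T then f x else 0) \<le> (\<Sum>g\<in>T. cmod (f g))" if "finite T" "T \<subseteq> carrier G" for T
    using that
  proof (induction T rule: finite_induct)
    case empty
    then show ?case using seminorm_zero by simp
  next
    case (insert g T)
    let ?f = "\<lambda>x. if x \<in> T then f x else 0"
    have fc: "?f \<in> carrier \<A>" using f by auto
    have g: "g \<in> carrier G" using insert by auto
    have "(\<lambda>x. if x \<in> insert g T then f x else 0) = f g \<odot>\<^bsub>\<A>\<^esub> group_unitary g \<oplus>\<^bsub>\<A>\<^esub> ?f"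
      using insert by (auto simp: group_unitary_def)
    then have "p (\<lambda>x. if x \<in> insert g T then f x else 0)
        \<le> p (f g \<odot>\<^bsub>\<A>\<^esub> group_unitary g) + p ?f"
      using seminorm_rules(1)[OF S.smult_cl[OF group_unitary_closed[OF g]] fc] by simp
    also have "p (f g \<odot>\<^bsub>\<A>\<^esub> group_unitary g) = cmod (f g) * p (group_unitary g)"
      by (rule seminorm_rules(2)[OF group_unitary_closed[OF g]])
    also have "\<dots> \<le> cmod (f g) * 1" by (intro mult_left_mono seminorm_group_unitary g) auto
    finally show ?case using insert by simp
  qed
  from this[OF finite_G order_refl] have "p (\<lambda>x. if x \<in> carrier G then f x else 0) \<le> (\<Sum>g\<in>carrier G. cmod (f g))" .
  moreover have "(\<lambda>x. if x \<in> carrier G then f x else 0) = f" using f by auto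
  ultimately show ?thesis by simp
qed

end

section \<open>The norm, the metric and the axioms of the group C*-algebra\<close>

abbreviation \<B> where "\<B> \<equiv> group_cstar_algebra G"

lemma seminorms_bdd: "f \<in> carrier \<A> \<Longrightarrow> bdd_above ((\<lambda>p. p f) ` Collect (cstar_seminorm \<A>))"
  by (rule bdd_aboveI2[of _ _ "\<Sum>g\<in>carrier G. cmod (f g)"]) (auto intro: seminorm_le_sum)

lemma seminorm_le_nrm: "\<lbrakk>f \<in> carrier \<A>; cstar_seminorm \<A> p\<rbrakk> \<Longrightarrow> p f \<le> nrm \<B> f"
  using cSUP_upper[OF _ seminorms_bdd, of p f] by simp

text \<open>A supremum over the empty set would be arbitrary; \<open>reg_norm\<close> shows that the
  family is inhabited.\<close>

lemma nrm_least: "(\<And>p. cstar_seminorm \<A> p \<Longrightarrow> p f \<le> c) \<Longrightarrow> nrm \<B> f \<le> c"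
  using cstar_seminorm_reg_norm by (auto intro!: cSUP_least)

lemma nrm_le_sum: "f \<in> carrier \<A> \<Longrightarrow> nrm \<B> f \<le> (\<Sum>g\<in>carrier G. cmod (f g))"
  by (rule nrm_least) (rule seminorm_le_sum)

lemma norm_le_nrm: "\<lbrakk>f \<in> carrier \<A>; x \<in> carrier G\<rbrakk> \<Longrightarrow> cmod (f x) \<le> nrm \<B> f"
  using norm_le_reg_norm seminorm_le_nrm[OF _ cstar_seminorm_reg_norm] order_trans by blast

lemma nrm_nonneg: "f \<in> carrier \<A> \<Longrightarrow> 0 \<le> nrm \<B> f"
  using reg_norm_nonneg seminorm_le_nrm[OF _ cstar_seminorm_reg_norm] order_trans by blast

text \<open>A pointwise supremum of C*-seminorms is again one. The C*-identity survives because
  squaring and taking square roots are monotone on nonnegative reals.\<close>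

lemma cstar_seminorm_nrm: "cstar_seminorm \<A> (nrm \<B>)"
  unfolding cstar_seminorm_def
proof (intro conjI ballI allI)
  fix f assume f: "f \<in> carrier \<A>"
  have smult_le: "nrm \<B> (c \<odot>\<^bsub>\<A>\<^esub> h) \<le> cmod c * nrm \<B> h" if h: "h \<in> carrier \<A>" for c h
  proof (rule nrm_least)
    fix p assume p: "cstar_seminorm \<A> p"
    show "p (c \<odot>\<^bsub>\<A>\<^esub> h) \<le> cmod c * nrm \<B> h"
      unfolding seminorm_rules(2)[OF p h] by (intro mult_left_mono seminorm_le_nrm h p norm_ge_zero)
  qed
  show "nrm \<B> (c \<odot>\<^bsub>\<A>\<^esub> f) = cmod c * nrm \<B> f" for c
  proof (cases "c = 0")
    case True
    have "0 \<le> nrm \<B> (c \<odot>\<^bsub>\<A>\<^esub> f)" by (intro nrm_nonneg S.smult_cl f)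
    then show ?thesis using smult_le[OF f, of c] True by (metis antisym mult_zero_left norm_zero)
  next
    case False
    have "nrm \<B> f = nrm \<B> (inverse c \<odot>\<^bsub>\<A>\<^esub> (c \<odot>\<^bsub>\<A>\<^esub> f))"
      using S.smult_smult[OF f, of "inverse c" c] S.smult_1[OF f] False by (metis left_inverse)
    also have "\<dots> \<le> cmod (inverse c) * nrm \<B> (c \<odot>\<^bsub>\<A>\<^esub> f)" by (rule smult_le) (rule S.smult_cl[OF f])
    finally have "cmod c * nrm \<B> f \<le> nrm \<B> (c \<odot>\<^bsub>\<A>\<^esub> f)"
      using False by (simp add: norm_inverse norm_divide field_simps del: group_star_algebra_simps group_cstar_algebra_simps)
    then show ?thesis using smult_le[OF f, of c] by (rule antisym[rotated])
  qed
  show "nrm \<B> (adj \<A> f \<otimes>\<^bsub>\<A>\<^esub> f) = (nrm \<B> f)\<^sup>2"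
  proof (rule antisym)
    have ff: "adj \<A> f \<otimes>\<^bsub>\<A>\<^esub> f \<in> carrier \<A>" by (intro S.mult_closed S.adj_closed f)
    show "nrm \<B> (adj \<A> f \<otimes>\<^bsub>\<A>\<^esub> f) \<le> (nrm \<B> f)\<^sup>2"
    proof (rule nrm_least)
      fix p assume p: "cstar_seminorm \<A> p"
      show "p (adj \<A> f \<otimes>\<^bsub>\<A>\<^esub> f) \<le> (nrm \<B> f)\<^sup>2"
        unfolding seminorm_rules(4)[OF p f] by (intro power_mono seminorm_le_nrm seminorm_nonneg[OF p] f p)
    qed
    have "nrm \<B> f \<le> sqrt (nrm \<B> (adj \<A> f \<otimes>\<^bsub>\<A>\<^esub> f))"
    proof (rule nrm_least)
      fix p assume p: "cstar_seminorm \<A> p"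
      have "(p f)\<^sup>2 \<le> nrm \<B> (adj \<A> f \<otimes>\<^bsub>\<A>\<^esub> f)"
        unfolding seminorm_rules(4)[OF p f, symmetric] by (rule seminorm_le_nrm[OF ff p])
      then show "p f \<le> sqrt (nrm \<B> (adj \<A> f \<otimes>\<^bsub>\<A>\<^esub> f))" by (rule real_le_rsqrt)
    qed
    then have "(nrm \<B> f)\<^sup>2 \<le> (sqrt (nrm \<B> (adj \<A> f \<otimes>\<^bsub>\<A>\<^esub> f)))\<^sup>2" by (rule power_mono) (rule nrm_nonneg[OF f])
    then show "(nrm \<B> f)\<^sup>2 \<le> nrm \<B> (adj \<A> f \<otimes>\<^bsub>\<A>\<^esub> f)" unfolding real_sqrt_pow2[OF nrm_nonneg[OF ff]] .
  qed
  fix h assume h: "h \<in> carrier \<A>"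
  show "nrm \<B> (f \<otimes>\<^bsub>\<A>\<^esub> h) \<le> nrm \<B> f * nrm \<B> h"
  proof (rule nrm_least)
    fix p assume p: "cstar_seminorm \<A> p"
    have "p f * p h \<le> nrm \<B> f * nrm \<B> h"
      by (intro mult_mono seminorm_le_nrm seminorm_nonneg[OF p] nrm_nonneg f h p)
    then show "p (f \<otimes>\<^bsub>\<A>\<^esub> h) \<le> nrm \<B> f * nrm \<B> h" using seminorm_rules(3)[OF p f h] by linarith
  qed
  show "nrm \<B> (f \<oplus>\<^bsub>\<A>\<^esub> h) \<le> nrm \<B> f + nrm \<B> h"
  proof (rule nrm_least)
    fix p assume p: "cstar_seminorm \<A> p"
    show "p (f \<oplus>\<^bsub>\<A>\<^esub> h) \<le> nrm \<B> f + nrm \<B> h"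
      using seminorm_rules(1)[OF p f h] seminorm_le_nrm[OF f p] seminorm_le_nrm[OF h p] by linarith
  qed
qed

lemma star_algebra_group_cstar_algebra: "star_algebra \<B>"
proof (intro star_algebra.intro star_algebra_axioms.intro)
  have "abelian_group \<B>"
  proof (rule abelian_groupI)
    fix f assume "f \<in> carrier \<B>"
    then show "\<exists>h\<in>carrier \<B>. h \<oplus>\<^bsub>\<B>\<^esub> f = \<zero>\<^bsub>\<B>\<^esub>"
      by (intro bexI[of _ "\<lambda>x. - f x"]) auto
  qed (auto simp: add_ac)
  then show "Module.module complex_ring \<B>"
    by (rule moduleI[OF cring_complex_ring]) (auto simp: complex_ring_def algebra_simps)
qed (simp_all only: group_cstar_algebra_simps S.mult_closed S.mult_assoc S.mult_add_left S.mult_add_right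
    S.mult_smult_left S.mult_smult_right S.adj_closed S.adj_adj S.adj_add S.adj_smult S.adj_mult)

lemma minus_group_cstar_algebra:
  assumes "f \<in> carrier \<A>" "h \<in> carrier \<A>"
  shows "f \<ominus>\<^bsub>\<B>\<^esub> h = (\<lambda>x. f x - h x)"
proof -
  interpret B: star_algebra \<B> by (rule star_algebra_group_cstar_algebra)
  show ?thesis using B.minus_smult[of f h] assms by auto
qed

lemma ndist_group_cstar_algebra:
  "\<lbrakk>f \<in> carrier \<A>; h \<in> carrier \<A>\<rbrakk> \<Longrightarrow> ndist \<B> f h = nrm \<B> (\<lambda>x. f x - h x)"
  by (simp only: ndist_def minus_group_cstar_algebra group_cstar_algebra_simps(1) simp_thms if_True)

lemma diff_closed: "\<lbrakk>f \<in> carrier \<A>; h \<in> carrier \<A>\<rbrakk> \<Longrightarrow> (\<lambda>x. f x - h x) \<in> carrier \<A>"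
  by simp

lemma nrm_eq_0_imp: "\<lbrakk>f \<in> carrier \<A>; nrm \<B> f = 0\<rbrakk> \<Longrightarrow> f = (\<lambda>x. 0)"
proof (rule ext)
  fix x assume "f \<in> carrier \<A>" "nrm \<B> f = 0"
  then show "f x = 0" using norm_le_nrm[of f x] by (cases "x \<in> carrier G") auto
qed

text \<open>Completeness is an axiom of \<open>cstar_algebra\<close>, so the metric is needed before
  the corresponding fact of that locale becomes available.\<close>

lemma Metric_space_group_cstar_algebra: "Metric_space (carrier \<B>) (ndist \<B>)"
proof
  note [simp del] = group_star_algebra_simps group_cstar_algebra_simps(2-)
  have sub: "nrm \<B> (\<lambda>x. f x - h x) = nrm \<B> (\<lambda>x. h x - f x)" if "f \<in> carrier \<A>" "h \<in> carrier \<A>" for f h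
    using seminorm_rules(2)[OF cstar_seminorm_nrm diff_closed[OF that(2,1)], of "-1"] by (simp add: group_star_algebra_simps)
  have out: "ndist \<B> f h = 0" if "f \<notin> carrier \<A> \<or> h \<notin> carrier \<A>" for f h
    using that by (auto simp: ndist_def)
  fix f h
  show "0 \<le> ndist \<B> f h"
    using nrm_nonneg[OF diff_closed, of f h] out[of f h] ndist_group_cstar_algebra[of f h] by fastforce
  show "ndist \<B> f h = ndist \<B> h f"
    using out[of f h] out[of h f] ndist_group_cstar_algebra[of f h] ndist_group_cstar_algebra[of h f] sub[of f h]
    by fastforce
  show "ndist \<B> f h = 0 \<longleftrightarrow> f = h" if "f \<in> carrier \<B>" "h \<in> carrier \<B>"
  proof -
    have c: "f \<in> carrier \<A>" "h \<in> carrier \<A>" using that by auto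
    have "f = h" if "nrm \<B> (\<lambda>x. f x - h x) = 0"
      using fun_cong[OF nrm_eq_0_imp[OF diff_closed[OF c] that]] by (auto simp: fun_eq_iff)
    moreover have "nrm \<B> (\<lambda>x. 0) = 0" by (rule seminorm_zero[OF cstar_seminorm_nrm])
    ultimately show ?thesis using ndist_group_cstar_algebra[OF c] by auto
  qed
  show "ndist \<B> f k \<le> ndist \<B> f h + ndist \<B> h k"
    if "f \<in> carrier \<B>" "h \<in> carrier \<B>" "k \<in> carrier \<B>" for k
  proof -
    have c: "f \<in> carrier \<A>" "h \<in> carrier \<A>" "k \<in> carrier \<A>" using that by auto
    have "(\<lambda>x. f x - k x) = (\<lambda>x. f x - h x) \<oplus>\<^bsub>\<A>\<^esub> (\<lambda>x. h x - k x)"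
      by (simp add: group_star_algebra_simps)
    then show ?thesis
      unfolding ndist_group_cstar_algebra[OF c(1,3)] ndist_group_cstar_algebra[OF c(1,2)] ndist_group_cstar_algebra[OF c(2,3)]
      using seminorm_rules(1)[OF cstar_seminorm_nrm diff_closed[OF c(1,2)] diff_closed[OF c(2,3)]] by simp
  qed
qed

text \<open>The norm lies between each absolute coordinate and the sum of all of them, so
  completeness reduces to that of the complex numbers in finitely many coordinates.\<close>

lemma mcomplete_group_cstar_algebra: "Metric_space.mcomplete (carrier \<B>) (ndist \<B>)"
proof -
  interpret M: Metric_space "carrier \<B>" "ndist \<B>" by (rule Metric_space_group_cstar_algebra)
  note [simp del] = group_star_algebra_simps group_cstar_algebra_simps(2-)
  show ?thesis
    unfolding M.mcomplete_def
  proof (intro allI impI)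
    fix \<sigma> assume "M.MCauchy \<sigma>"
    then have \<sigma>: "\<And>n. \<sigma> n \<in> carrier \<A>"
      and cau: "\<And>e. e > 0 \<Longrightarrow> \<exists>N. \<forall>n n'. N \<le> n \<longrightarrow> N \<le> n' \<longrightarrow> ndist \<B> (\<sigma> n) (\<sigma> n') < e"
      unfolding M.MCauchy_def by auto
    have "convergent (\<lambda>n. \<sigma> n x)" if x: "x \<in> carrier G" for x
    proof (rule Cauchy_convergent, rule metric_CauchyI)
      fix e :: real assume "e > 0"
      then obtain N where N: "\<And>n n'. N \<le> n \<Longrightarrow> N \<le> n' \<Longrightarrow> ndist \<B> (\<sigma> n) (\<sigma> n') < e" using cau by blast
      have "dist (\<sigma> m x) (\<sigma> n x) < e" if "m \<ge> N" "n \<ge> N" for m n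
        using N[OF that] norm_le_nrm[OF diff_closed[OF \<sigma> \<sigma>] x, of m n]
        unfolding ndist_group_cstar_algebra[OF \<sigma> \<sigma>] dist_norm by linarith
      then show "\<exists>M. \<forall>m\<ge>M. \<forall>n\<ge>M. dist (\<sigma> m x) (\<sigma> n x) < e" by blast
    qed
    then have lim: "(\<lambda>n. \<sigma> n x) \<longlonglongrightarrow> lim (\<lambda>n. \<sigma> n x)" if "x \<in> carrier G" for x
      using that convergent_LIMSEQ_iff by blast
    \<comment> \<open>The value 0 off the group is what membership in the carrier demands.\<close>
    define f where "f x = (if x \<in> carrier G then lim (\<lambda>n. \<sigma> n x) else 0)" for x
    have f: "f \<in> carrier \<A>" by (simp add: f_def group_star_algebra_simps)
    have "(\<lambda>n. \<Sum>g\<in>carrier G. cmod (\<sigma> n g - f g)) \<longlonglongrightarrow> (\<Sum>g\<in>carrier G. cmod (f g - f g))"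
      by (intro tendsto_intros) (use lim in \<open>auto simp: f_def\<close>)
    then have *: "(\<lambda>n. \<Sum>g\<in>carrier G. cmod (\<sigma> n g - f g)) \<longlonglongrightarrow> 0" by simp
    have "limitin M.mtopology \<sigma> f sequentially"
      unfolding M.limit_metric_sequentially
    proof (intro conjI allI impI)
      fix e :: real assume "e > 0"
      with * have "\<forall>\<^sub>F n in sequentially. (\<Sum>g\<in>carrier G. cmod (\<sigma> n g - f g)) < e" by (rule order_tendstoD)
      then obtain N where N: "\<And>n. n \<ge> N \<Longrightarrow> (\<Sum>g\<in>carrier G. cmod (\<sigma> n g - f g)) < e"
        by (auto simp: eventually_sequentially)
      have "ndist \<B> (\<sigma> n) f < e" if "n \<ge> N" for n
        using N[OF that] nrm_le_sum[OF diff_closed[OF \<sigma> f], of n]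
        unfolding ndist_group_cstar_algebra[OF \<sigma> f] by linarith
      then show "\<exists>N. \<forall>n\<ge>N. \<sigma> n \<in> carrier \<B> \<and> ndist \<B> (\<sigma> n) f < e" using \<sigma> by auto
    qed (use f in simp)
    then show "\<exists>f. limitin M.mtopology \<sigma> f sequentially" by blast
  qed
qed

lemma cstar_algebra_group_cstar_algebra: "cstar_algebra \<B>"
proof (intro cstar_algebra.intro cstar_algebra_axioms.intro)
  show "star_algebra \<B>" by (rule star_algebra_group_cstar_algebra)
  show "cstar_seminorm \<B> (nrm \<B>)"
    using cstar_seminorm_nrm unfolding cstar_seminorm_group_cstar_algebra .
  show "x = \<zero>\<^bsub>\<B>\<^esub>" if "x \<in> carrier \<B>" "nrm \<B> x = 0" for x
    using nrm_eq_0_imp[of x] that by (simp del: group_cstar_algebra_simps(7))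
qed (rule mcomplete_group_cstar_algebra)

sublocale B: cstar_algebra \<B>
  by (rule cstar_algebra_group_cstar_algebra)

section \<open>The grading by coordinates\<close>

lemma group_cstar_comp_iff:
  "g \<in> carrier G \<Longrightarrow> f \<in> group_cstar_comp G g \<longleftrightarrow> f \<in> carrier \<A> \<and> (\<forall>x. x \<noteq> g \<longrightarrow> f x = 0)"
proof
  assume g: "g \<in> carrier G" and f: "f \<in> carrier \<A> \<and> (\<forall>x. x \<noteq> g \<longrightarrow> f x = 0)"
  have "f = f g \<odot>\<^bsub>\<B>\<^esub> group_unitary g" using f by (auto simp: group_unitary_def)
  then show "f \<in> group_cstar_comp G g" unfolding group_cstar_comp_def by blast
qed (auto simp: group_cstar_comp_def group_unitary_def)

lemma finsum_group_cstar_algebra: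
  assumes "finite T" "\<And>g. g \<in> T \<Longrightarrow> F g \<in> carrier \<A>"
  shows "finsum \<B> F T = (\<lambda>x. \<Sum>g\<in>T. F g x)"
  using assms
proof (induction T rule: finite_induct)
  case (insert g T)
  have "finsum \<B> F (insert g T) = F g \<oplus>\<^bsub>\<B>\<^esub> finsum \<B> F T"
    using insert by (intro B.M.finsum_insert) auto
  then show ?case using insert by simp
qed simp

lemma finsum_homogeneous:
  assumes "\<And>g. g \<in> carrier G \<Longrightarrow> F g \<in> group_cstar_comp G g" "x \<in> carrier G"
  shows "finsum \<B> F (carrier G) x = F x x"
proof -
  have F: "F g x = 0" if "g \<in> carrier G - {x}" for g using assms(1)[of g] that group_cstar_comp_iff[of g] by auto
  have "finsum \<B> F (carrier G) x = (\<Sum>g\<in>carrier G. F g x)"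
    using finsum_group_cstar_algebra[OF finite_G, of F] assms group_cstar_comp_iff by simp
  also have "\<dots> = F x x"
    using sum.remove[OF finite_G assms(2), of "\<lambda>g. F g x"] F by simp
  finally show ?thesis .
qed

lemma graded_group_cstar_algebra: "graded_cstar_algebra G \<B> (group_cstar_comp G)"
proof (intro graded_cstar_algebra.intro graded_cstar_algebra_axioms.intro)
  show "group G" by (rule group_axioms)
  show "cstar_algebra \<B>" by (rule cstar_algebra_group_cstar_algebra)
  show "finite (carrier G)" by (rule finite_G)
  fix g assume g: "g \<in> carrier G"
  show "submodule (group_cstar_comp G g) complex_ring \<B>"
  proof (rule B.submoduleI)
    show "\<ominus>\<^bsub>\<B>\<^esub> a \<in> group_cstar_comp G g" if "a \<in> group_cstar_comp G g" for a
      using that B.smult_neg1[of a] unfolding group_cstar_comp_iff[OF g] by auto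
  qed (unfold group_cstar_comp_iff[OF g] subset_eq Ball_def, auto)
  show "closedin (ntopology \<B>) (group_cstar_comp G g)"
    unfolding B.MS.metric_closedin_iff_sequentially_closed
  proof (intro conjI allI impI)
    note [simp del] = group_cstar_algebra_simps(7)
    show "group_cstar_comp G g \<subseteq> carrier \<B>" using group_cstar_comp_iff[OF g] by auto
    fix \<sigma> l assume "range \<sigma> \<subseteq> group_cstar_comp G g \<and> limitin (ntopology \<B>) \<sigma> l sequentially"
    then have \<sigma>: "\<And>n. \<sigma> n \<in> group_cstar_comp G g" and l: "l \<in> carrier \<A>"
      and lim: "\<And>e. e > 0 \<Longrightarrow> \<exists>n. ndist \<B> (\<sigma> n) l < e"
      unfolding B.MS.limit_metric_sequentially by (auto, meson order_refl)
    have "l x = 0" if "x \<noteq> g" for x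
    proof (rule ccontr)
      assume nz: "l x \<noteq> 0"
      then have x: "x \<in> carrier G" using l by auto
      \<comment> \<open>Every \<open>\<sigma> n\<close> vanishes at \<open>x\<close>, so by
        \<open>norm_le_nrm\<close> its distance from \<open>l\<close> is at least
        \<open>cmod (l x)\<close>.\<close>
      obtain n where n: "ndist \<B> (\<sigma> n) l < cmod (l x)" using lim[of "cmod (l x)"] nz by auto
      have sn: "\<sigma> n \<in> carrier \<A>" "\<sigma> n x = 0" using \<sigma>[of n] that unfolding group_cstar_comp_iff[OF g] by auto
      show False
        using n norm_le_nrm[OF diff_closed[OF sn(1) l] x] sn(2)
        unfolding ndist_group_cstar_algebra[OF sn(1) l] by simp
    qed
    then show "l \<in> group_cstar_comp G g" using l group_cstar_comp_iff[OF g] by simp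
  qed
  show "adj \<B> a \<in> group_cstar_comp G (inv g)" if "a \<in> group_cstar_comp G g" for a
  proof -
    obtain c where "a = c \<odot>\<^bsub>\<A>\<^esub> group_unitary g" using \<open>a \<in> _\<close> by (auto simp: group_cstar_comp_def)
    then have "adj \<B> a = cnj c \<odot>\<^bsub>\<B>\<^esub> group_unitary (inv g)"
      using S.adj_smult[OF group_unitary_closed[OF g], of c] group_unitary_adj[OF g]
      by (simp only: group_cstar_algebra_simps)
    then show ?thesis unfolding group_cstar_comp_def by blast
  qed
  fix h a b assume h: "h \<in> carrier G" and "a \<in> group_cstar_comp G g" "b \<in> group_cstar_comp G h"
  then obtain c d where "a = c \<odot>\<^bsub>\<A>\<^esub> group_unitary g" "b = d \<odot>\<^bsub>\<A>\<^esub> group_unitary h"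
    by (auto simp: group_cstar_comp_def)
  then have "a \<otimes>\<^bsub>\<B>\<^esub> b = (d * c) \<odot>\<^bsub>\<B>\<^esub> group_unitary (g \<otimes> h)"
    by (simp only: group_cstar_algebra_simps S.mult_smult_left S.mult_smult_right S.smult_smult group_unitary_mult
        group_unitary_closed S.smult_cl S.mult_closed g h m_closed)
  then show "a \<otimes>\<^bsub>\<B>\<^esub> b \<in> group_cstar_comp G (g \<otimes> h)" unfolding group_cstar_comp_def by blast
next
  fix a assume a: "a \<in> carrier \<B>"
  let ?F = "\<lambda>g\<in>carrier G. \<lambda>x. if x = g then a g else 0"
  show "\<exists>!f. f \<in> (\<Pi>\<^sub>E g\<in>carrier G. group_cstar_comp G g) \<and> a = finsum \<B> f (carrier G)"
  proof (rule ex1I[of _ ?F])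
    have F: "?F g \<in> group_cstar_comp G g" if "g \<in> carrier G" for g
      using that group_cstar_comp_iff[OF that] by auto
    have "a = finsum \<B> ?F (carrier G)"
    proof
      fix x
      show "a x = finsum \<B> ?F (carrier G) x"
      proof (cases "x \<in> carrier G")
        case True
        have "finsum \<B> ?F (carrier G) x = ?F x x" by (rule finsum_homogeneous[OF F True])
        also have "\<dots> = a x" using True by simp
        finally show ?thesis ..
      next
        case False
        have "finsum \<B> ?F (carrier G) \<in> carrier \<B>"
          by (rule B.finsum_cl) (use F group_cstar_comp_iff in auto)
        then show ?thesis using a False by simp
      qed
    qed
    then show "?F \<in> (\<Pi>\<^sub>E g\<in>carrier G. group_cstar_comp G g) \<and> a = finsum \<B> ?F (carrier G)" using F by auto
    fix f assume f: "f \<in> (\<Pi>\<^sub>E g\<in>carrier G. group_cstar_comp G g) \<and> a = finsum \<B> f (carrier G)"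
    then have fc: "\<And>g. g \<in> carrier G \<Longrightarrow> f g \<in> group_cstar_comp G g" by auto
    show "f = ?F"
    proof
      fix g
      show "f g = ?F g"
      proof (cases "g \<in> carrier G")
        case True
        have "f g g = a g" using finsum_homogeneous[OF fc True] f by simp
        then show ?thesis using fc[OF True] True group_cstar_comp_iff[OF True] by auto
      next
        case False
        then show ?thesis using f by (auto simp: PiE_def extensional_def)
      qed
    qed
  qed
next
  show "\<exists>K. \<forall>f\<in>\<Pi>\<^sub>E g\<in>carrier G. group_cstar_comp G g.
      (\<Sum>g\<in>carrier G. nrm \<B> (f g)) \<le> K * nrm \<B> (finsum \<B> f (carrier G))"
  proof (intro exI ballI)
    fix f assume "f \<in> (\<Pi>\<^sub>E g\<in>carrier G. group_cstar_comp G g)"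
    then have f: "\<And>g. g \<in> carrier G \<Longrightarrow> f g \<in> group_cstar_comp G g" by auto
    have fc: "\<And>g. g \<in> carrier G \<Longrightarrow> f g \<in> carrier \<A>" using f group_cstar_comp_iff by blast
    have sc: "finsum \<B> f (carrier G) \<in> carrier \<A>"
      using B.finsum_cl[of "carrier G" f] fc by simp
    \<comment> \<open>A homogeneous element has a single coordinate, which is also a coordinate of
      the whole sum and so bounded by its norm. Adding up, the constant left open by
      \<open>exI\<close> becomes the order of the group.\<close>
    have "(\<Sum>g\<in>carrier G. nrm \<B> (f g)) \<le> (\<Sum>g\<in>carrier G. nrm \<B> (finsum \<B> f (carrier G)))"
    proof (rule sum_mono)
      fix g assume g: "g \<in> carrier G"
      have "nrm \<B> (f g) \<le> (\<Sum>x\<in>carrier G. cmod (f g x))" by (rule nrm_le_sum[OF fc[OF g]])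
      also have "\<dots> = cmod (f g g)"
        using sum.remove[OF finite_G g, of "\<lambda>x. cmod (f g x)"] f[OF g] group_cstar_comp_iff[OF g] by simp
      also have "\<dots> = cmod (finsum \<B> f (carrier G) g)" using finsum_homogeneous[OF f g] by simp
      also have "\<dots> \<le> nrm \<B> (finsum \<B> f (carrier G))" by (rule norm_le_nrm[OF sc g])
      finally show "nrm \<B> (f g) \<le> nrm \<B> (finsum \<B> f (carrier G))" .
    qed
    then show "(\<Sum>g\<in>carrier G. nrm \<B> (f g)) \<le> real (card (carrier G)) * nrm \<B> (finsum \<B> f (carrier G))"
      by (simp only: sum_constant)
  qed
qed

end

section \<open>Lifting graded homomorphisms\<close>

context cstar_algebra
begin

context
  fixes I assumes I: "star_ideal I"
begin

lemma coset_iff: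
  assumes x: "x \<in> carrier A"
  shows "y \<in> I +> x \<longleftrightarrow> y \<in> carrier A \<and> y \<ominus> x \<in> I"
proof
  assume "y \<in> I +> x"
  then obtain i where i: "i \<in> I" "y = i \<oplus> x" by (auto simp: a_r_coset_def')
  have "i \<in> carrier A" using star_ideal_closed(1)[OF I i(1)] .
  moreover from this have "y \<ominus> x = i" using i x by (simp add: diff_eq_iff)
  ultimately show "y \<in> carrier A \<and> y \<ominus> x \<in> I" using i x by simp
next
  assume y: "y \<in> carrier A \<and> y \<ominus> x \<in> I"
  have "y = (y \<ominus> x) \<oplus> x" using x y diff_eq_iff[of y x "y \<ominus> x"] by simp
  then show "y \<in> I +> x" using y by (auto simp: a_r_coset_def')
qed

lemma coset_eqI: "\<lbrakk>x \<in> carrier A; y \<in> carrier A; x \<ominus> y \<in> I\<rbrakk> \<Longrightarrow> I +> x = I +> y"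
  by (rule Set.set_eqI) (meson coset_iff cong_trans[OF I] cong_sym[OF I])

lemma coset_eq_iff: "\<lbrakk>x \<in> carrier A; y \<in> carrier A\<rbrakk> \<Longrightarrow> I +> x = I +> y \<longleftrightarrow> x \<ominus> y \<in> I"
  using coset_eqI coset_iff[of y x] coset_iff[of x x] cong_refl[OF I, of x] by blast

lemma coset_self: "x \<in> carrier A \<Longrightarrow> x \<in> I +> x"
  using coset_iff cong_refl[OF I] by simp

lemma quot_carrier: "carrier (cstar_quot A I) = (\<lambda>x. I +> x) ` carrier A"
  by (auto simp: cstar_quot_def FactRing_def A_RCOSETS_def')

lemma quot_map_coset:
  assumes IJ: "I \<subseteq> J" and J: "star_ideal J" and x: "x \<in> carrier A"
  shows "quot_map A J (I +> x) = J +> x"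
proof (rule Set.set_eqI)
  fix y
  have "y \<in> quot_map A J (I +> x) \<longleftrightarrow> (\<exists>j\<in>J. \<exists>i\<in>I. y = j \<oplus> (i \<oplus> x))"
    by (auto simp: quot_map_def set_add_def' a_r_coset_def')
  also have "\<dots> \<longleftrightarrow> (\<exists>j\<in>J. y = j \<oplus> x)"
  proof
    assume "\<exists>j\<in>J. \<exists>i\<in>I. y = j \<oplus> (i \<oplus> x)"
    then obtain j i where ji: "j \<in> J" "i \<in> I" "y = j \<oplus> (i \<oplus> x)" by blast
    then have "j \<in> carrier A" "i \<in> carrier A" using star_ideal_closed(1)[OF J] IJ by auto
    then have "y = (j \<oplus> i) \<oplus> x" using ji x by (simp add: M.a_assoc)
    moreover have "j \<oplus> i \<in> J" using ji IJ star_ideal_closed(3)[OF J] by auto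
    ultimately show "\<exists>j\<in>J. y = j \<oplus> x" by blast
  next
    assume "\<exists>j\<in>J. y = j \<oplus> x"
    then obtain j where "j \<in> J" "y = j \<oplus> x" by blast
    then have "y = j \<oplus> (\<zero> \<oplus> x)" using x by simp
    then show "\<exists>j\<in>J. \<exists>i\<in>I. y = j \<oplus> (i \<oplus> x)" using \<open>j \<in> J\<close> star_ideal_closed(2)[OF I] by blast
  qed
  also have "\<dots> \<longleftrightarrow> y \<in> J +> x" by (auto simp: a_r_coset_def')
  finally show "y \<in> quot_map A J (I +> x) \<longleftrightarrow> y \<in> J +> x" .
qed

lemma quot_add:
  assumes x: "x \<in> carrier A" and y: "y \<in> carrier A"
  shows "(I +> x) \<oplus>\<^bsub>cstar_quot A I\<^esub> (I +> y) = I +> (x \<oplus> y)"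
proof -
  have "(I +> x) \<oplus>\<^bsub>cstar_quot A I\<^esub> (I +> y) = {u \<oplus> v | u v. u \<in> I +> x \<and> v \<in> I +> y}"
    by (auto simp: cstar_quot_def FactRing_def set_add_def')
  also have "\<dots> = I +> (x \<oplus> y)"
  proof (intro Set.set_eqI iffI)
    fix z assume "z \<in> {u \<oplus> v | u v. u \<in> I +> x \<and> v \<in> I +> y}"
    then obtain u v where z: "z = u \<oplus> v" "u \<in> I +> x" "v \<in> I +> y" by blast
    have uv: "u \<in> carrier A" "u \<ominus> x \<in> I" "v \<in> carrier A" "v \<ominus> y \<in> I"
      using z x y by (auto simp: coset_iff)
    then show "z \<in> I +> (x \<oplus> y)" using z x y cong_add[OF I uv(2,4)] by (simp add: coset_iff)
  next
    fix z assume "z \<in> I +> (x \<oplus> y)"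
    then obtain i where i: "i \<in> I" "z = i \<oplus> (x \<oplus> y)" by (auto simp: a_r_coset_def')
    have "z = (i \<oplus> x) \<oplus> y" using i x y star_ideal_closed(1)[OF I i(1)] by (simp add: M.a_assoc)
    moreover have "i \<oplus> x \<in> I +> x" using i by (auto simp: a_r_coset_def')
    ultimately show "z \<in> {u \<oplus> v | u v. u \<in> I +> x \<and> v \<in> I +> y}" using coset_self[OF y] by blast
  qed
  finally show ?thesis .
qed

text \<open>The operations of \<open>cstar_quot\<close> are unions over all representatives. If the
  result does not depend on the representative, all members of the union are the same coset.\<close>

lemma coset_UN_eq:
  assumes x: "x \<in> carrier A" and F: "F x \<in> carrier A"
    and "\<And>u. \<lbrakk>u \<in> carrier A; u \<ominus> x \<in> I\<rbrakk> \<Longrightarrow> F u \<in> carrier A \<and> F u \<ominus> F x \<in> I"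
  shows "(\<Union>u\<in>I +> x. I +> F u) = I +> F x"
proof -
  have "I +> F u = I +> F x" if "u \<in> I +> x" for u
    using that assms coset_iff[OF x] by (intro coset_eqI) auto
  then show ?thesis using coset_self[OF x] by blast
qed

lemma quot_smult:
  assumes x: "x \<in> carrier A"
  shows "c \<odot>\<^bsub>cstar_quot A I\<^esub> (I +> x) = I +> (c \<odot> x)"
proof -
  have "c \<odot>\<^bsub>cstar_quot A I\<^esub> (I +> x) = (\<Union>u\<in>I +> x. I +> (c \<odot> u))" by (simp add: cstar_quot_def)
  also have "\<dots> = I +> (c \<odot> x)"
    by (rule coset_UN_eq[OF x, of "\<lambda>u. c \<odot> u"]) (use x cong_smult[OF I] in auto)
  finally show ?thesis .
qed

lemma quot_adj:
  assumes x: "x \<in> carrier A"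
  shows "adj (cstar_quot A I) (I +> x) = I +> adj A x"
proof -
  have "adj (cstar_quot A I) (I +> x) = (\<Union>u\<in>I +> x. I +> adj A u)" by (simp add: cstar_quot_def)
  also have "\<dots> = I +> adj A x"
    by (rule coset_UN_eq[OF x, of "adj A"]) (use x cong_adj[OF I] in auto)
  finally show ?thesis .
qed

lemma quot_mult:
  assumes x: "x \<in> carrier A" and y: "y \<in> carrier A"
  shows "(I +> x) \<otimes>\<^bsub>cstar_quot A I\<^esub> (I +> y) = I +> (x \<otimes> y)"
proof -
  have "(I +> x) \<otimes>\<^bsub>cstar_quot A I\<^esub> (I +> y) = (\<Union>u\<in>I +> x. \<Union>v\<in>I +> y. I +> (u \<otimes> v))"
    by (simp add: cstar_quot_def FactRing_def rcoset_mult_def)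
  also have "\<dots> = (\<Union>u\<in>I +> x. I +> (u \<otimes> y))"
  proof (rule SUP_cong[OF refl])
    fix u assume u: "u \<in> I +> x"
    then have "u \<in> carrier A" using coset_iff[OF x] by simp
    then show "(\<Union>v\<in>I +> y. I +> (u \<otimes> v)) = I +> (u \<otimes> y)"
      by (intro coset_UN_eq[OF y, of "\<lambda>v. u \<otimes> v"]) (use y cong_mult[OF I cong_refl[OF I]] in auto)
  qed
  also have "\<dots> = I +> (x \<otimes> y)"
    by (rule coset_UN_eq[OF x, of "\<lambda>u. u \<otimes> y"]) (use x y cong_mult[OF I _ cong_refl[OF I]] in auto)
  finally show ?thesis .
qed

end

end

section \<open>Linear extension of a family indexed by the group\<close>

context graded_cstar_algebra
begin

sublocale FG: finite_group G
  by unfold_locales (rule finite_group)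

text \<open>The linear map taking \<open>group_unitary g\<close> to \<open>w g\<close>. It has
  values in \<open>A\<close> itself, where it is multiplicative and compatible with the adjoint only
  up to an ideal.\<close>

definition extend_hom :: "('g \<Rightarrow> 'a) \<Rightarrow> ('g \<Rightarrow> complex) \<Rightarrow> 'a" where
  "extend_hom w x = finsum A (\<lambda>g. x g \<odot>\<^bsub>A\<^esub> w g) (carrier G)"

lemma finsum_swap:
  assumes "finite T" "\<And>a b. a \<in> S \<Longrightarrow> b \<in> T \<Longrightarrow> f a b \<in> carrier A" "finite S"
  shows "finsum A (\<lambda>a. finsum A (f a) T) S = finsum A (\<lambda>b. finsum A (\<lambda>a. f a b) S) T"
  using assms(3,2)
proof (induction S rule: finite_induct)
  case empty
  then show ?case by simp
next
  case (insert a S)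
  have "finsum A (\<lambda>a. finsum A (f a) T) (insert a S) = finsum A (f a) T \<oplus>\<^bsub>A\<^esub> finsum A (\<lambda>a. finsum A (f a) T) S"
    using insert by (intro A.M.finsum_insert) auto
  also have "\<dots> = finsum A (f a) T \<oplus>\<^bsub>A\<^esub> finsum A (\<lambda>b. finsum A (\<lambda>a. f a b) S) T"
    using insert by simp
  also have "\<dots> = finsum A (\<lambda>b. f a b \<oplus>\<^bsub>A\<^esub> finsum A (\<lambda>a. f a b) S) T"
    using insert by (intro A.M.finsum_addf[symmetric]) auto
  also have "\<dots> = finsum A (\<lambda>b. finsum A (\<lambda>a. f a b) (insert a S)) T"
    using insert by (intro A.M.finsum_cong') (auto intro!: A.M.finsum_insert[symmetric])
  finally show ?case .
qed

lemma sum_smult: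
  "u \<in> carrier A \<Longrightarrow> finite T \<Longrightarrow> (\<Sum>t\<in>T. c t) \<odot>\<^bsub>A\<^esub> u = finsum A (\<lambda>t. c t \<odot>\<^bsub>A\<^esub> u) T"
  by (induction T rule: infinite_finite_induct)
    (simp_all add: A.smult_add_left del: A.smult_collect)

context
  fixes w assumes w: "\<And>g. g \<in> carrier G \<Longrightarrow> w g \<in> gcomp g"
begin

lemma extend_closed [simp, intro]: "extend_hom w x \<in> carrier A"
  unfolding extend_hom_def using gcomp_carrier w by (intro A.finsum_cl A.smult_cl) auto

lemma extend_add: "extend_hom w (\<lambda>g. x g + y g) = extend_hom w x \<oplus>\<^bsub>A\<^esub> extend_hom w y"
proof -
  have "extend_hom w (\<lambda>g. x g + y g) = finsum A (\<lambda>g. x g \<odot>\<^bsub>A\<^esub> w g \<oplus>\<^bsub>A\<^esub> y g \<odot>\<^bsub>A\<^esub> w g) (carrier G)"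
    unfolding extend_hom_def using gcomp_carrier w
    by (intro A.M.finsum_cong') (auto simp: A.smult_add_left simp del: A.smult_collect)
  also have "\<dots> = extend_hom w x \<oplus>\<^bsub>A\<^esub> extend_hom w y"
    unfolding extend_hom_def using gcomp_carrier w by (intro A.M.finsum_addf) auto
  finally show ?thesis .
qed

lemma extend_smult: "extend_hom w (\<lambda>g. c * x g) = c \<odot>\<^bsub>A\<^esub> extend_hom w x"
proof -
  have "c \<odot>\<^bsub>A\<^esub> extend_hom w x = finsum A (\<lambda>g. c \<odot>\<^bsub>A\<^esub> (x g \<odot>\<^bsub>A\<^esub> w g)) (carrier G)"
    unfolding extend_hom_def using gcomp_carrier w finite_group by (intro A.finsum_smult) auto
  also have "\<dots> = extend_hom w (\<lambda>g. c * x g)"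
    unfolding extend_hom_def using gcomp_carrier w by (intro A.M.finsum_cong') auto
  finally show ?thesis by simp
qed

lemma extend_unitary:
  assumes g: "g \<in> carrier G"
  shows "extend_hom w (group_unitary g) = w g"
proof -
  have "extend_hom w (group_unitary g) = group_unitary g g \<odot>\<^bsub>A\<^esub> w g \<oplus>\<^bsub>A\<^esub>
      finsum A (\<lambda>h. group_unitary g h \<odot>\<^bsub>A\<^esub> w h) (carrier G - {g})"
    unfolding extend_hom_def
    using A.M.finsum_insert[of "carrier G - {g}" g "\<lambda>h. group_unitary g h \<odot>\<^bsub>A\<^esub> w h"] g finite_group gcomp_carrier[OF _ w]
    by (simp add: insert_absorb Pi_def)
  also have "finsum A (\<lambda>h. group_unitary g h \<odot>\<^bsub>A\<^esub> w h) (carrier G - {g}) = finsum A (\<lambda>h. \<zero>\<^bsub>A\<^esub>) (carrier G - {g})"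
    using gcomp_carrier w by (intro A.M.finsum_cong') (auto simp: group_unitary_def)
  finally show ?thesis using g gcomp_carrier w by (simp add: group_unitary_def A.M.finsum_zero)
qed

text \<open>Substituting \<open>k = g h\<close> writes both terms as double sums over
  \<open>g\<close> and \<open>h\<close> with the same coefficients, which are then congruent term by
  term.\<close>

lemma extend_cong_mult:
  assumes I: "A.star_ideal I"
    and mult: "\<And>g h. \<lbrakk>g \<in> carrier G; h \<in> carrier G\<rbrakk> \<Longrightarrow> w (g \<otimes> h) \<ominus>\<^bsub>A\<^esub> w g \<otimes>\<^bsub>A\<^esub> w h \<in> I"
  shows "extend_hom w (x \<otimes>\<^bsub>FG.\<A>\<^esub> y) \<ominus>\<^bsub>A\<^esub> extend_hom w x \<otimes>\<^bsub>A\<^esub> extend_hom w y \<in> I"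
proof -
  have wc: "w g \<in> carrier A" if "g \<in> carrier G" for g using gcomp_carrier w that by blast
  have ec: "extend_hom w x \<in> carrier A" for x by simp
  have "extend_hom w (x \<otimes>\<^bsub>FG.\<A>\<^esub> y)
      = finsum A (\<lambda>k. finsum A (\<lambda>g. (x g * y (inv g \<otimes> k)) \<odot>\<^bsub>A\<^esub> w k) (carrier G)) (carrier G)"
    unfolding extend_hom_def using wc finite_group
    by (intro A.M.finsum_cong') (auto simp: sum_smult)
  also have "\<dots> = finsum A (\<lambda>g. finsum A (\<lambda>k. (x g * y (inv g \<otimes> k)) \<odot>\<^bsub>A\<^esub> w k) (carrier G)) (carrier G)"
    using wc finite_group by (intro finsum_swap) auto
  also have "\<dots> = finsum A (\<lambda>g. finsum A (\<lambda>h. (x g * y h) \<odot>\<^bsub>A\<^esub> w (g \<otimes> h)) (carrier G)) (carrier G)"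
  proof (rule A.M.finsum_cong')
    fix g assume g: "g \<in> carrier G"
    have im: "(\<lambda>h. g \<otimes> h) ` carrier G = carrier G" using surj_const_mult[OF g] .
    have "finsum A (\<lambda>k. (x g * y (inv g \<otimes> k)) \<odot>\<^bsub>A\<^esub> w k) ((\<lambda>h. g \<otimes> h) ` carrier G)
        = finsum A (\<lambda>h. (x g * y (inv g \<otimes> (g \<otimes> h))) \<odot>\<^bsub>A\<^esub> w (g \<otimes> h)) (carrier G)"
      using g wc im inj_on_cmult[OF g] by (intro A.M.finsum_reindex) auto
    also have "\<dots> = finsum A (\<lambda>h. (x g * y h) \<odot>\<^bsub>A\<^esub> w (g \<otimes> h)) (carrier G)"
      using g wc by (intro A.M.finsum_cong') (auto simp: m_assoc[symmetric])
    finally show "finsum A (\<lambda>k. (x g * y (inv g \<otimes> k)) \<odot>\<^bsub>A\<^esub> w k) (carrier G)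
        = finsum A (\<lambda>h. (x g * y h) \<odot>\<^bsub>A\<^esub> w (g \<otimes> h)) (carrier G)" unfolding im .
  qed (use wc in auto)
  finally have 1: "extend_hom w (x \<otimes>\<^bsub>FG.\<A>\<^esub> y)
      = finsum A (\<lambda>g. finsum A (\<lambda>h. (x g * y h) \<odot>\<^bsub>A\<^esub> w (g \<otimes> h)) (carrier G)) (carrier G)" .
  have "extend_hom w x \<otimes>\<^bsub>A\<^esub> extend_hom w y
      = finsum A (\<lambda>g. (x g \<odot>\<^bsub>A\<^esub> w g) \<otimes>\<^bsub>A\<^esub> extend_hom w y) (carrier G)"
    unfolding extend_hom_def[of w x] using wc ec finite_group by (intro SG.finsum_mult_right) auto
  also have "\<dots> = finsum A (\<lambda>g. finsum A (\<lambda>h. (x g * y h) \<odot>\<^bsub>A\<^esub> (w g \<otimes>\<^bsub>A\<^esub> w h)) (carrier G)) (carrier G)"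
  proof (rule A.M.finsum_cong')
    fix g assume g: "g \<in> carrier G"
    have "(x g \<odot>\<^bsub>A\<^esub> w g) \<otimes>\<^bsub>A\<^esub> extend_hom w y
        = finsum A (\<lambda>h. (x g \<odot>\<^bsub>A\<^esub> w g) \<otimes>\<^bsub>A\<^esub> (y h \<odot>\<^bsub>A\<^esub> w h)) (carrier G)"
      unfolding extend_hom_def using wc g finite_group by (intro SG.finsum_mult_left) auto
    also have "\<dots> = finsum A (\<lambda>h. (x g * y h) \<odot>\<^bsub>A\<^esub> (w g \<otimes>\<^bsub>A\<^esub> w h)) (carrier G)"
      using wc g by (intro A.M.finsum_cong') (auto simp: A.mult_smult_left A.mult_smult_right mult.commute)
    finally show "(x g \<odot>\<^bsub>A\<^esub> w g) \<otimes>\<^bsub>A\<^esub> extend_hom w y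
        = finsum A (\<lambda>h. (x g * y h) \<odot>\<^bsub>A\<^esub> (w g \<otimes>\<^bsub>A\<^esub> w h)) (carrier G)" .
  qed (use wc in auto)
  finally have 2: "extend_hom w x \<otimes>\<^bsub>A\<^esub> extend_hom w y
      = finsum A (\<lambda>g. finsum A (\<lambda>h. (x g * y h) \<odot>\<^bsub>A\<^esub> (w g \<otimes>\<^bsub>A\<^esub> w h)) (carrier G)) (carrier G)" .
  show ?thesis unfolding 1 2
    using wc finite_group mult
    by (intro A.cong_finsum[OF I] A.cong_smult[OF I]) auto
qed

text \<open>Reindexing by inversion matches the coefficients \<open>cnj (x g)\<close> on both sides;
  the rest is termwise.\<close>

lemma extend_cong_adj:
  assumes I: "A.star_ideal I"
    and adj: "\<And>g. g \<in> carrier G \<Longrightarrow> w (inv g) \<ominus>\<^bsub>A\<^esub> adj A (w g) \<in> I"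
  shows "extend_hom w (adj FG.\<A> x) \<ominus>\<^bsub>A\<^esub> adj A (extend_hom w x) \<in> I"
proof -
  have wc: "w g \<in> carrier A" if "g \<in> carrier G" for g using gcomp_carrier w that by blast
  have im: "(\<lambda>g. inv g) ` carrier G = carrier G" by (auto simp: image_iff) (metis inv_closed inv_inv)
  have "finsum A (\<lambda>g. adj FG.\<A> x g \<odot>\<^bsub>A\<^esub> w g) ((\<lambda>g. inv g) ` carrier G)
      = finsum A (\<lambda>g. adj FG.\<A> x (inv g) \<odot>\<^bsub>A\<^esub> w (inv g)) (carrier G)"
  proof (rule A.M.finsum_reindex)
    show "inj_on (\<lambda>g. inv g) (carrier G)" by (metis inj_onI inv_inv)
  qed (use wc in auto)
  also have "\<dots> = finsum A (\<lambda>g. cnj (x g) \<odot>\<^bsub>A\<^esub> w (inv g)) (carrier G)"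
    using wc by (intro A.M.finsum_cong') auto
  finally have 1: "extend_hom w (adj FG.\<A> x) = finsum A (\<lambda>g. cnj (x g) \<odot>\<^bsub>A\<^esub> w (inv g)) (carrier G)"
    unfolding im extend_hom_def .
  have "adj A (finsum A (\<lambda>g. x g \<odot>\<^bsub>A\<^esub> w g) T) = finsum A (\<lambda>g. cnj (x g) \<odot>\<^bsub>A\<^esub> adj A (w g)) T"
    if "finite T" "T \<subseteq> carrier G" for T
    using that
  proof (induction T rule: finite_induct)
    case (insert g T)
    have "finsum A (\<lambda>g. x g \<odot>\<^bsub>A\<^esub> w g) (insert g T) = x g \<odot>\<^bsub>A\<^esub> w g \<oplus>\<^bsub>A\<^esub> finsum A (\<lambda>g. x g \<odot>\<^bsub>A\<^esub> w g) T"
      "finsum A (\<lambda>g. cnj (x g) \<odot>\<^bsub>A\<^esub> adj A (w g)) (insert g T)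
        = cnj (x g) \<odot>\<^bsub>A\<^esub> adj A (w g) \<oplus>\<^bsub>A\<^esub> finsum A (\<lambda>g. cnj (x g) \<odot>\<^bsub>A\<^esub> adj A (w g)) T"
      using insert wc by (auto intro!: A.M.finsum_insert)
    moreover have "finsum A (\<lambda>g. x g \<odot>\<^bsub>A\<^esub> w g) T \<in> carrier A" using insert wc by (intro A.finsum_cl) auto
    ultimately show ?case using insert wc by (simp add: A.adj_add)
  qed simp
  from this[OF finite_group order_refl] have 2: "adj A (extend_hom w x) = finsum A (\<lambda>g. cnj (x g) \<odot>\<^bsub>A\<^esub> adj A (w g)) (carrier G)"
    unfolding extend_hom_def .
  show ?thesis unfolding 1 2
    using wc finite_group adj by (intro A.cong_finsum[OF I] A.cong_smult[OF I]) auto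
qed

lemma graded_hom_extend:
  assumes I: "A.star_ideal I"
    and mult: "\<And>g h. \<lbrakk>g \<in> carrier G; h \<in> carrier G\<rbrakk> \<Longrightarrow> w (g \<otimes> h) \<ominus>\<^bsub>A\<^esub> w g \<otimes>\<^bsub>A\<^esub> w h \<in> I"
    and adj: "\<And>g. g \<in> carrier G \<Longrightarrow> w (inv g) \<ominus>\<^bsub>A\<^esub> adj A (w g) \<in> I"
  shows "graded_hom G FG.\<B> (group_cstar_comp G) (cstar_quot A I) (quot_comp A gcomp I)
    (\<lambda>x. I +>\<^bsub>A\<^esub> extend_hom w x)"
proof -
  have ec: "extend_hom w x \<in> carrier A" for x by simp
  note [simp del] = group_star_algebra_simps
  show ?thesis
    unfolding graded_hom_def star_hom_def
  proof (intro conjI ballI allI)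
    show "(\<lambda>x. I +>\<^bsub>A\<^esub> extend_hom w x) \<in> carrier FG.\<B> \<rightarrow> carrier (cstar_quot A I)"
      using ec by (auto simp: A.quot_carrier[OF I])
    fix x
    show "I +>\<^bsub>A\<^esub> extend_hom w (c \<odot>\<^bsub>FG.\<B>\<^esub> x) = c \<odot>\<^bsub>cstar_quot A I\<^esub> (I +>\<^bsub>A\<^esub> extend_hom w x)" for c
      using A.quot_smult[OF I ec] extend_smult[of c x] by (simp add: group_star_algebra_simps(5))
    show "I +>\<^bsub>A\<^esub> extend_hom w (adj FG.\<B> x) = adj (cstar_quot A I) (I +>\<^bsub>A\<^esub> extend_hom w x)"
      using A.quot_adj[OF I ec] A.coset_eqI[OF I ec A.adj_closed[OF ec] extend_cong_adj[OF I adj]] by simp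
    fix y
    show "I +>\<^bsub>A\<^esub> extend_hom w (x \<oplus>\<^bsub>FG.\<B>\<^esub> y)
        = (I +>\<^bsub>A\<^esub> extend_hom w x) \<oplus>\<^bsub>cstar_quot A I\<^esub> (I +>\<^bsub>A\<^esub> extend_hom w y)"
      using A.quot_add[OF I ec ec] extend_add[of x y] by (simp add: group_star_algebra_simps(4))
    show "I +>\<^bsub>A\<^esub> extend_hom w (x \<otimes>\<^bsub>FG.\<B>\<^esub> y)
        = (I +>\<^bsub>A\<^esub> extend_hom w x) \<otimes>\<^bsub>cstar_quot A I\<^esub> (I +>\<^bsub>A\<^esub> extend_hom w y)"
      using A.quot_mult[OF I ec ec] A.coset_eqI[OF I ec A.mult_closed[OF ec ec] extend_cong_mult[OF I mult]] by simp
  next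
    fix g assume g: "g \<in> carrier G"
    show "(\<lambda>x. I +>\<^bsub>A\<^esub> extend_hom w x) ` group_cstar_comp G g \<subseteq> quot_comp A gcomp I g"
    proof (rule image_subsetI)
      fix x assume "x \<in> group_cstar_comp G g"
      then obtain c where "x = c \<odot>\<^bsub>FG.\<B>\<^esub> group_unitary g" by (auto simp: group_cstar_comp_def)
      then have "extend_hom w x = c \<odot>\<^bsub>A\<^esub> w g"
        using extend_smult[of c "group_unitary g"] extend_unitary[OF g] by (simp add: group_star_algebra_simps(5))
      moreover have "c \<odot>\<^bsub>A\<^esub> w g \<in> gcomp g" using A.submodule_closed(4)[OF gcomp_submodule[OF g] w[OF g]] .
      ultimately show "I +>\<^bsub>A\<^esub> extend_hom w x \<in> quot_comp A gcomp I g" by (auto simp: quot_comp_def)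
    qed
  qed
qed

end

text \<open>The unitaries of the group span the algebra, so a homomorphism is determined by its
  values on them; the induction runs over the support of \<open>x\<close>.\<close>

lemma star_hom_eq_extend:
  assumes J: "A.star_ideal J" and \<phi>: "star_hom FG.\<B> (cstar_quot A J) \<phi>"
    and v: "\<And>g. g \<in> carrier G \<Longrightarrow> v g \<in> carrier A"
    and \<phi>v: "\<And>g. g \<in> carrier G \<Longrightarrow> \<phi> (group_unitary g) = J +>\<^bsub>A\<^esub> v g"
    and x: "x \<in> carrier FG.\<B>"
  shows "\<phi> x = J +>\<^bsub>A\<^esub> extend_hom v x"
proof -
  have add: "\<phi> (x \<oplus>\<^bsub>FG.\<B>\<^esub> y) = \<phi> x \<oplus>\<^bsub>cstar_quot A J\<^esub> \<phi> y" if "x \<in> carrier FG.\<B>" "y \<in> carrier FG.\<B>" for x y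
    using \<phi> that unfolding star_hom_def by blast
  have smult: "\<phi> (c \<odot>\<^bsub>FG.\<B>\<^esub> x) = c \<odot>\<^bsub>cstar_quot A J\<^esub> \<phi> x" if "x \<in> carrier FG.\<B>" for c x
    using \<phi> that unfolding star_hom_def by blast
  have uc: "group_unitary g \<in> carrier FG.\<B>" if "g \<in> carrier G" for g
    using FG.group_unitary_closed[OF that] by simp
  let ?z = "\<lambda>x. 0 :: complex"
  \<comment> \<open>\<open>star_hom\<close> says nothing about zero explicitly, so the empty sum is
    obtained as 0 times a unitary.\<close>
  have zero: "\<phi> ?z = J +>\<^bsub>A\<^esub> \<zero>\<^bsub>A\<^esub>"
  proof -
    have "\<phi> (0 \<odot>\<^bsub>FG.\<B>\<^esub> group_unitary \<one>) = 0 \<odot>\<^bsub>cstar_quot A J\<^esub> (J +>\<^bsub>A\<^esub> v \<one>)"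
      using smult[OF uc[OF one_closed], of 0] \<phi>v[OF one_closed] by simp
    also have "\<dots> = J +>\<^bsub>A\<^esub> \<zero>\<^bsub>A\<^esub>" using A.quot_smult[OF J v[OF one_closed], of 0] v[OF one_closed] by simp
    finally show ?thesis by simp
  qed
  have "\<phi> (\<lambda>g. if g \<in> T then x g else 0) = J +>\<^bsub>A\<^esub> finsum A (\<lambda>g. x g \<odot>\<^bsub>A\<^esub> v g) T"
    if "finite T" "T \<subseteq> carrier G" for T
    using that
  proof (induction T rule: finite_induct)
    case empty
    then show ?case using zero by simp
  next
    case (insert g T)
    let ?f = "\<lambda>h. if h \<in> T then x h else 0"
    have g: "g \<in> carrier G" and T: "T \<subseteq> carrier G" using insert by auto
    have fc: "?f \<in> carrier FG.\<B>" using x by simp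
    have sc: "finsum A (\<lambda>g. x g \<odot>\<^bsub>A\<^esub> v g) T \<in> carrier A" using T v by (intro A.finsum_cl) auto
    have "(\<lambda>h. if h \<in> insert g T then x h else 0) = x g \<odot>\<^bsub>FG.\<B>\<^esub> group_unitary g \<oplus>\<^bsub>FG.\<B>\<^esub> ?f"
      using insert by (auto simp: group_unitary_def)
    then have "\<phi> (\<lambda>h. if h \<in> insert g T then x h else 0)
        = (x g \<odot>\<^bsub>cstar_quot A J\<^esub> (J +>\<^bsub>A\<^esub> v g)) \<oplus>\<^bsub>cstar_quot A J\<^esub> (J +>\<^bsub>A\<^esub> finsum A (\<lambda>g. x g \<odot>\<^bsub>A\<^esub> v g) T)"
      using add[OF FG.B.smult_cl[OF uc[OF g]] fc] smult[OF uc[OF g]] \<phi>v[OF g] insert(3)[OF T] by metis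
    also have "\<dots> = J +>\<^bsub>A\<^esub> (x g \<odot>\<^bsub>A\<^esub> v g \<oplus>\<^bsub>A\<^esub> finsum A (\<lambda>g. x g \<odot>\<^bsub>A\<^esub> v g) T)"
      using A.quot_smult[OF J v[OF g]] A.quot_add[OF J A.smult_cl[OF v[OF g]] sc] by simp
    also have "x g \<odot>\<^bsub>A\<^esub> v g \<oplus>\<^bsub>A\<^esub> finsum A (\<lambda>g. x g \<odot>\<^bsub>A\<^esub> v g) T = finsum A (\<lambda>g. x g \<odot>\<^bsub>A\<^esub> v g) (insert g T)"
      using insert v by (intro A.M.finsum_insert[symmetric]) auto
    finally show ?case .
  qed
  from this[OF finite_group order_refl]
  have "\<phi> (\<lambda>g. if g \<in> carrier G then x g else 0) = J +>\<^bsub>A\<^esub> extend_hom v x" unfolding extend_hom_def .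
  moreover have "(\<lambda>g. if g \<in> carrier G then x g else 0) = x" using x by auto
  ultimately show ?thesis by simp
qed

text \<open>Homogeneous representatives \<open>v g\<close> of the images of the unitaries satisfy
  the relations modulo \<open>J\<close>. The linear extension of the corrected family
  \<open>w\<close> is the lift: congruence of \<open>w\<close> and \<open>v\<close> modulo
  \<open>J\<close> makes the two extensions define the same coset of \<open>J\<close>.\<close>

lemma graded_hom_lift:
  assumes Jn: "\<And>n. graded_ideal G A gcomp (Jn n)" and inc: "\<And>n. Jn n \<subseteq> Jn (Suc n)"
    and J: "J = ntopology A closure_of (\<Union>n. Jn n)"
    and \<phi>: "graded_hom G FG.\<B> (group_cstar_comp G) (cstar_quot A J) (quot_comp A gcomp J) \<phi>"
  shows "\<exists>n \<psi>. graded_hom G FG.\<B> (group_cstar_comp G) (cstar_quot A (Jn n)) (quot_comp A gcomp (Jn n)) \<psi> \<and>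
    (\<forall>a\<in>carrier FG.\<B>. quot_map A J (\<psi> a) = \<phi> a)"
proof -
  have In: "A.star_ideal (Jn n)" for n
    using Jn[of n] A.closed_ideal_star_ideal unfolding graded_ideal_def by auto
  have IJ: "A.star_ideal J" and JnJ: "Jn n \<subseteq> J" for n
    using A.star_ideal_limit[OF In inc J] A.Jn_subset_limit[OF In inc J] by auto
  have hom: "star_hom FG.\<B> (cstar_quot A J) \<phi>" using \<phi> by (simp add: graded_hom_def)
  have "\<forall>g\<in>carrier G. \<exists>v. v \<in> gcomp g \<and> \<phi> (group_unitary g) = J +>\<^bsub>A\<^esub> v"
  proof
    fix g assume g: "g \<in> carrier G"
    have "group_unitary g \<in> group_cstar_comp G g"
      using FG.group_cstar_comp_iff[OF g] FG.group_unitary_closed[OF g] by (auto simp: group_unitary_def)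
    then have "\<phi> (group_unitary g) \<in> quot_comp A gcomp J g" using \<phi> g unfolding graded_hom_def by blast
    then show "\<exists>v. v \<in> gcomp g \<and> \<phi> (group_unitary g) = J +>\<^bsub>A\<^esub> v" by (auto simp: quot_comp_def)
  qed
  from bchoice[OF this] obtain v where v: "\<And>g. g \<in> carrier G \<Longrightarrow> v g \<in> gcomp g"
    and \<phi>v: "\<And>g. g \<in> carrier G \<Longrightarrow> \<phi> (group_unitary g) = J +>\<^bsub>A\<^esub> v g" by blast
  have vc: "v g \<in> carrier A" if "g \<in> carrier G" for g using gcomp_carrier v that by blast
  have uc: "group_unitary g \<in> carrier FG.\<B>" if "g \<in> carrier G" for g
    using FG.group_unitary_closed[OF that] by simp
  have v_mult: "v (g \<otimes> h) \<ominus>\<^bsub>A\<^esub> v g \<otimes>\<^bsub>A\<^esub> v h \<in> J" if g: "g \<in> carrier G" and h: "h \<in> carrier G" for g h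
  proof -
    have "J +>\<^bsub>A\<^esub> v (g \<otimes> h) = \<phi> (group_unitary g \<otimes>\<^bsub>FG.\<B>\<^esub> group_unitary h)"
      using \<phi>v[of "g \<otimes> h"] FG.group_unitary_mult[OF g h] g h by (simp del: group_star_algebra_simps)
    also have "\<dots> = \<phi> (group_unitary g) \<otimes>\<^bsub>cstar_quot A J\<^esub> \<phi> (group_unitary h)"
      using hom uc[OF g] uc[OF h] unfolding star_hom_def by blast
    also have "\<dots> = J +>\<^bsub>A\<^esub> (v g \<otimes>\<^bsub>A\<^esub> v h)"
      using \<phi>v[OF g] \<phi>v[OF h] A.quot_mult[OF IJ vc[OF g] vc[OF h]] by simp
    finally show ?thesis using A.coset_eq_iff[OF IJ] vc g h by simp
  qed
  have v_adj: "v (inv g) \<ominus>\<^bsub>A\<^esub> adj A (v g) \<in> J" if g: "g \<in> carrier G" for g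
  proof -
    have "J +>\<^bsub>A\<^esub> v (inv g) = \<phi> (adj FG.\<B> (group_unitary g))"
      using \<phi>v[of "inv g"] FG.group_unitary_adj[OF g] g by (simp del: group_star_algebra_simps)
    also have "\<dots> = adj (cstar_quot A J) (\<phi> (group_unitary g))"
      using hom uc[OF g] unfolding star_hom_def by blast
    also have "\<dots> = J +>\<^bsub>A\<^esub> adj A (v g)" using \<phi>v[OF g] A.quot_adj[OF IJ vc[OF g]] by simp
    finally show ?thesis using A.coset_eq_iff[OF IJ] vc g by simp
  qed
  obtain n w where w: "\<forall>g\<in>carrier G. w g \<in> gcomp g \<and> w g \<ominus>\<^bsub>A\<^esub> v g \<in> J \<and>
      w (inv g) \<ominus>\<^bsub>A\<^esub> adj A (w g) \<in> Jn n \<and>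
      (\<forall>h\<in>carrier G. w (g \<otimes> h) \<ominus>\<^bsub>A\<^esub> w g \<otimes>\<^bsub>A\<^esub> w h \<in> Jn n)"
    using multiplicative_lift[OF Jn inc J v v_mult v_adj] by blast
  have wg: "w g \<in> gcomp g" if "g \<in> carrier G" for g using w that by blast
  have wc: "w g \<in> carrier A" if "g \<in> carrier G" for g using gcomp_carrier wg that by blast
  have hom': "graded_hom G FG.\<B> (group_cstar_comp G) (cstar_quot A (Jn n)) (quot_comp A gcomp (Jn n))
      (\<lambda>x. Jn n +>\<^bsub>A\<^esub> extend_hom w x)"
    by (rule graded_hom_extend[OF wg In]) (use w in auto)
  have "quot_map A J (Jn n +>\<^bsub>A\<^esub> extend_hom w x) = \<phi> x" if x: "x \<in> carrier FG.\<B>" for x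
  proof -
    have ec: "extend_hom w x \<in> carrier A" "extend_hom v x \<in> carrier A"
      using extend_closed[OF wg] extend_closed[OF v] by auto
    have "extend_hom w x \<ominus>\<^bsub>A\<^esub> extend_hom v x \<in> J"
      unfolding extend_hom_def using w wc vc finite_group
      by (intro A.cong_finsum[OF IJ] A.cong_smult[OF IJ]) auto
    then show ?thesis
      using A.quot_map_coset[OF In JnJ IJ ec(1)] A.coset_eqI[OF IJ ec] star_hom_eq_extend[OF IJ hom vc \<phi>v x] by simp
  qed
  then show ?thesis using hom' by blast
qed

end

theorem theorem6p9:
  fixes G :: "('g, 'k) monoid_scheme"
  assumes "group G" and "finite (carrier G)"
  shows "graded_semiprojective TYPE('c) G (group_cstar_algebra G) (group_cstar_comp G)"
proof -
  interpret finite_group G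
    using assms by (simp add: finite_group_def finite_group_axioms_def)
  show ?thesis
    unfolding graded_semiprojective_def
    using graded_group_cstar_algebra graded_cstar_algebra.graded_hom_lift by blast
qed

end
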